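(* Let $s_1,s_2\in\overline{\mathbf R_\flat}$ be such that $s_1<\frac12$ and $s_2\le\frac12$. Then the mappings $a\mapsto\operatorname{Op}_{\mathfrak V}(a)$, $$\widehat{\mathcal B}_{s_1}(\mathbf C^{2d})\to\mathcal L(\mathcal A_{s_1}(\mathbf C^d)),\qquad \widehat{\mathcal B}_{s_1}^\star(\mathbf C^{2d})\to\mathcal L(\mathcal A_{s_1}'(\mathbf C^d)),$$ $$\widehat{\mathcal B}_{0,s_2}(\mathbf C^{2d})\to\mathcal L(\mathcal A_{0,s_2}(\mathbf C^d)),\qquad \widehat{\mathcal B}_{0,s_2}^\star(\mathbf C^{2d})\to\mathcal L(\mathcal A_{0,s_2}'(\mathbf C^d)),$$ are isomorphisms (linear bijections), where $\operatorname{Op}_{\mathfrak V}(a)$ is understood as its unique continuous extension from $\mathcal A_0(\mathbf C^d)$ to the indicated space.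
   Context: **Indices and weights.** $\mathbf N=\{0,1,2,\dots\}$. $\overline{\mathbf R_\flat}=[0,\infty)\cup\{\flat_\sigma:\sigma>0\}$, where the $\flat_\sigma$ are formal symbols, ordered so that $x_1<\flat_{\sigma_1}<\flat_{\sigma_2}<x_2$ whenever $x_1<\frac12\le x_2$ and $\sigma_1<\sigma_2$. For $r>0$ and $\alpha\in\mathbf N^d$: $\vartheta_{r,s}(\alpha)=e^{r|\alpha|^{1/(2s)}}$ if $s\in(0,\infty)$; $\vartheta_{r,s}(\alpha)=r^{|\alpha|}(\alpha!)^{1/(2\sigma)}$ if $s=\flat_\sigma$; $\vartheta_{r,0}(\alpha)=1$ if $|\alpha|\le r$ and $=\infty$ if $|\alpha|>r$. Conventions: $a/\infty=0$ for all $a\in(0,\infty]$, $\infty\cdot0=0$. For $\omega:\Lambda\to[0,\infty]$, $\ell_{[\omega]}(\Lambda)$ is the set of $c:\Lambda\to\mathbf C$ with $\|c\,\omega\|_{\ell^p(\Lambda)}<\infty$, with this (quasi-/semi-)norm, $p\in(0,\infty]$ fixed (the limit spaces below do not depend on $p$). **Spaces on $\mathbf C^d$.** $\ell_s(\mathbf N^d)=\operatorname{ind\,lim}_{r>0}\ell_{[\vartheta_{r,s}]}$, $\ell_s^\star=\operatorname{proj\,lim}_{r>0}\ell_{[1/\vartheta_{r,s}]}$, and for $s>0$, $\ell_{0,s}=\operatorname{proj\,lim}_{r>0}\ell_{[\vartheta_{r,s}]}$, $\ell_{0,s}^\star=\operatorname{ind\,lim}_{r>0}\ell_{[1/\vartheta_{r,s}]}$;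 $\ell_{0,0}=\ell_{0,0}^\star=\{0\}$. With $e_\alpha(z)=z^\alpha/\sqrt{\alpha!}$, $\mathcal A_s$, $\mathcal A_s'$, $\mathcal A_{0,s}$, $\mathcal A_{0,s}'$ (on $\mathbf C^d$) are the spaces of formal power series $F=\sum_\alpha c(F;\alpha)e_\alpha$ with coefficients in $\ell_s,\ell_s^\star,\ell_{0,s},\ell_{0,s}^\star$, with transported topologies. $\mathcal A_0$ is the space of polynomials. **Spaces on $\mathbf C^{2d}$.** On $\mathbf N^{2d}\ni(\alpha,\beta)$ put $\omega_{r_2,r_1}(\alpha,\beta)=\vartheta_{r_2,s}(\alpha)/\vartheta_{r_1,s}(\beta)$, $\omega^\star_{r_2,r_1}(\alpha,\beta)=\vartheta_{r_1,s}(\beta)/\vartheta_{r_2,s}(\alpha)$. With limits over positive parameters: $\ell_{\mathcal B,s}=\operatorname{proj\,lim}_{r_1}\operatorname{ind\,lim}_{r_2}\ell_{[\omega_{r_2,r_1}]}$, $\ell_{\mathcal B,0,s}=\operatorname{proj\,lim}_{r_2}\operatorname{ind\,lim}_{r_1}\ell_{[\omega_{r_2,r_1}]}$, $\ell_{\mathcal B,s}^\star=\operatorname{proj\,lim}_{r_2}\operatorname{ind\,lim}_{r_1}\ell_{[\omega^\star_{r_2,r_1}]}$, $\ell_{\mathcal B,0,s}^\star=\operatorname{proj\,lim}_{r_1}\operatorname{ind\,lim}_{r_2}\ell_{[\omega^\star_{r_2,r_1}]}$; $\ell_{\mathcal B,0,0}=\ell_{\mathcal B,0,0}^\star=\{0\}$.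 As sets, projective/inductive limits are intersections/unions. $\widehat{\mathcal B}_s,\widehat{\mathcal B}_{0,s},\widehat{\mathcal B}_s^\star,\widehat{\mathcal B}_{0,s}^\star$ are the spaces of formal series $a(z,w)=\sum_{\alpha,\beta}c(a;\alpha,\beta)e_\alpha(z)e_\beta(\overline w)$ with coefficients in the corresponding sequence space. **Wick operators.** For a formal series $a(z,w)=\sum_{\alpha,\beta\in\mathbf N^d}c(a;\alpha,\beta)e_\alpha(z)e_\beta(\overline w)$, let $K(z,w)=e^{(z,w)}a(z,w)$ (product of formal power series in $(z,\overline w)$, $(z,w)=\sum_jz_j\overline{w_j}$), with coefficients $c(K;\alpha,\beta)$ given by $K(z,w)=\sum_{\alpha,\beta\in\mathbf N^d}c(K;\alpha,\beta)e_\alpha(z)e_\beta(\overline w)$. The Wick operator is defined on $F\in\mathcal A_0(\mathbf C^d)$ by $\operatorname{Op}_{\mathfrak V}(a)F=\sum_\alpha\big(\sum_\beta c(K;\alpha,\beta)c(F;\beta)\big)e_\alpha$; when the integral makes sense, $\operatorname{Op}_{\mathfrak V}(a)F(z)=\pi^{-d}\int_{\mathbf C^d}a(z,w)F(w)e^{(z-w,w)}\,d\lambda(w)$. $\mathcal L(V)$ is the vector space of continuous linear maps $V\to V$. *)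

theory Defs
  imports "HOL-Analysis.Analysis"
begin

section \<open>The index set and the weights\<close>

text \<open>The constructor \<open>Flat \<sigma>\<close> stands for the formal symbol \<open>\<flat>\<^sub>\<sigma>\<close>.
  The datatype is larger than the index set of the paper; admissible indices are those in
  \<open>Rflat_bar\<close>.\<close>

datatype rflat = Num real | Flat real

definition Rflat_bar :: "rflat set" where
  "Rflat_bar = Num ` {0..} \<union> Flat ` {0<..}"

instantiation rflat :: linorder
begin

fun less_rflat :: "rflat \<Rightarrow> rflat \<Rightarrow> bool" where
  "Num x < Num y \<longleftrightarrow> x < y"
| "Num x < Flat \<sigma> \<longleftrightarrow> x < 1/2"
| "Flat \<sigma> < Num x \<longleftrightarrow> 1/2 \<le> x"
| "Flat \<sigma> < Flat \<tau> \<longleftrightarrow> \<sigma> < \<tau>"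

definition less_eq_rflat :: "rflat \<Rightarrow> rflat \<Rightarrow> bool" where
  "s \<le> t \<longleftrightarrow> s < t \<or> s = (t :: rflat)"

instance
proof
  fix x y z :: rflat
  show "x < y \<longleftrightarrow> x \<le> y \<and> \<not> y \<le> x"
    by (cases x; cases y) (auto simp: less_eq_rflat_def)
  show "x \<le> x" by (simp add: less_eq_rflat_def)
  show "x \<le> y \<Longrightarrow> y \<le> z \<Longrightarrow> x \<le> z"
    by (cases x; cases y; cases z) (auto simp: less_eq_rflat_def)
  show "x \<le> y \<Longrightarrow> y \<le> x \<Longrightarrow> x = y"
    by (cases x; cases y) (auto simp: less_eq_rflat_def)
  show "x \<le> y \<or> y \<le> x"
    by (cases x; cases y) (auto simp: less_eq_rflat_def)
qed

end

text \<open>\<open>\<nat>\<^sup>d\<close> is rendered as \<open>nat ^ 'd\<close> with \<open>d = CARD('d)\<close>,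
  and \<open>\<nat>\<^sup>2\<^sup>d\<close> as \<open>(nat ^ 'd) \<times> (nat ^ 'd)\<close>.\<close>

definition mdeg :: "nat ^ 'd \<Rightarrow> nat" where
  "mdeg \<alpha> = (\<Sum>j\<in>UNIV. \<alpha> $ j)"

definition mfact :: "nat ^ 'd \<Rightarrow> real" where
  "mfact \<alpha> = (\<Prod>j\<in>UNIV. fact (\<alpha> $ j))"

fun weight :: "real \<Rightarrow> rflat \<Rightarrow> nat ^ 'd \<Rightarrow> ennreal" where
  "weight r (Num s) \<alpha> =
     (if s = 0 then (if real (mdeg \<alpha>) \<le> r then 1 else \<infinity>)
      else ennreal (exp (r * real (mdeg \<alpha>) powr (1 / (2 * s)))))"
| "weight r (Flat \<sigma>) \<alpha> = ennreal (r ^ mdeg \<alpha> * mfact \<alpha> powr (1 / (2 * \<sigma>)))"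

section \<open>Weighted sequence spaces\<close>

text \<open>The arithmetic of \<open>ennreal\<close> agrees with the conventions used for weights:
  \<open>\<infinity> * 0 = 0\<close> and \<open>a / \<infinity> = 0\<close> for every \<open>a\<close>, including \<open>a = \<infinity>\<close>.\<close>

definition epowr :: "ennreal \<Rightarrow> real \<Rightarrow> ennreal" where
  "epowr x q = (if x = \<infinity> then \<infinity> else ennreal (enn2real x powr q))"

definition lp_norm :: "ennreal \<Rightarrow> ('i \<Rightarrow> ennreal) \<Rightarrow> ennreal" where
  "lp_norm p f =
     (if p = \<infinity> then (SUP i. f i)
      else epowr (\<Sum>\<^sub>\<infinity>i. epowr (f i) (enn2real p)) (1 / enn2real p))"

definition wnorm :: "ennreal \<Rightarrow> ('i \<Rightarrow> ennreal) \<Rightarrow> ('i \<Rightarrow> complex) \<Rightarrow> ennreal" where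
  "wnorm p \<omega> c = lp_norm p (\<lambda>i. ennreal (cmod (c i)) * \<omega> i)"

definition lp_space :: "ennreal \<Rightarrow> ('i \<Rightarrow> ennreal) \<Rightarrow> ('i \<Rightarrow> complex) set" where
  "lp_space p \<omega> = {c. wnorm p \<omega> c < \<infinity>}"

lemma istopologyI:
  assumes "\<And>S T. P S \<Longrightarrow> P T \<Longrightarrow> P (S \<inter> T)" and "\<And>\<K>. \<forall>K\<in>\<K>. P K \<Longrightarrow> P (\<Union>\<K>)"
  shows "istopology P"
  using assms unfolding istopology_def by blast

definition lp_topology :: "ennreal \<Rightarrow> ('i \<Rightarrow> ennreal) \<Rightarrow> ('i \<Rightarrow> complex) topology" where
  "lp_topology p \<omega> = topology (\<lambda>U. U \<subseteq> lp_space p \<omega> \<and>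
     (\<forall>x\<in>U. \<exists>\<epsilon>>0. \<forall>y\<in>lp_space p \<omega>. wnorm p \<omega> (\<lambda>i. y i - x i) < ennreal \<epsilon> \<longrightarrow> y \<in> U))"

lemma openin_lp_topology:
  "openin (lp_topology p \<omega>) U \<longleftrightarrow> U \<subseteq> lp_space p \<omega> \<and>
     (\<forall>x\<in>U. \<exists>\<epsilon>>0. \<forall>y\<in>lp_space p \<omega>. wnorm p \<omega> (\<lambda>i. y i - x i) < ennreal \<epsilon> \<longrightarrow> y \<in> U)"
proof -
  let ?P = "\<lambda>U. U \<subseteq> lp_space p \<omega> \<and>
     (\<forall>x\<in>U. \<exists>\<epsilon>>0. \<forall>y\<in>lp_space p \<omega>. wnorm p \<omega> (\<lambda>i. y i - x i) < ennreal \<epsilon> \<longrightarrow> y \<in> U)"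
  have I: "?P (S \<inter> T)" if S: "?P S" and T: "?P T" for S T
  proof (intro conjI ballI)
    show "S \<inter> T \<subseteq> lp_space p \<omega>" using S by blast
    fix x assume x: "x \<in> S \<inter> T"
    from S x obtain d where d: "d > 0"
      "\<forall>y\<in>lp_space p \<omega>. wnorm p \<omega> (\<lambda>i. y i - x i) < ennreal d \<longrightarrow> y \<in> S" by blast
    from T x obtain e where e: "e > 0"
      "\<forall>y\<in>lp_space p \<omega>. wnorm p \<omega> (\<lambda>i. y i - x i) < ennreal e \<longrightarrow> y \<in> T" by blast
    have "ennreal (min d e) \<le> ennreal d" "ennreal (min d e) \<le> ennreal e"
      using d(1) e(1) by (auto intro!: ennreal_leI)
    then show "\<exists>\<epsilon>>0. \<forall>y\<in>lp_space p \<omega>.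
        wnorm p \<omega> (\<lambda>i. y i - x i) < ennreal \<epsilon> \<longrightarrow> y \<in> S \<inter> T"
      using d e by (intro exI[of _ "min d e"]) (metis (no_types, lifting) IntI d(1) e(1) less_le_trans min_less_iff_conj)
  qed
  have U: "?P (\<Union>\<K>)" if "\<forall>K\<in>\<K>. ?P K" for \<K>
    proof (intro conjI ballI)
    show "\<Union>\<K> \<subseteq> lp_space p \<omega>" using that by blast
    fix x assume "x \<in> \<Union>\<K>"
    then obtain K where K: "K \<in> \<K>" "x \<in> K" by blast
    with that obtain e where "e > 0"
      "\<forall>y\<in>lp_space p \<omega>. wnorm p \<omega> (\<lambda>i. y i - x i) < ennreal e \<longrightarrow> y \<in> K" by meson
    with K(1) show "\<exists>\<epsilon>>0. \<forall>y\<in>lp_space p \<omega>.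
        wnorm p \<omega> (\<lambda>i. y i - x i) < ennreal \<epsilon> \<longrightarrow> y \<in> \<Union>\<K>" by blast
  qed
  have "istopology ?P"
    by (rule istopologyI[of ?P, OF I U])
  then show ?thesis
    unfolding lp_topology_def by (simp add: topology_inverse')
qed

lemma topspace_lp_topology [simp]: "topspace (lp_topology p \<omega>) = lp_space p \<omega>"
proof -
  have "openin (lp_topology p \<omega>) (lp_space p \<omega>)"
    by (auto simp: openin_lp_topology intro: exI[of _ 1])
  then show ?thesis
    by (metis openin_lp_topology openin_subset openin_topspace subset_antisym)
qed

section \<open>Projective and inductive limits\<close>

text \<open>Both limits are taken over families of spaces of functions \<open>'i \<Rightarrow> complex\<close> connected by
  inclusions. The projective limit carries the coarsest topology for which the inclusions into the
  steps are continuous.\<close>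

definition proj_lim :: "'r set \<Rightarrow> ('r \<Rightarrow> ('i \<Rightarrow> complex) topology) \<Rightarrow> ('i \<Rightarrow> complex) topology"
  where
  "proj_lim R X = topology_generated_by
     {(\<Inter>r\<in>R. topspace (X r)) \<inter> U | r U. r \<in> R \<and> openin (X r) U}"

text \<open>The inductive limit carries the finest locally convex topology for which the inclusions of
  the steps are continuous: a base of neighbourhoods of \<open>0\<close> is formed by the absolutely convex sets
  whose trace on every step is a neighbourhood of \<open>0\<close> in that step. The steps need not be locally
  convex themselves (\<open>lp_topology\<close> with \<open>p < 1\<close>).\<close>

definition abs_convex :: "('i \<Rightarrow> complex) set \<Rightarrow> bool" where
  "abs_convex W \<longleftrightarrow>
     (\<forall>x\<in>W. \<forall>y\<in>W. \<forall>a b. cmod a + cmod b \<le> 1 \<longrightarrow> (\<lambda>i. a * x i + b * y i) \<in> W)"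

definition ind_nhd :: "'r set \<Rightarrow> ('r \<Rightarrow> ('i \<Rightarrow> complex) topology) \<Rightarrow> ('i \<Rightarrow> complex) set \<Rightarrow> bool"
  where
  "ind_nhd R X W \<longleftrightarrow> W \<subseteq> (\<Union>r\<in>R. topspace (X r)) \<and> abs_convex W \<and>
     (\<forall>r\<in>R. \<exists>U. openin (X r) U \<and> (\<lambda>_. 0) \<in> U \<and> U \<subseteq> W)"

definition ind_lim :: "'r set \<Rightarrow> ('r \<Rightarrow> ('i \<Rightarrow> complex) topology) \<Rightarrow> ('i \<Rightarrow> complex) topology"
  where
  "ind_lim R X = topology (\<lambda>U. U \<subseteq> (\<Union>r\<in>R. topspace (X r)) \<and>
     (\<forall>x\<in>U. \<exists>W. ind_nhd R X W \<and> (\<forall>w\<in>W. (\<lambda>i. x i + w i) \<in> U)))"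

lemma ind_nhd_Int:
  assumes "ind_nhd R X W" "ind_nhd R X W'"
  shows "ind_nhd R X (W \<inter> W')"
  unfolding ind_nhd_def
proof (intro conjI ballI)
  show "W \<inter> W' \<subseteq> (\<Union>r\<in>R. topspace (X r))" "abs_convex (W \<inter> W')"
    using assms by (auto simp: ind_nhd_def abs_convex_def)
  fix r assume "r \<in> R"
  then obtain U U' where "openin (X r) U" "(\<lambda>_. 0) \<in> U" "U \<subseteq> W"
      "openin (X r) U'" "(\<lambda>_. 0) \<in> U'" "U' \<subseteq> W'"
    using assms unfolding ind_nhd_def by meson
  then show "\<exists>V. openin (X r) V \<and> (\<lambda>_. 0) \<in> V \<and> V \<subseteq> W \<inter> W'"
    by (intro exI[of _ "U \<inter> U'"]) auto
qed

lemma openin_ind_lim: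
  "openin (ind_lim R X) U \<longleftrightarrow> U \<subseteq> (\<Union>r\<in>R. topspace (X r)) \<and>
     (\<forall>x\<in>U. \<exists>W. ind_nhd R X W \<and> (\<forall>w\<in>W. (\<lambda>i. x i + w i) \<in> U))"
proof -
  let ?P = "\<lambda>U. U \<subseteq> (\<Union>r\<in>R. topspace (X r)) \<and>
     (\<forall>x\<in>U. \<exists>W. ind_nhd R X W \<and> (\<forall>w\<in>W. (\<lambda>i. x i + w i) \<in> U))"
  have I: "?P (S \<inter> T)" if S: "?P S" and T: "?P T" for S T
  proof (intro conjI ballI)
    show "S \<inter> T \<subseteq> (\<Union>r\<in>R. topspace (X r))" using S by blast
    fix x assume x: "x \<in> S \<inter> T"
    from S x obtain W where W: "ind_nhd R X W" "\<forall>w\<in>W. (\<lambda>i. x i + w i) \<in> S" by blast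
    from T x obtain W' where W': "ind_nhd R X W'" "\<forall>w\<in>W'. (\<lambda>i. x i + w i) \<in> T" by blast
    show "\<exists>W. ind_nhd R X W \<and> (\<forall>w\<in>W. (\<lambda>i. x i + w i) \<in> S \<inter> T)"
      using W W' ind_nhd_Int by (intro exI[of _ "W \<inter> W'"]) blast
  qed
  have U: "?P (\<Union>\<K>)" if "\<forall>K\<in>\<K>. ?P K" for \<K>
    proof (intro conjI ballI)
    show "\<Union>\<K> \<subseteq> (\<Union>r\<in>R. topspace (X r))" using that by blast
    fix x assume "x \<in> \<Union>\<K>"
    then obtain K where K: "K \<in> \<K>" "x \<in> K" by blast
    with that obtain W where "ind_nhd R X W" "\<forall>w\<in>W. (\<lambda>i. x i + w i) \<in> K" by meson
    with K(1) show "\<exists>W. ind_nhd R X W \<and> (\<forall>w\<in>W. (\<lambda>i. x i + w i) \<in> \<Union>\<K>)" by blast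
  qed
  have "istopology ?P"
    by (rule istopologyI[of ?P, OF I U])
  then show ?thesis
    unfolding ind_lim_def by (simp add: topology_inverse')
qed

section \<open>The sequence spaces on \<open>\<nat>\<^sup>d\<close> and \<open>\<nat>\<^sup>2\<^sup>d\<close>\<close>

definition ell :: "ennreal \<Rightarrow> rflat \<Rightarrow> (nat ^ 'd \<Rightarrow> complex) topology" where
  "ell p s = ind_lim {0<..} (\<lambda>r. lp_topology p (weight r s))"

definition ell_star :: "ennreal \<Rightarrow> rflat \<Rightarrow> (nat ^ 'd \<Rightarrow> complex) topology" where
  "ell_star p s = proj_lim {0<..} (\<lambda>r. lp_topology p (\<lambda>\<alpha>. 1 / weight r s \<alpha>))"

definition ell0 :: "ennreal \<Rightarrow> rflat \<Rightarrow> (nat ^ 'd \<Rightarrow> complex) topology" where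
  "ell0 p s = (if s = Num 0 then discrete_topology {\<lambda>_. 0}
     else proj_lim {0<..} (\<lambda>r. lp_topology p (weight r s)))"

definition ell0_star :: "ennreal \<Rightarrow> rflat \<Rightarrow> (nat ^ 'd \<Rightarrow> complex) topology" where
  "ell0_star p s = (if s = Num 0 then discrete_topology {\<lambda>_. 0}
     else ind_lim {0<..} (\<lambda>r. lp_topology p (\<lambda>\<alpha>. 1 / weight r s \<alpha>)))"

definition omega :: "rflat \<Rightarrow> real \<Rightarrow> real \<Rightarrow> (nat ^ 'd) \<times> (nat ^ 'd) \<Rightarrow> ennreal" where
  "omega s r2 r1 = (\<lambda>(\<alpha>, \<beta>). weight r2 s \<alpha> / weight r1 s \<beta>)"

definition omega_star :: "rflat \<Rightarrow> real \<Rightarrow> real \<Rightarrow> (nat ^ 'd) \<times> (nat ^ 'd) \<Rightarrow> ennreal" where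
  "omega_star s r2 r1 = (\<lambda>(\<alpha>, \<beta>). weight r1 s \<beta> / weight r2 s \<alpha>)"

definition ellB :: "ennreal \<Rightarrow> rflat \<Rightarrow> ((nat ^ 'd) \<times> (nat ^ 'd) \<Rightarrow> complex) set" where
  "ellB p s = (\<Inter>r1\<in>{0<..}. \<Union>r2\<in>{0<..}. lp_space p (omega s r2 r1))"

definition ellB_star :: "ennreal \<Rightarrow> rflat \<Rightarrow> ((nat ^ 'd) \<times> (nat ^ 'd) \<Rightarrow> complex) set" where
  "ellB_star p s = (\<Inter>r2\<in>{0<..}. \<Union>r1\<in>{0<..}. lp_space p (omega_star s r2 r1))"

definition ellB0 :: "ennreal \<Rightarrow> rflat \<Rightarrow> ((nat ^ 'd) \<times> (nat ^ 'd) \<Rightarrow> complex) set" where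
  "ellB0 p s = (if s = Num 0 then {\<lambda>_. 0}
     else (\<Inter>r2\<in>{0<..}. \<Union>r1\<in>{0<..}. lp_space p (omega s r2 r1)))"

definition ellB0_star :: "ennreal \<Rightarrow> rflat \<Rightarrow> ((nat ^ 'd) \<times> (nat ^ 'd) \<Rightarrow> complex) set" where
  "ellB0_star p s = (if s = Num 0 then {\<lambda>_. 0}
     else (\<Inter>r1\<in>{0<..}. \<Union>r2\<in>{0<..}. lp_space p (omega_star s r2 r1)))"

section \<open>Formal power series\<close>

text \<open>A formal power series is given by its coefficients with respect to the monomials:
  \<open>F\<close> stands for the sum of the \<open>F \<alpha> z\<^sup>\<alpha>\<close>, and \<open>a\<close> for the sum of the
  \<open>a (\<alpha>, \<beta>) z\<^sup>\<alpha> v\<^sup>\<beta>\<close>, where \<open>v\<close> is the conjugate of \<open>w\<close>. The functions \<open>coef\<close> and \<open>coef2\<close>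
  give the coefficients \<open>c(F; \<alpha>)\<close> and \<open>c(a; \<alpha>, \<beta>)\<close> with respect to the normalized
  monomials \<open>e\<^sub>\<alpha>(z)\<close> and \<open>e\<^sub>\<alpha>(z) e\<^sub>\<beta>(v)\<close>.\<close>

type_synonym 'd series = "nat ^ 'd \<Rightarrow> complex"
type_synonym 'd series2 = "(nat ^ 'd) \<times> (nat ^ 'd) \<Rightarrow> complex"

definition coef :: "'d::finite series \<Rightarrow> nat ^ 'd \<Rightarrow> complex" where
  "coef F \<alpha> = F \<alpha> * of_real (sqrt (mfact \<alpha>))"

definition coef2 :: "'d::finite series2 \<Rightarrow> (nat ^ 'd) \<times> (nat ^ 'd) \<Rightarrow> complex" where
  "coef2 a = (\<lambda>(\<alpha>, \<beta>). a (\<alpha>, \<beta>) * of_real (sqrt (mfact \<alpha>) * sqrt (mfact \<beta>)))"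

text \<open>The \<open>A\<close>-spaces with their topologies (the carrier is the \<open>topspace\<close>), and the carriers of
  the \<open>B\<close>-spaces.\<close>

definition A_sp :: "ennreal \<Rightarrow> rflat \<Rightarrow> 'd::finite series topology" where
  "A_sp p s = pullback_topology UNIV coef (ell p s)"

definition A_dual :: "ennreal \<Rightarrow> rflat \<Rightarrow> 'd::finite series topology" where
  "A_dual p s = pullback_topology UNIV coef (ell_star p s)"

definition A0_sp :: "ennreal \<Rightarrow> rflat \<Rightarrow> 'd::finite series topology" where
  "A0_sp p s = pullback_topology UNIV coef (ell0 p s)"

definition A0_dual :: "ennreal \<Rightarrow> rflat \<Rightarrow> 'd::finite series topology" where
  "A0_dual p s = pullback_topology UNIV coef (ell0_star p s)"

definition B_sp :: "ennreal \<Rightarrow> rflat \<Rightarrow> 'd::finite series2 set" where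
  "B_sp p s = {a. coef2 a \<in> ellB p s}"

definition B_star :: "ennreal \<Rightarrow> rflat \<Rightarrow> 'd::finite series2 set" where
  "B_star p s = {a. coef2 a \<in> ellB_star p s}"

definition B0_sp :: "ennreal \<Rightarrow> rflat \<Rightarrow> 'd::finite series2 set" where
  "B0_sp p s = {a. coef2 a \<in> ellB0 p s}"

definition B0_star :: "ennreal \<Rightarrow> rflat \<Rightarrow> 'd::finite series2 set" where
  "B0_star p s = {a. coef2 a \<in> ellB0_star p s}"

definition polynomials :: "'d::finite series set" where
  "polynomials = {F. finite {\<alpha>. F \<alpha> \<noteq> 0}}"

section \<open>Wick operators\<close>

definition fps_one :: "'i::comm_monoid_add \<Rightarrow> complex" where
  "fps_one = (\<lambda>k. if k = 0 then 1 else 0)"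

definition fps_prod :: "('i::comm_monoid_add \<Rightarrow> complex) \<Rightarrow> ('i \<Rightarrow> complex) \<Rightarrow> 'i \<Rightarrow> complex" where
  "fps_prod f g = (\<lambda>k. \<Sum>(i, j)\<in>{(i, j). i + j = k}. f i * g j)"

text \<open>Only used for series without constant term, for which all but finitely many terms vanish.\<close>

definition fps_exponential :: "('i::comm_monoid_add \<Rightarrow> complex) \<Rightarrow> 'i \<Rightarrow> complex" where
  "fps_exponential f = (\<lambda>k. \<Sum>n. (fps_prod f ^^ n) fps_one k / fact n)"

text \<open>The polynomial \<open>(z, w) = \<Sum>\<^sub>j z\<^sub>j v\<^sub>j\<close>, where \<open>v\<close> is the conjugate of \<open>w\<close>.\<close>

definition pairing :: "'d::finite series2" where
  "pairing = (\<lambda>k. \<Sum>j\<in>UNIV. if k = (axis j 1, axis j 1) then 1 else 0)"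

definition wick_kernel :: "'d::finite series2 \<Rightarrow> 'd series2" where
  "wick_kernel a = fps_prod (fps_exponential pairing) a"

text \<open>Meaningful for polynomials \<open>F\<close>; the division passes from coefficients with respect to
  \<open>e\<^sub>\<alpha>\<close> to coefficients with respect to \<open>z\<^sup>\<alpha>\<close>.\<close>

definition wick_op :: "'d::finite series2 \<Rightarrow> 'd series \<Rightarrow> 'd series" where
  "wick_op a F = (\<lambda>\<alpha>. (\<Sum>\<beta> | coef F \<beta> \<noteq> 0. coef2 (wick_kernel a) (\<alpha>, \<beta>) * coef F \<beta>)
     / of_real (sqrt (mfact \<alpha>)))"

text \<open>Maps on a space \<open>V\<close> are normalized to be \<open>undefined\<close> outside of \<open>V\<close>, so that equality
  of maps on \<open>V\<close> is equality in HOL.\<close>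

definition cont_lin :: "'d::finite series topology \<Rightarrow> ('d series \<Rightarrow> 'd series) set" where
  "cont_lin V = {T \<in> extensional (topspace V). continuous_map V V T \<and>
     (\<forall>F\<in>topspace V. \<forall>G\<in>topspace V. \<forall>c d.
        T (\<lambda>\<alpha>. c * F \<alpha> + d * G \<alpha>) = (\<lambda>\<alpha>. c * T F \<alpha> + d * T G \<alpha>))}"

text \<open>Linearity is not part of the definition of a continuous extension. All spaces considered
  contain the polynomials, except for the trivial ones \<open>A0_sp p (Num 0)\<close> and \<open>A0_dual p (Num 0)\<close>;
  on these the operator is just restricted.\<close>

definition wick_extension :: "'d::finite series topology \<Rightarrow> 'd series2 \<Rightarrow> ('d series \<Rightarrow> 'd series) \<Rightarrow> bool"
  where
  "wick_extension V a T \<longleftrightarrow> T \<in> extensional (topspace V) \<and> continuous_map V V T \<and>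
     (\<forall>F \<in> polynomials \<inter> topspace V. T F = wick_op a F)"

definition Op :: "'d::finite series topology \<Rightarrow> 'd series2 \<Rightarrow> 'd series \<Rightarrow> 'd series" where
  "Op V a = (THE T. wick_extension V a T)"

definition linear_bijection ::
  "('d::finite series2 \<Rightarrow> 'd series \<Rightarrow> 'd series) \<Rightarrow> 'd series2 set \<Rightarrow> 'd series topology \<Rightarrow> bool" where
  "linear_bijection \<Phi> B V \<longleftrightarrow> bij_betw \<Phi> B (cont_lin V) \<and>
     (\<forall>a\<in>B. \<forall>b\<in>B. \<forall>c d. (\<lambda>k. c * a k + d * b k) \<in> B \<and>
        \<Phi> (\<lambda>k. c * a k + d * b k) =
          restrict (\<lambda>F \<alpha>. c * \<Phi> a F \<alpha> + d * \<Phi> b F \<alpha>) (topspace V))"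

definition wick_isomorphism :: "'d::finite series2 set \<Rightarrow> 'd series topology \<Rightarrow> bool" where
  "wick_isomorphism B V \<longleftrightarrow>
     (\<forall>a\<in>B. \<exists>!T. wick_extension V a T) \<and> linear_bijection (Op V) B V"

end

theory Submission
  imports Defs
begin

text \<open>All four spaces are limits over one increasing scale \<open>u\<close> of weights: an inductive limit of
  the spaces \<open>\<bar>c\<bar> \<le> C u\<^sub>n\<close> or a projective limit of the spaces \<open>\<bar>c\<bar> u\<^sub>n \<le> C\<close>. Since
  \<open>M\<^bsup>|\<alpha>|\<^esup> u\<^sub>n\<close> is dominated by some \<open>u\<^sub>m\<close>, the exponent \<open>p\<close> is irrelevant, and the continuous
  linear maps of the limit are exactly the infinite matrices satisfying the obvious estimates; for
  the inductive limit the necessity is the boundedness of the image of a bounded set in some step.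
  These matrix estimates define the \<open>\<B>\<close>-spaces, applied to the kernel \<open>K\<close> instead of the
  symbol \<open>a\<close>. Finally \<open>K = e\<^bsup>(z,w)\<^esup> a\<close> and \<open>a = e\<^bsup>-(z,w)\<^esup> K\<close> satisfy the same estimates, because
  \<open>u\<^sub>n(\<alpha> + \<beta>)\<close> and \<open>u\<^sub>n(\<alpha>) u\<^sub>n(\<beta>)\<close> dominate each other up to a change of \<open>n\<close>, while the binomial
  coefficients grow at most like \<open>M\<^bsup>|\<alpha>|\<^esup>\<close>; the absorption of such factors is what requires
  \<open>s < 1/2\<close> or \<open>s \<le> 1/2\<close>.\<close>

section \<open>Weighted sequence norms\<close>

text \<open>The strict bound on \<open>s1\<close> and the non-strict one on \<open>s2\<close> come
  from the two shapes of the scale. For \<open>\<A>_s\<close> and its dual, the weights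
  \<open>1 / weight r s\<close> increase as \<open>r\<close> tends to 0, so \<open>u n\<close> is
  like \<open>exp (- k powr t / (n + 1))\<close> with \<open>k = mdeg \<alpha>\<close> and
  \<open>t = 1 / (2 * s)\<close>. Such a scale absorbs every \<open>M ^ k\<close> only for
  \<open>t > 1\<close>. For \<open>\<A>_{0,s}\<close> the scale is like
  \<open>exp ((n + 1) * k powr t)\<close>, and there \<open>t = 1\<close> suffices. The flat weights
  carry a free base \<open>r ^ k\<close> and absorb powers for either sign of the exponent. The main
  obstacle is necessity of the matrix estimate for inductive limits: a neighbourhood of zero has its
  own radius in every step, and nothing says beforehand that a map sends one step into one other.
  The countable index \<open>n\<close> allows a diagonal choice of coordinates, from which a single
  bad neighbourhood is built. The symbol-to-kernel map is inverted exactly, not just estimated: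
  multiplications by \<open>e^(t(z,w))\<close> form a one-parameter group, so \<open>t = 1\<close>
  and \<open>t = -1\<close> undo each other and one estimate for \<open>cmod t \<le> 1\<close>
  serves both directions.\<close>

lemma epowr_mono: "x \<le> y \<Longrightarrow> 0 \<le> q \<Longrightarrow> epowr x q \<le> epowr y q"
  unfolding epowr_def
  by (auto simp: top_unique intro!: ennreal_leI powr_mono2 enn2real_mono simp: less_top)

lemma epowr_epowr_inverse: "0 < q \<Longrightarrow> epowr (epowr x q) (1 / q) = x"
  by (cases x) (auto simp: epowr_def powr_powr)

text \<open>One term is at most the whole sum. With \<open>lp_norm_le\<close> this sandwiches every
  \<open>p\<close> between sup estimates.\<close>

lemma lp_norm_ge:
  assumes "0 < p" shows "f i \<le> lp_norm p f"
proof (cases "p = \<infinity>")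
  case True
  then show ?thesis by (auto simp: lp_norm_def intro: SUP_upper)
next
  case False
  define q where "q = enn2real p"
  have q: "q > 0" using assms False by (simp add: q_def enn2real_positive_iff less_top)
  have "epowr (f i) q \<le> (\<Sum>\<^sub>\<infinity>i. epowr (f i) q)"
    by (subst nonneg_infsum_complete) (auto intro!: SUP_upper2[of "{i}"])
  then have "epowr (epowr (f i) q) (1 / q) \<le> epowr (\<Sum>\<^sub>\<infinity>i. epowr (f i) q) (1 / q)"
    by (rule epowr_mono) (use q in simp)
  then show ?thesis
    using q False by (simp add: lp_norm_def epowr_epowr_inverse flip: q_def)
qed

text \<open>A majorant \<open>h\<close> that is itself in \<open>\<ell>^p\<close> turns a pointwise
  bound into a norm bound. \<open>C\<close> depends on neither \<open>K\<close> nor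
  \<open>f\<close>, so whole balls are mapped into balls; this is what comparing topologies
  requires.\<close>

lemma lp_norm_le:
  assumes p: "0 < p" and h: "\<And>i. 0 \<le> h i" "\<And>i. h i \<le> (1::real)"
    and B: "\<And>F. p \<noteq> \<infinity> \<Longrightarrow> finite F \<Longrightarrow> (\<Sum>i\<in>F. h i powr enn2real p) \<le> B"
  shows "\<exists>C>0. \<forall>K\<ge>0. \<forall>f. (\<forall>i. f i \<le> ennreal (K * h i)) \<longrightarrow> lp_norm p f \<le> ennreal (K * C)"
proof (cases "p = \<infinity>")
  case True
  have "lp_norm p f \<le> ennreal (K * 1)"
    if "0 \<le> K" "\<forall>i. f i \<le> ennreal (K * h i)" for K f
    unfolding lp_norm_def using that h True
    by (auto intro!: SUP_least order.trans[OF spec[OF that(2)]] ennreal_leI mult_left_le)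
  then show ?thesis by (intro exI[of _ 1]) auto
next
  case False
  define q where "q = enn2real p"
  have q: "q > 0" using p False by (simp add: q_def enn2real_positive_iff less_top)
  have B0: "0 \<le> B" using B[OF False, of "{}"] by simp
  show ?thesis
  \<comment> \<open>The \<open>+ 1\<close> keeps the constant positive when
    \<open>B = 0\<close>.\<close>
  proof (intro exI[of _ "(B + 1) powr (1 / q)"] conjI allI impI)
    show "0 < (B + 1) powr (1 / q)" using B0 by simp
    fix K f assume K: "0 \<le> (K::real)" and f: "\<forall>i. f i \<le> ennreal (K * h i)"
    have le: "epowr (f i) q \<le> ennreal (K powr q * h i powr q)" for i
    proof -
      have "epowr (f i) q \<le> epowr (ennreal (K * h i)) q"
        using f q by (intro epowr_mono) auto
      then show ?thesis using q K h(1)[of i] by (simp add: epowr_def powr_mult)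
    qed
    have "(\<Sum>i\<in>F. epowr (f i) q) \<le> ennreal (K powr q * (B + 1))" if "finite F" for F
    proof -
      have "(\<Sum>i\<in>F. epowr (f i) q) \<le> (\<Sum>i\<in>F. ennreal (K powr q * h i powr q))"
        by (intro sum_mono le)
      also have "\<dots> = ennreal (K powr q * (\<Sum>i\<in>F. h i powr q))"
        by (simp add: sum_ennreal sum_distrib_left)
      also have "\<dots> \<le> ennreal (K powr q * (B + 1))"
        using B[OF False that] by (intro ennreal_leI mult_left_mono) (auto simp: q_def)
      finally show ?thesis .
    qed
    then have "(\<Sum>\<^sub>\<infinity>i. epowr (f i) q) \<le> ennreal (K powr q * (B + 1))"
      by (subst nonneg_infsum_complete) (auto intro!: SUP_least)
    from epowr_mono[OF this, of "1 / q"]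
    have "lp_norm p f \<le> epowr (ennreal (K powr q * (B + 1))) (1 / q)"
      using False q by (simp add: lp_norm_def flip: q_def)
    also have "\<dots> = ennreal (K * (B + 1) powr (1 / q))"
      using K q B0 by (simp add: epowr_def powr_mult powr_powr)
    finally show "lp_norm p f \<le> ennreal (K * (B + 1) powr (1 / q))" .
  qed
qed

lemma wnorm_less_imp_bound:
  assumes "0 < p" "wnorm p \<omega> c < \<infinity>"
  obtains C where "0 < C" "\<And>i. ennreal (cmod (c i)) * \<omega> i \<le> ennreal C"
proof -
  obtain K where K: "wnorm p \<omega> c = ennreal K" "0 \<le> K" using assms(2) by (cases "wnorm p \<omega> c") auto
  have "ennreal (cmod (c i)) * \<omega> i \<le> ennreal (K + 1)" for i
    using lp_norm_ge[OF assms(1), of "\<lambda>i. ennreal (cmod (c i)) * \<omega> i" i] K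
    by (auto simp: wnorm_def intro: order.trans ennreal_leI)
  with K(2) show thesis by (intro that[of "K + 1"]) auto
qed

text \<open>Distributivity over the box below \<open>\<eta>\<close>. It reduces the geometric
  series, the number of multi-indices below a given one, and the binomial theorem to one
  variable.\<close>

lemma sum_prod_below:
  fixes f :: "'d::finite \<Rightarrow> nat \<Rightarrow> 'a::comm_ring_1" and \<eta> :: "nat ^ 'd"
  shows "(\<Sum>\<gamma> | \<gamma> \<le> \<eta>. \<Prod>j\<in>UNIV. f j (\<gamma> $ j)) = (\<Prod>j\<in>UNIV. \<Sum>k\<le>\<eta> $ j. f j k)"
proof -
  have "(\<Prod>j\<in>UNIV. \<Sum>k\<le>\<eta> $ j. f j k) = (\<Sum>g\<in>PiE UNIV (\<lambda>j. {..\<eta> $ j}). \<Prod>j\<in>UNIV. f j (g j))"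
    by (rule prod_sum_PiE) auto
  also have "\<dots> = (\<Sum>\<gamma> | \<gamma> \<le> \<eta>. \<Prod>j\<in>UNIV. f j (\<gamma> $ j))"
    by (rule sum.reindex_bij_witness[of _ "\<lambda>\<gamma> j. \<gamma> $ j" "\<lambda>g. \<chi> j. g j"])
       (auto simp: less_eq_vec_def PiE_def)
  finally show ?thesis ..
qed

lemma finite_below: "finite {\<gamma> :: nat ^ 'd::finite. \<gamma> \<le> \<eta>}"
proof -
  have "{\<gamma>. \<gamma> \<le> \<eta>} \<subseteq> (\<lambda>g. \<chi> j. g j) ` PiE UNIV (\<lambda>j. {..\<eta> $ j})"
  proof
    fix \<gamma> assume "\<gamma> \<in> {\<gamma>. \<gamma> \<le> \<eta>}"
    then show "\<gamma> \<in> (\<lambda>g. \<chi> j. g j) ` PiE UNIV (\<lambda>j. {..\<eta> $ j})"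
      by (intro image_eqI[of _ _ "\<lambda>j. \<gamma> $ j"]) (auto simp: less_eq_vec_def PiE_def)
  qed
  then show ?thesis by (rule finite_subset) (auto intro!: finite_PiE)
qed

lemma sum_half_power_mdeg_le:
  fixes F :: "(nat ^ 'd::finite) set"
  assumes "finite F" shows "(\<Sum>\<alpha>\<in>F. (1/2::real) ^ mdeg \<alpha>) \<le> 2 ^ CARD('d)"
proof -
  \<comment> \<open>Each coordinate of \<open>\<eta>\<close> is the total degree of all of
    \<open>F\<close>, so the box below \<open>\<eta>\<close> contains \<open>F\<close>.\<close>
  define \<eta> :: "nat ^ 'd" where "\<eta> = (\<chi> j. \<Sum>\<alpha>\<in>F. mdeg \<alpha>)"
  have "\<alpha> \<le> \<eta>" if "\<alpha> \<in> F" for \<alpha>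
  proof -
    have "\<alpha> $ j \<le> mdeg \<alpha>" for j unfolding mdeg_def by (rule member_le_sum) auto
    moreover have "mdeg \<alpha> \<le> (\<Sum>\<alpha>\<in>F. mdeg \<alpha>)" using that assms by (intro member_le_sum) auto
    ultimately show ?thesis by (auto simp: less_eq_vec_def \<eta>_def intro: order.trans)
  qed
  then have "(\<Sum>\<alpha>\<in>F. (1/2::real) ^ mdeg \<alpha>) \<le> (\<Sum>\<alpha> | \<alpha> \<le> \<eta>. (1/2::real) ^ mdeg \<alpha>)"
    by (intro sum_mono2 finite_below) auto
  also have "\<dots> = (\<Prod>j\<in>UNIV. \<Sum>k\<le>\<eta> $ j. (1/2::real) ^ k)"
    by (simp add: mdeg_def power_sum flip: sum_prod_below)
  also have "\<dots> \<le> (\<Prod>j\<in>(UNIV::'d set). 2)"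
  proof (intro prod_mono conjI sum_nonneg)
    fix j
    have "(\<Sum>k\<le>n. (1/2::real) ^ k) \<le> 2 - (1/2) ^ n" for n by (induction n) auto
    then show "(\<Sum>k\<le>\<eta> $ j. (1/2::real) ^ k) \<le> 2"
      by (meson diff_le_eq le_add_same_cancel1 order_trans zero_le_divide_1_iff zero_le_numeral zero_le_power)
  qed auto
  also have "\<dots> = 2 ^ CARD('d)" by simp
  finally show ?thesis .
qed

lemma summable_half_power_mdeg: "(\<lambda>\<alpha> :: nat ^ 'd::finite. (1/2::real) ^ mdeg \<alpha>) summable_on UNIV"
  using sum_half_power_mdeg_le
  by (intro nonneg_bounded_partial_sums_imp_summable_on[where C = "2 ^ CARD('d)"]) auto

text \<open>Chosen such that \<open>(gain p)\<^bsup>-|\<alpha>|\<^esup>\<close> has finite \<open>\<ell>\<^sup>p\<close> quasi-norm; it equals \<open>1\<close> for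
  \<open>p = \<infinity>\<close>, since \<open>enn2real \<infinity> = 0\<close> and \<open>1 / 0 = 0\<close>.\<close>

definition gain :: "ennreal \<Rightarrow> real" where
  "gain p = 2 powr (1 / enn2real p)"

lemma gain_ge_1: "1 \<le> gain p"
  unfolding gain_def by (intro ge_one_powr_ge_zero) auto

lemma gain_powr_le:
  assumes "0 < p" "p \<noteq> \<infinity>" shows "(1 / gain p ^ n) powr enn2real p = (1/2) ^ n"
proof -
  have "0 < enn2real p" using assms by (simp add: enn2real_positive_iff less_top)
  then show ?thesis
    by (simp add: gain_def powr_divide powr_powr flip: powr_realpow)
qed

text \<open>A finite set of pairs lies in the product of its two projections, where the sum
  factors.\<close>

lemma finite_sum_product_le:
  fixes f :: "'a \<Rightarrow> real" and g :: "'b \<Rightarrow> real"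
  assumes "\<And>i. 0 \<le> f i" "\<And>j. 0 \<le> g j"
    and "\<And>F. finite F \<Longrightarrow> sum f F \<le> A" "\<And>F. finite F \<Longrightarrow> sum g F \<le> B"
    and "finite F"
  shows "(\<Sum>(i, j)\<in>F. f i * g j) \<le> A * B"
proof -
  have "(\<Sum>(i, j)\<in>F. f i * g j) \<le> (\<Sum>(i, j)\<in>fst ` F \<times> snd ` F. f i * g j)"
    using assms by (intro sum_mono2) (auto simp: rev_image_eqI)
  also have "\<dots> = sum f (fst ` F) * sum g (snd ` F)"
    by (simp add: sum_product sum.cartesian_product)
  also have "\<dots> \<le> A * B"
    using assms by (intro mult_mono sum_nonneg) (auto intro: order.trans[OF _ assms(3)[of "{}"]])
  finally show ?thesis .
qed

lemma lp_norm_le_mdeg: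
  assumes "0 < p"
  shows "\<exists>D>0. \<forall>K\<ge>0. \<forall>f :: nat ^ 'd::finite \<Rightarrow> ennreal.
    (\<forall>\<alpha>. f \<alpha> \<le> ennreal (K * (1 / gain p ^ mdeg \<alpha>))) \<longrightarrow> lp_norm p f \<le> ennreal (K * D)"
  by (rule lp_norm_le[OF assms, of _ "2 ^ CARD('d)"])
     (use assms gain_ge_1[of p] in \<open>simp_all add: gain_powr_le sum_half_power_mdeg_le divide_le_eq
        del: power_one_over\<close>)

lemma lp_norm_le_mdeg2:
  assumes "0 < p"
  shows "\<exists>D>0. \<forall>K\<ge>0. \<forall>f :: (nat ^ 'd::finite) \<times> (nat ^ 'd) \<Rightarrow> ennreal.
    (\<forall>i. f i \<le> ennreal (K * (1 / gain p ^ mdeg (fst i) * (1 / gain p ^ mdeg (snd i)))))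
      \<longrightarrow> lp_norm p f \<le> ennreal (K * D)"
proof (rule lp_norm_le[OF assms])
  note g = gain_ge_1[of p]
  show "0 \<le> 1 / gain p ^ mdeg (fst i) * (1 / gain p ^ mdeg (snd i))" for i :: "(nat ^ 'd) \<times> (nat ^ 'd)"
    using g by simp
  show "1 / gain p ^ mdeg (fst i) * (1 / gain p ^ mdeg (snd i)) \<le> 1" for i :: "(nat ^ 'd) \<times> (nat ^ 'd)"
    using g by (intro mult_le_one) auto
  fix F :: "((nat ^ 'd) \<times> (nat ^ 'd)) set" assume F: "finite F" "p \<noteq> \<infinity>"
  have eq: "(1 / gain p ^ m * (1 / gain p ^ n)) powr enn2real p = (1/2) ^ m * (1/2) ^ n" for m n
    using g gain_powr_le[OF assms F(2)] by (subst powr_mult) auto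
  show "(\<Sum>i\<in>F. (1 / gain p ^ mdeg (fst i) * (1 / gain p ^ mdeg (snd i))) powr enn2real p)
      \<le> 2 ^ CARD('d) * 2 ^ CARD('d)"
    unfolding eq
    using finite_sum_product_le[OF _ _ sum_half_power_mdeg_le sum_half_power_mdeg_le F(1)]
    by (simp add: case_prod_unfold)
qed

text \<open>The case \<open>b = 0\<close> is consistent because \<open>0 / 0 = 0\<close> while
  \<open>a / 0 = \<infinity>\<close> for \<open>a > 0\<close>. It does occur: for
  \<open>s = 0\<close> the function \<open>h r = 1 / weight r s\<close> vanishes in high
  degree.\<close>

lemma ennreal_divide_le_iff_mult:
  assumes "b < \<infinity>" "0 < K" shows "a / b \<le> ennreal K \<longleftrightarrow> a \<le> ennreal K * b"
proof (cases "b = 0")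
  case True
  then show ?thesis using assms
    by (cases "a = 0") (auto simp: divide_ennreal_def ennreal_mult_top top_unique)
next
  case False
  with assms show ?thesis
    by (cases b; cases a)
       (auto simp: divide_ennreal ennreal_top_divide ennreal_le_iff divide_le_eq less_le top_unique simp flip: ennreal_mult split: if_splits)
qed

section \<open>Topologies of the limit spaces\<close>

text \<open>The Koethe co-echelon space of order infinity. Multiplying by \<open>w\<close> instead
  of dividing gives a zero of \<open>w n\<close> its intended meaning: the coefficient must vanish
  there.\<close>

definition ind_space :: "(nat \<Rightarrow> 'i \<Rightarrow> real) \<Rightarrow> ('i \<Rightarrow> complex) set" where
  "ind_space w = {c. \<exists>n C. \<forall>i. cmod (c i) \<le> C * w n i}"

text \<open>The radius \<open>\<epsilon>\<close> may depend on \<open>n\<close> without any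
  uniformity; the diagonal argument for continuous maps exploits this freedom.\<close>

definition ind_zero_nhd :: "(nat \<Rightarrow> 'i \<Rightarrow> real) \<Rightarrow> ('i \<Rightarrow> complex) set \<Rightarrow> bool" where
  "ind_zero_nhd w W \<longleftrightarrow> W \<subseteq> ind_space w \<and> abs_convex W \<and>
     (\<forall>n. \<exists>\<epsilon>>0. \<forall>c. (\<forall>i. cmod (c i) \<le> \<epsilon> * w n i) \<longrightarrow> c \<in> W)"

text \<open>The Koethe echelon space of order infinity.\<close>

definition proj_space :: "(nat \<Rightarrow> 'i \<Rightarrow> real) \<Rightarrow> ('i \<Rightarrow> complex) set" where
  "proj_space w = {c. \<forall>n. \<exists>C. \<forall>i. cmod (c i) * w n i \<le> C}"

definition proj_zero_nhd :: "(nat \<Rightarrow> 'i \<Rightarrow> real) \<Rightarrow> ('i \<Rightarrow> complex) set \<Rightarrow> bool" where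
  "proj_zero_nhd w W \<longleftrightarrow> W \<subseteq> proj_space w \<and> abs_convex W \<and>
     (\<exists>n. \<exists>\<epsilon>>0. \<forall>c\<in>proj_space w. (\<forall>i. cmod (c i) * w n i \<le> \<epsilon>) \<longrightarrow> c \<in> W)"

text \<open>A translation-invariant topology given by sets around zero. The sets in
  \<open>nhd\<close> need not be open, so sup-balls with non-strict inequalities qualify.\<close>

definition topology_with_zero_nhds ::
  "('i \<Rightarrow> complex) topology \<Rightarrow> ('i \<Rightarrow> complex) set \<Rightarrow> (('i \<Rightarrow> complex) set \<Rightarrow> bool) \<Rightarrow> bool" where
  "topology_with_zero_nhds V S nhd \<longleftrightarrow> (\<forall>U. openin V U \<longleftrightarrow> U \<subseteq> S \<and>
     (\<forall>x\<in>U. \<exists>W. nhd W \<and> (\<forall>w\<in>W. (\<lambda>i. x i + w i) \<in> U)))"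

text \<open>The steps of an inductive limit have weights \<open>1 / h r\<close>, those of a projective limit \<open>h r\<close>. In
  this way \<open>h\<close> takes only finite values, also for \<open>s = 0\<close>.\<close>

definition cofinal_weights :: "(nat \<Rightarrow> 'i \<Rightarrow> real) \<Rightarrow> (real \<Rightarrow> 'i \<Rightarrow> ennreal) \<Rightarrow> bool" where
  "cofinal_weights u h \<longleftrightarrow> (\<forall>n. \<exists>r>0. \<forall>i. ennreal (u n i) \<le> h r i) \<and>
     (\<forall>r>0. \<exists>n. \<forall>i. h r i \<le> ennreal (u n i))"

text \<open>Sup-balls are open in every \<open>\<ell>\<^sup>p\<close> topology, whereas \<open>p\<close>-balls would require Minkowski's
  inequality or its substitute for \<open>p < 1\<close>.\<close>

lemma openin_lp_sup_ball:
  assumes "0 < p"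
  shows "openin (lp_topology p \<omega>)
    {y \<in> lp_space p \<omega>. \<exists>t. 0 \<le> t \<and> t < \<epsilon> \<and> (\<forall>i. ennreal (cmod (y i - x i)) * \<omega> i \<le> ennreal t)}"
  unfolding openin_lp_topology
proof (intro conjI ballI)
  fix y assume "y \<in> {y \<in> lp_space p \<omega>. \<exists>t. 0 \<le> t \<and> t < \<epsilon> \<and> (\<forall>i. ennreal (cmod (y i - x i)) * \<omega> i \<le> ennreal t)}"
  then obtain t where t: "0 \<le> t" "t < \<epsilon>" "\<And>i. ennreal (cmod (y i - x i)) * \<omega> i \<le> ennreal t" by auto
  \<comment> \<open>The set asks for one bound \<open>t < \<epsilon>\<close> common to all
    coordinates. The gap \<open>\<epsilon> - t\<close> is the uniform room for a perturbation; a
    coordinatewise strict inequality would leave none.\<close>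
  define \<delta> where "\<delta> = (\<epsilon> - t) / 2"
  have \<delta>: "\<delta> > 0" "\<delta> + t < \<epsilon>" using t by (auto simp: \<delta>_def field_simps)
  have "\<exists>t. 0 \<le> t \<and> t < \<epsilon> \<and> (\<forall>i. ennreal (cmod (z i - x i)) * \<omega> i \<le> ennreal t)"
    if z: "wnorm p \<omega> (\<lambda>i. z i - y i) < ennreal \<delta>" for z
  proof (intro exI[of _ "\<delta> + t"] conjI allI)
    fix i
    have "ennreal (cmod (z i - y i)) * \<omega> i \<le> ennreal \<delta>"
      using lp_norm_ge[OF assms, of "\<lambda>i. ennreal (cmod (z i - y i)) * \<omega> i" i] z
      by (auto simp: wnorm_def)
    moreover have "cmod (z i - x i) \<le> cmod (z i - y i) + cmod (y i - x i)"
      by norm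
    then have "ennreal (cmod (z i - x i)) \<le> ennreal (cmod (z i - y i)) + ennreal (cmod (y i - x i))"
      by (simp flip: ennreal_plus)
    then have "ennreal (cmod (z i - x i)) * \<omega> i \<le>
        ennreal (cmod (z i - y i)) * \<omega> i + ennreal (cmod (y i - x i)) * \<omega> i"
      by (metis distrib_right mult_right_mono zero_le)
    ultimately show "ennreal (cmod (z i - x i)) * \<omega> i \<le> ennreal (\<delta> + t)"
      using t(1) t(3)[of i] \<delta>(1) by (auto simp: ennreal_plus intro: order.trans add_mono)
  qed (use \<delta> t in auto)
  with \<delta>(1) show "\<exists>\<delta>>0. \<forall>z\<in>lp_space p \<omega>. wnorm p \<omega> (\<lambda>i. z i - y i) < ennreal \<delta> \<longrightarrow>
      z \<in> {y \<in> lp_space p \<omega>. \<exists>t. 0 \<le> t \<and> t < \<epsilon> \<and> (\<forall>i. ennreal (cmod (y i - x i)) * \<omega> i \<le> ennreal t)}"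
    by blast
qed auto

section \<open>Abstract weight scales and their comparison with the l^p steps\<close>

locale weight_family =
  fixes u :: "nat \<Rightarrow> 'i \<Rightarrow> real"
  assumes nonneg: "0 \<le> u n i"
    and mono: "n \<le> m \<Longrightarrow> u n i \<le> u m i"
    and pos: "\<exists>n. 0 < u n i"

text \<open>\<open>absorb_power\<close> yields independence of \<open>p\<close> and summability of
  matrix rows, and swallows binomial coefficients. \<open>split_add\<close> and
  \<open>join_add\<close> serve the multiplication of a symbol by an exponential.\<close>

locale weight_scale = weight_family u for u :: "nat \<Rightarrow> nat ^ 'd::finite \<Rightarrow> real" +
  assumes absorb_power: "1 \<le> M \<Longrightarrow> \<exists>m. \<exists>C>0. \<forall>\<alpha>. M ^ mdeg \<alpha> * u n \<alpha> \<le> C * u m \<alpha>"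
    and split_add: "\<exists>m. \<exists>C>0. \<forall>\<alpha> \<beta>. u n (\<alpha> + \<beta>) \<le> C * (u m \<alpha> * u m \<beta>)"
    and join_add: "\<exists>m. \<exists>C>0. \<forall>\<alpha> \<beta>. u n \<alpha> * u n \<beta> \<le> C * u m (\<alpha> + \<beta>)"

locale weight_limit = weight_scale u for u :: "nat \<Rightarrow> nat ^ 'd::finite \<Rightarrow> real" +
  fixes h :: "real \<Rightarrow> nat ^ 'd \<Rightarrow> ennreal" and p :: ennreal
  assumes cofinal: "cofinal_weights u h" and p: "0 < p"
begin

lemma below_step: "\<exists>r>0. \<forall>\<alpha>. ennreal (u n \<alpha>) \<le> h r \<alpha>"
  and above_step: "0 < r \<Longrightarrow> \<exists>n. \<forall>\<alpha>. h r \<alpha> \<le> ennreal (u n \<alpha>)"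
  using cofinal by (auto simp: cofinal_weights_def)

lemma step_finite: "0 < r \<Longrightarrow> h r \<alpha> < \<infinity>"
  using above_step[of r] by (auto intro: le_less_trans)

text \<open>Moving from \<open>u n\<close> to \<open>u m\<close> gains the factor
  \<open>1 / gain p ^ mdeg \<alpha>\<close>, which has finite \<open>p\<close>-norm. Hence a
  sup-ball of one step is bounded in the \<open>p\<close>-norm of another.\<close>

lemma ind_wnorm_le:
  "\<exists>r>0. \<exists>D>0. \<forall>K>0. \<forall>c. (\<forall>\<alpha>. cmod (c \<alpha>) \<le> K * u n \<alpha>) \<longrightarrow>
     wnorm p (\<lambda>\<alpha>. 1 / h r \<alpha>) c \<le> ennreal (K * D)"
proof -
  obtain m C where C: "C > 0" "\<And>\<alpha>. gain p ^ mdeg \<alpha> * u n \<alpha> \<le> C * u m \<alpha>"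
    using absorb_power[OF gain_ge_1] by blast
  obtain r where r: "r > 0" "\<And>\<alpha>. ennreal (u m \<alpha>) \<le> h r \<alpha>" using below_step by blast
  obtain D where D: "0 < D" "\<And>K (f :: nat ^ 'd \<Rightarrow> ennreal). 0 \<le> K \<Longrightarrow>
      (\<And>\<alpha>. f \<alpha> \<le> ennreal (K * (1 / gain p ^ mdeg \<alpha>))) \<Longrightarrow> lp_norm p f \<le> ennreal (K * D)"
    using lp_norm_le_mdeg[OF p] by meson
  have "wnorm p (\<lambda>\<alpha>. 1 / h r \<alpha>) c \<le> ennreal (K * C * D)"
    if K: "K > 0" and c: "\<And>\<alpha>. cmod (c \<alpha>) \<le> K * u n \<alpha>" for K c
    unfolding wnorm_def
  proof (rule D(2))
    fix \<alpha> :: "nat ^ 'd"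
    define G where "G = gain p ^ mdeg \<alpha>"
    have G: "G > 0" using gain_ge_1[of p] by (simp add: G_def)
    have "cmod (c \<alpha>) \<le> K * (C * u m \<alpha> / G)"
    proof -
      have "cmod (c \<alpha>) * G \<le> K * u n \<alpha> * G" using c G by simp
      also have "\<dots> \<le> K * (C * u m \<alpha>)"
        using mult_left_mono[OF C(2)[of \<alpha>], of K] K by (simp add: G_def algebra_simps)
      finally show ?thesis using G by (simp add: field_simps)
    qed
    then have "ennreal (cmod (c \<alpha>)) \<le> ennreal (K * C * (1 / G)) * ennreal (u m \<alpha>)"
      using K C G nonneg by (auto simp: field_simps intro!: ennreal_leI simp flip: ennreal_mult)
    also have "\<dots> \<le> ennreal (K * C * (1 / G)) * h r \<alpha>" by (intro mult_left_mono r) auto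
    finally have "ennreal (cmod (c \<alpha>)) / h r \<alpha> \<le> ennreal (K * C * (1 / G))"
      using K C G step_finite[OF r(1)] by (subst ennreal_divide_le_iff_mult) auto
    then show "ennreal (cmod (c \<alpha>)) * (1 / h r \<alpha>) \<le> ennreal (K * C * (1 / gain p ^ mdeg \<alpha>))"
      by (simp add: G_def ennreal_times_divide)
  qed (use K C in auto)
  then show ?thesis using r(1) C(1) D(1)
    by (intro exI[of _ r] conjI exI[of _ "C * D"]) (auto simp: mult.assoc)
qed

text \<open>The way back from a step to sup estimates, with the same constant \<open>K\<close>:
  balls stay balls of the same radius.\<close>

lemma ind_bound:
  "0 < r \<Longrightarrow> \<exists>n. \<forall>K>0. \<forall>c. (\<forall>\<alpha>. ennreal (cmod (c \<alpha>)) * (1 / h r \<alpha>) \<le> ennreal K) \<longrightarrow>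
     (\<forall>\<alpha>. cmod (c \<alpha>) \<le> K * u n \<alpha>)"
proof -
  assume r: "0 < r"
  obtain n where n: "\<And>\<alpha>. h r \<alpha> \<le> ennreal (u n \<alpha>)" using above_step[OF r] by blast
  have "cmod (c \<alpha>) \<le> K * u n \<alpha>"
    if K: "K > 0" "\<And>\<alpha>. ennreal (cmod (c \<alpha>)) * (1 / h r \<alpha>) \<le> ennreal K" for K c \<alpha>
  proof -
    have "ennreal (cmod (c \<alpha>)) \<le> ennreal K * h r \<alpha>"
      using K(2)[of \<alpha>] K(1) step_finite[OF r]
      by (simp add: ennreal_times_divide ennreal_divide_le_iff_mult)
    also have "\<dots> \<le> ennreal K * ennreal (u n \<alpha>)" by (intro mult_left_mono n) auto
    finally show ?thesis using K nonneg by (simp flip: ennreal_mult)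
  qed
  then show ?thesis by blast
qed

text \<open>The gain is used as for the inductive limit, but now the step \<open>r\<close> is given
  and the sup estimate is chosen after it.\<close>

lemma proj_wnorm_le:
  "0 < r \<Longrightarrow> \<exists>n. \<exists>D>0. \<forall>K>0. \<forall>c. (\<forall>\<alpha>. cmod (c \<alpha>) * u n \<alpha> \<le> K) \<longrightarrow>
     wnorm p (h r) c \<le> ennreal (K * D)"
proof -
  assume r: "0 < r"
  obtain n where n: "\<And>\<alpha>. h r \<alpha> \<le> ennreal (u n \<alpha>)" using above_step[OF r] by blast
  obtain m C where C: "C > 0" "\<And>\<alpha>. gain p ^ mdeg \<alpha> * u n \<alpha> \<le> C * u m \<alpha>"
    using absorb_power[OF gain_ge_1] by blast
  obtain D where D: "0 < D" "\<And>K (f :: nat ^ 'd \<Rightarrow> ennreal). 0 \<le> K \<Longrightarrow>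
      (\<And>\<alpha>. f \<alpha> \<le> ennreal (K * (1 / gain p ^ mdeg \<alpha>))) \<Longrightarrow> lp_norm p f \<le> ennreal (K * D)"
    using lp_norm_le_mdeg[OF p] by meson
  have "wnorm p (h r) c \<le> ennreal (K * C * D)"
    if K: "K > 0" and c: "\<And>\<alpha>. cmod (c \<alpha>) * u m \<alpha> \<le> K" for K c
    unfolding wnorm_def
  proof (rule D(2))
    fix \<alpha> :: "nat ^ 'd"
    define G where "G = gain p ^ mdeg \<alpha>"
    have G: "G > 0" using gain_ge_1[of p] by (simp add: G_def)
    have "ennreal (cmod (c \<alpha>)) * h r \<alpha> \<le> ennreal (cmod (c \<alpha>)) * ennreal (u n \<alpha>)"
      by (intro mult_left_mono n) auto
    also have "\<dots> = ennreal (cmod (c \<alpha>) * u n \<alpha>)" using nonneg by (simp add: ennreal_mult)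
    also have "\<dots> \<le> ennreal (K * C * (1 / G))"
    proof (rule ennreal_leI)
      have "cmod (c \<alpha>) * (G * u n \<alpha>) \<le> cmod (c \<alpha>) * (C * u m \<alpha>)"
        by (intro mult_left_mono) (use C(2)[of \<alpha>] in \<open>auto simp: G_def\<close>)
      also have "\<dots> \<le> K * C" using mult_left_mono[OF c[of \<alpha>], of C] C(1) by (simp add: algebra_simps)
      finally show "cmod (c \<alpha>) * u n \<alpha> \<le> K * C * (1 / G)" using G by (simp add: field_simps)
    qed
    finally show "ennreal (cmod (c \<alpha>)) * h r \<alpha> \<le> ennreal (K * C * (1 / gain p ^ mdeg \<alpha>))"
      by (simp add: G_def)
  qed (use K C in auto)
  then show ?thesis using C(1) D(1)
    by (intro exI[of _ m] conjI exI[of _ "C * D"]) (auto simp: mult.assoc)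
qed

lemma proj_bound:
  "\<exists>r>0. \<forall>K\<ge>0. \<forall>c. (\<forall>\<alpha>. ennreal (cmod (c \<alpha>)) * h r \<alpha> \<le> ennreal K) \<longrightarrow>
     (\<forall>\<alpha>. cmod (c \<alpha>) * u n \<alpha> \<le> K)"
proof -
  obtain r where r: "r > 0" "\<And>\<alpha>. ennreal (u n \<alpha>) \<le> h r \<alpha>" using below_step by blast
  have "cmod (c \<alpha>) * u n \<alpha> \<le> K"
    if K: "K \<ge> 0" "\<And>\<alpha>. ennreal (cmod (c \<alpha>)) * h r \<alpha> \<le> ennreal K" for K c \<alpha>
  proof -
    have "ennreal (cmod (c \<alpha>)) * ennreal (u n \<alpha>) \<le> ennreal (cmod (c \<alpha>)) * h r \<alpha>"
      by (intro mult_left_mono r) auto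
    also have "\<dots> \<le> ennreal K" by (rule K)
    finally show ?thesis using K nonneg by (simp flip: ennreal_mult)
  qed
  with r(1) show ?thesis by blast
qed

end

lemma abs_convexD:
  "abs_convex W \<Longrightarrow> x \<in> W \<Longrightarrow> y \<in> W \<Longrightarrow> cmod a + cmod b \<le> 1 \<Longrightarrow> (\<lambda>i. a * x i + b * y i) \<in> W"
  by (simp add: abs_convex_def)

context weight_family begin

lemma ind_space_linear:
  assumes "x \<in> ind_space u" "y \<in> ind_space u" shows "(\<lambda>i. a * x i + b * y i) \<in> ind_space u"
proof -
  obtain n C where n: "\<And>i. cmod (x i) \<le> C * u n i" using assms by (auto simp: ind_space_def)
  obtain m D where m: "\<And>i. cmod (y i) \<le> D * u m i" using assms by (auto simp: ind_space_def)
  have "cmod (a * x i + b * y i) \<le> (cmod a * \<bar>C\<bar> + cmod b * \<bar>D\<bar>) * u (max n m) i" for i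
  proof -
    have "cmod (x i) \<le> \<bar>C\<bar> * u (max n m) i"
      using mult_mono[OF abs_ge_self[of C] mono[of n "max n m" i]] n[of i] nonneg by fastforce
    moreover have "cmod (y i) \<le> \<bar>D\<bar> * u (max n m) i"
      using mult_mono[OF abs_ge_self[of D] mono[of m "max n m" i]] m[of i] nonneg by fastforce
    ultimately have "cmod a * cmod (x i) + cmod b * cmod (y i) \<le>
        cmod a * (\<bar>C\<bar> * u (max n m) i) + cmod b * (\<bar>D\<bar> * u (max n m) i)"
      by (intro add_mono mult_left_mono) auto
    then show ?thesis
      using norm_triangle_ineq[of "a * x i" "b * y i"] by (simp add: norm_mult algebra_simps)
  qed
  then show ?thesis by (auto simp: ind_space_def)
qed

lemma proj_space_linear:
  assumes "x \<in> proj_space u" "y \<in> proj_space u" shows "(\<lambda>i. a * x i + b * y i) \<in> proj_space u"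
  unfolding proj_space_def
proof (intro CollectI allI)
  fix n
  obtain C where n: "\<And>i. cmod (x i) * u n i \<le> C" using assms unfolding proj_space_def by blast
  obtain D where m: "\<And>i. cmod (y i) * u n i \<le> D" using assms unfolding proj_space_def by blast
  have "cmod (a * x i + b * y i) * u n i \<le> cmod a * C + cmod b * D" for i
  proof -
    have "cmod (a * x i + b * y i) * u n i \<le> (cmod a * cmod (x i) + cmod b * cmod (y i)) * u n i"
      using norm_triangle_ineq[of "a * x i" "b * y i"] nonneg
      by (intro mult_right_mono) (auto simp: norm_mult)
    also have "\<dots> \<le> cmod a * C + cmod b * D"
      using mult_left_mono[OF n[of i], of "cmod a"] mult_left_mono[OF m[of i], of "cmod b"]
      by (simp add: algebra_simps)
    finally show ?thesis .
  qed
  then show "\<exists>C. \<forall>i. cmod (a * x i + b * y i) * u n i \<le> C" by blast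
qed

end

text \<open>The indirection through \<open>f\<close> lets the same coordinate be constrained
  repeatedly with different bounds, as happens along a sequence \<open>f N\<close> of
  coordinates.\<close>

lemma abs_convex_bounded:
  assumes "\<And>x y a b. x \<in> S \<Longrightarrow> y \<in> S \<Longrightarrow> (\<lambda>i. a * x i + b * y i) \<in> S"
    and "\<And>i. 0 \<le> v i"
  shows "abs_convex {c \<in> S. \<forall>i\<in>I. cmod (c (f i)) * v i \<le> (t i :: real)}"
  unfolding abs_convex_def
proof (intro ballI allI impI)
  fix x y a b
  assume x: "x \<in> {c \<in> S. \<forall>i\<in>I. cmod (c (f i)) * v i \<le> t i}"
    and y: "y \<in> {c \<in> S. \<forall>i\<in>I. cmod (c (f i)) * v i \<le> t i}" and ab: "cmod a + cmod b \<le> 1"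
  have "cmod (a * x (f i) + b * y (f i)) * v i \<le> t i" if i: "i \<in> I" for i
  proof -
    \<comment> \<open>Nonnegativity of \<open>t i\<close> is inherited from the membership of
      \<open>x\<close>.\<close>
    have t: "0 \<le> t i" using x i assms(2)[of i] by (auto intro: order.trans[of 0 "cmod (x (f i)) * v i"])
    have "cmod (a * x (f i) + b * y (f i)) * v i \<le> (cmod a * cmod (x (f i)) + cmod b * cmod (y (f i))) * v i"
      using norm_triangle_ineq[of "a * x (f i)" "b * y (f i)"] assms(2)[of i]
      by (intro mult_right_mono) (auto simp: norm_mult)
    also have "\<dots> = cmod a * (cmod (x (f i)) * v i) + cmod b * (cmod (y (f i)) * v i)"
      by (simp add: algebra_simps)
    also have "\<dots> \<le> cmod a * t i + cmod b * t i"
      using x y i by (intro add_mono mult_left_mono) auto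
    also have "\<dots> \<le> t i" using mult_right_mono[OF ab t] by (simp add: algebra_simps)
    finally show ?thesis .
  qed
  then show "(\<lambda>i. a * x i + b * y i) \<in> {c \<in> S. \<forall>i\<in>I. cmod (c (f i)) * v i \<le> t i}"
    using assms x y by auto
qed

section \<open>The limit topologies described by sup estimates\<close>

context weight_limit begin

abbreviation "ind_step \<equiv> (\<lambda>r. lp_topology p (\<lambda>\<alpha>. 1 / h r \<alpha>))"

lemma ind_step_union: "(\<Union>r\<in>{0<..}. lp_space p (\<lambda>\<alpha>. 1 / h r \<alpha>)) = ind_space u"
proof (intro equalityI subsetI)
  fix c assume "c \<in> (\<Union>r\<in>{0<..}. lp_space p (\<lambda>\<alpha>. 1 / h r \<alpha>))"
  then obtain r where r: "r > 0" "wnorm p (\<lambda>\<alpha>. 1 / h r \<alpha>) c < \<infinity>" by (auto simp: lp_space_def)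
  then show "c \<in> ind_space u"
    using wnorm_less_imp_bound[OF p r(2)] ind_bound[OF r(1)]
    unfolding ind_space_def mem_Collect_eq by metis
next
  fix c assume "c \<in> ind_space u"
  then obtain n C where c: "\<And>i. cmod (c i) \<le> C * u n i" by (auto simp: ind_space_def)
  have "cmod (c i) \<le> (\<bar>C\<bar> + 1) * u n i" for i
    using c[of i] mult_right_mono[of C "\<bar>C\<bar> + 1" "u n i"] nonneg[of n i] by linarith
  then obtain r D where "r > 0" "wnorm p (\<lambda>\<alpha>. 1 / h r \<alpha>) c \<le> ennreal ((\<bar>C\<bar> + 1) * D)"
    using ind_wnorm_le[of n] by (metis abs_ge_zero add_nonneg_pos zero_less_one)
  then show "c \<in> (\<Union>r\<in>{0<..}. lp_space p (\<lambda>\<alpha>. 1 / h r \<alpha>))"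
    by (auto simp: lp_space_def intro!: bexI[of _ r] elim: le_less_trans)
qed

text \<open>From left to right, sup-balls lie in \<open>p\<close>-balls of a suitable step;
  conversely, open sup-balls of a step lie in sup-balls of the scale. So the same sets are
  neighbourhoods for all \<open>p\<close>.\<close>

lemma ind_nhd_iff: "ind_nhd {0<..} ind_step W \<longleftrightarrow> ind_zero_nhd u W"
proof
  assume W: "ind_nhd {0<..} ind_step W"
  have "\<exists>\<epsilon>>0. \<forall>c. (\<forall>i. cmod (c i) \<le> \<epsilon> * u n i) \<longrightarrow> c \<in> W" for n
  proof -
    obtain r D where r: "r > 0" "D > 0" and D: "\<And>K c. K > 0 \<Longrightarrow> (\<And>\<alpha>. cmod (c \<alpha>) \<le> K * u n \<alpha>) \<Longrightarrow>
        wnorm p (\<lambda>\<alpha>. 1 / h r \<alpha>) c \<le> ennreal (K * D)"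
      using ind_wnorm_le[of n] by blast
    obtain U where U: "openin (ind_step r) U" "(\<lambda>_. 0) \<in> U" "U \<subseteq> W"
      using W r(1) unfolding ind_nhd_def by (meson greaterThan_iff)
    then obtain \<epsilon> where \<epsilon>: "\<epsilon> > 0"
      "\<And>y. y \<in> lp_space p (\<lambda>\<alpha>. 1 / h r \<alpha>) \<Longrightarrow> wnorm p (\<lambda>\<alpha>. 1 / h r \<alpha>) (\<lambda>i. y i - 0) < ennreal \<epsilon> \<Longrightarrow> y \<in> U"
      unfolding openin_lp_topology by meson
    \<comment> \<open>The factor 2 turns the bound of \<open>ind_wnorm_le\<close> into the strict
      inequality in the definition of open sets.\<close>
    have "c \<in> W" if "\<forall>i. cmod (c i) \<le> \<epsilon> / (2 * D) * u n i" for c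
    proof -
      have "wnorm p (\<lambda>\<alpha>. 1 / h r \<alpha>) c \<le> ennreal (\<epsilon> / (2 * D) * D)"
        by (rule D) (use that \<epsilon> r in auto)
      also have "\<dots> < ennreal \<epsilon>" using r \<epsilon> by (intro ennreal_lessI) auto
      finally have *: "wnorm p (\<lambda>\<alpha>. 1 / h r \<alpha>) c < ennreal \<epsilon>" .
      then have "c \<in> U" by (intro \<epsilon>(2)) (auto simp: lp_space_def intro: less_trans)
      then show ?thesis using U by blast
    qed
    then show ?thesis using \<epsilon> r by (intro exI[of _ "\<epsilon> / (2 * D)"]) auto
  qed
  then show "ind_zero_nhd u W"
    using W ind_step_union by (auto simp: ind_zero_nhd_def ind_nhd_def)
next
  assume W: "ind_zero_nhd u W"
  have "\<exists>U. openin (ind_step r) U \<and> (\<lambda>_. 0) \<in> U \<and> U \<subseteq> W" if r: "r > 0" for r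
  proof -
    obtain n where n: "\<And>K c \<alpha>. K > 0 \<Longrightarrow> (\<And>\<alpha>. ennreal (cmod (c \<alpha>)) * (1 / h r \<alpha>) \<le> ennreal K) \<Longrightarrow>
        cmod (c \<alpha>) \<le> K * u n \<alpha>" using ind_bound[OF r] by blast
    obtain \<epsilon> where \<epsilon>: "\<epsilon> > 0" "\<And>c. (\<And>i. cmod (c i) \<le> \<epsilon> * u n i) \<Longrightarrow> c \<in> W"
      using W unfolding ind_zero_nhd_def by meson
    \<comment> \<open>The sup-ball about zero serves as the open set; its coordinatewise bound feeds
      directly into \<open>ind_bound\<close>.\<close>
    let ?U = "{y \<in> lp_space p (\<lambda>\<alpha>. 1 / h r \<alpha>). \<exists>t. 0 \<le> t \<and> t < \<epsilon> \<and>
      (\<forall>i. ennreal (cmod (y i - 0)) * (1 / h r i) \<le> ennreal t)}"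
    have "y \<in> W" if y: "y \<in> ?U" for y
    proof (rule \<epsilon>(2), rule n)
      obtain t where t: "t < \<epsilon>" "\<And>i. ennreal (cmod (y i)) * (1 / h r i) \<le> ennreal t"
        using y by auto
      show "ennreal (cmod (y i)) * (1 / h r i) \<le> ennreal \<epsilon>" for i
        using t by (meson ennreal_leI less_imp_le order_trans)
    qed (use \<epsilon> in auto)
    moreover have "(\<lambda>_. 0) \<in> ?U" using \<epsilon>(1)
    proof -
      have "wnorm p (\<lambda>\<alpha>. 1 / h r \<alpha>) (\<lambda>_. 0) < \<infinity>"
        by (auto simp: wnorm_def lp_norm_def epowr_def)
      then show ?thesis using \<epsilon>(1) by (auto simp: lp_space_def intro: exI[of _ 0])
    qed
    moreover have "openin (ind_step r) ?U" by (rule openin_lp_sup_ball[OF p])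
    ultimately show ?thesis by blast
  qed
  then show "ind_nhd {0<..} ind_step W"
    using W ind_step_union by (auto simp: ind_zero_nhd_def ind_nhd_def)
qed

lemma ind_lim_topology:
  "topology_with_zero_nhds (ind_lim {0<..} ind_step) (ind_space u) (ind_zero_nhd u)"
  unfolding topology_with_zero_nhds_def openin_ind_lim
  by (simp add: ind_nhd_iff ind_step_union)

lemma proj_step_inter: "(\<Inter>r\<in>{0<..}. lp_space p (h r)) = proj_space u"
proof (intro equalityI subsetI)
  fix c assume c: "c \<in> (\<Inter>r\<in>{0<..}. lp_space p (h r))"
  show "c \<in> proj_space u" unfolding proj_space_def
  proof (intro CollectI allI)
    fix n
    obtain r where r: "r > 0" "\<And>K c \<alpha>. K \<ge> 0 \<Longrightarrow>
        (\<And>\<alpha>. ennreal (cmod (c \<alpha>)) * h r \<alpha> \<le> ennreal K) \<Longrightarrow> cmod (c \<alpha>) * u n \<alpha> \<le> K"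
      using proj_bound[of n] by blast
    have "wnorm p (h r) c < \<infinity>" using c r by (auto simp: lp_space_def)
    from wnorm_less_imp_bound[OF p this] r(2) show "\<exists>C. \<forall>i. cmod (c i) * u n i \<le> C"
      by (metis less_imp_le)
  qed
next
  fix c assume c: "c \<in> proj_space u"
  have "wnorm p (h r) c < \<infinity>" if r: "r > 0" for r
  proof -
    obtain n D where n: "D > 0" "\<And>K c. K > 0 \<Longrightarrow> (\<And>\<alpha>. cmod (c \<alpha>) * u n \<alpha> \<le> K) \<Longrightarrow>
        wnorm p (h r) c \<le> ennreal (K * D)" using proj_wnorm_le[OF r] by blast
    obtain C where "\<And>i. cmod (c i) * u n i \<le> C" using c by (auto simp: proj_space_def)
    then have "wnorm p (h r) c \<le> ennreal ((\<bar>C\<bar> + 1) * D)"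
      by (intro n(2)) (auto intro: order.trans[OF _ add_increasing2[OF zero_le_one abs_ge_self]])
    then show ?thesis by (auto elim: le_less_trans)
  qed
  then show "c \<in> (\<Inter>r\<in>{0<..}. lp_space p (h r))" by (auto simp: lp_space_def)
qed

text \<open>The generating sets give a subbase only. Since \<open>u\<close> increases in
  \<open>n\<close>, a ball for \<open>max n m\<close> lies in the intersection of balls for
  \<open>n\<close> and \<open>m\<close>, so the sup-balls already form a base of
  neighbourhoods.\<close>

lemma openin_proj_lim:
  "openin (proj_lim {0<..} (\<lambda>r. lp_topology p (h r))) U \<longleftrightarrow> U \<subseteq> proj_space u \<and>
     (\<forall>x\<in>U. \<exists>n. \<exists>\<epsilon>>0. \<forall>y\<in>proj_space u. (\<forall>i. cmod (y i - x i) * u n i \<le> \<epsilon>) \<longrightarrow> y \<in> U)"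
  (is "_ \<longleftrightarrow> ?P U")
proof
  let ?G = "{(\<Inter>r\<in>{0<..}. topspace (lp_topology p (h r))) \<inter> U | r U. r \<in> {0<..} \<and> openin (lp_topology p (h r)) U}"
  assume "openin (proj_lim {0<..} (\<lambda>r. lp_topology p (h r))) U"
  then have "generate_topology_on ?G U"
    by (simp add: proj_lim_def openin_topology_generated_by_iff)
  then show "?P U"
  proof induction
    case Empty
    then show ?case by auto
  next
    case (Int a b)
    show ?case
    proof (intro conjI ballI)
      show "a \<inter> b \<subseteq> proj_space u" using Int by blast
      fix x assume x: "x \<in> a \<inter> b"
      obtain n d where n: "d > 0" "\<And>y. y \<in> proj_space u \<Longrightarrow> (\<And>i. cmod (y i - x i) * u n i \<le> d) \<Longrightarrow> y \<in> a"
        using Int.IH(1) x by (meson IntD1)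
      obtain m e where m: "e > 0" "\<And>y. y \<in> proj_space u \<Longrightarrow> (\<And>i. cmod (y i - x i) * u m i \<le> e) \<Longrightarrow> y \<in> b"
        using Int.IH(2) x by (meson IntD2)
      have "y \<in> a \<inter> b" if y: "y \<in> proj_space u" "\<And>i. cmod (y i - x i) * u (max n m) i \<le> min d e" for y
      proof -
        have "cmod (y i - x i) * u n i \<le> d" "cmod (y i - x i) * u m i \<le> e" for i
          using y(2)[of i] mult_left_mono[OF mono[of n "max n m" i], of "cmod (y i - x i)"]
            mult_left_mono[OF mono[of m "max n m" i], of "cmod (y i - x i)"] by auto
        then show ?thesis using n m y by blast
      qed
      then show "\<exists>n. \<exists>\<epsilon>>0. \<forall>y\<in>proj_space u. (\<forall>i. cmod (y i - x i) * u n i \<le> \<epsilon>) \<longrightarrow> y \<in> a \<inter> b"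
        using n(1) m(1) by (metis min_less_iff_conj)
    qed
  next
    case (UN K)
    show ?case
    proof (intro conjI ballI)
      show "\<Union> K \<subseteq> proj_space u" using UN by blast
      fix x assume "x \<in> \<Union> K"
      then obtain k where k: "k \<in> K" "x \<in> k" by blast
      then obtain n e where "e > 0" "\<forall>y\<in>proj_space u. (\<forall>i. cmod (y i - x i) * u n i \<le> e) \<longrightarrow> y \<in> k"
        using UN.IH by meson
      with k show "\<exists>n. \<exists>\<epsilon>>0. \<forall>y\<in>proj_space u. (\<forall>i. cmod (y i - x i) * u n i \<le> \<epsilon>) \<longrightarrow> y \<in> \<Union> K"
        by blast
    qed
  next
    case (Basis B)
    then obtain r U where r: "r > 0" and U: "openin (lp_topology p (h r)) U" and B: "B = proj_space u \<inter> U"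
      using proj_step_inter by auto
    obtain n D where n: "D > 0" "\<And>K c. K > 0 \<Longrightarrow> (\<And>\<alpha>. cmod (c \<alpha>) * u n \<alpha> \<le> K) \<Longrightarrow>
        wnorm p (h r) c \<le> ennreal (K * D)" using proj_wnorm_le[OF r] by blast
    have "\<exists>n. \<exists>\<epsilon>>0. \<forall>y\<in>proj_space u. (\<forall>i. cmod (y i - x i) * u n i \<le> \<epsilon>) \<longrightarrow> y \<in> B" if x: "x \<in> B" for x
    proof -
      obtain \<epsilon> where \<epsilon>: "\<epsilon> > 0" "\<And>y. y \<in> lp_space p (h r) \<Longrightarrow>
          wnorm p (h r) (\<lambda>i. y i - x i) < ennreal \<epsilon> \<Longrightarrow> y \<in> U"
        using U x B unfolding openin_lp_topology by (meson IntD2)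
      have "y \<in> B" if y: "y \<in> proj_space u" "\<forall>i. cmod (y i - x i) * u n i \<le> \<epsilon> / (2 * D)" for y
      proof -
        have "wnorm p (h r) (\<lambda>i. y i - x i) \<le> ennreal (\<epsilon> / (2 * D) * D)"
          by (rule n(2)) (use y \<epsilon> n in auto)
        also have "\<dots> < ennreal \<epsilon>" using n \<epsilon> by (intro ennreal_lessI) auto
        finally show ?thesis using \<epsilon>(2) y B r proj_step_inter by auto
      qed
      then show ?thesis using \<epsilon> n by (intro exI[of _ n] exI[of _ "\<epsilon> / (2 * D)"]) auto
    qed
    then show ?case using B by auto
  qed
next
  assume P: "?P U"
  show "openin (proj_lim {0<..} (\<lambda>r. lp_topology p (h r))) U"
  proof (subst openin_subopen, intro ballI)
    fix x assume x: "x \<in> U"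
    then obtain n \<epsilon> where n: "\<epsilon> > 0" "\<And>y. y \<in> proj_space u \<Longrightarrow> (\<And>i. cmod (y i - x i) * u n i \<le> \<epsilon>) \<Longrightarrow> y \<in> U"
      using P by meson
    obtain r where r: "r > 0" "\<And>K c \<alpha>. K \<ge> 0 \<Longrightarrow>
        (\<And>\<alpha>. ennreal (cmod (c \<alpha>)) * h r \<alpha> \<le> ennreal K) \<Longrightarrow> cmod (c \<alpha>) * u n \<alpha> \<le> K"
      using proj_bound[of n] by blast
    let ?U = "{y \<in> lp_space p (h r). \<exists>t. 0 \<le> t \<and> t < \<epsilon> \<and>
      (\<forall>i. ennreal (cmod (y i - x i)) * h r i \<le> ennreal t)}"
    have "openin (proj_lim {0<..} (\<lambda>r. lp_topology p (h r))) (proj_space u \<inter> ?U)"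
      unfolding proj_lim_def openin_topology_generated_by_iff
      using openin_lp_sup_ball[OF p, of "h r" \<epsilon> x] r proj_step_inter
      by (intro generate_topology_on.Basis CollectI exI[of _ r] exI[of _ ?U]) auto
    moreover have "x \<in> proj_space u \<inter> ?U"
      using P x proj_step_inter r(1) n(1) by (auto intro: exI[of _ 0])
    moreover have "proj_space u \<inter> ?U \<subseteq> U"
    proof
      fix y assume y: "y \<in> proj_space u \<inter> ?U"
      then obtain t where t: "0 \<le> t" "t < \<epsilon>" "\<And>i. ennreal (cmod (y i - x i)) * h r i \<le> ennreal t" by auto
      then have "cmod (y i - x i) * u n i \<le> t" for i by (intro r(2)) auto
      with t(2) y show "y \<in> U" by (intro n(2)) (auto intro: order.trans[OF _ less_imp_le])
    qed
    ultimately show "\<exists>T. openin (proj_lim {0<..} (\<lambda>r. lp_topology p (h r))) T \<and> x \<in> T \<and> T \<subseteq> U" by blast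
  qed
qed

text \<open>A sup-ball is itself absolutely convex, so replacing balls by absolutely convex sets
  that contain a ball changes nothing.\<close>

lemma proj_lim_topology:
  "topology_with_zero_nhds (proj_lim {0<..} (\<lambda>r. lp_topology p (h r))) (proj_space u) (proj_zero_nhd u)"
  unfolding topology_with_zero_nhds_def
proof
  fix U
  have eq: "(\<exists>n. \<exists>\<epsilon>>0. \<forall>y\<in>proj_space u. (\<forall>i. cmod (y i - x i) * u n i \<le> \<epsilon>) \<longrightarrow> y \<in> U) \<longleftrightarrow>
    (\<exists>W. proj_zero_nhd u W \<and> (\<forall>w\<in>W. (\<lambda>i. x i + w i) \<in> U))" if x: "x \<in> proj_space u" for x
  proof
    assume "\<exists>n. \<exists>\<epsilon>>0. \<forall>y\<in>proj_space u. (\<forall>i. cmod (y i - x i) * u n i \<le> \<epsilon>) \<longrightarrow> y \<in> U"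
    then obtain n \<epsilon> where n: "\<epsilon> > 0" "\<And>y. y \<in> proj_space u \<Longrightarrow> (\<And>i. cmod (y i - x i) * u n i \<le> \<epsilon>) \<Longrightarrow> y \<in> U"
      by blast
    have "proj_zero_nhd u {c \<in> proj_space u. \<forall>i\<in>UNIV. cmod (c i) * u n i \<le> \<epsilon>}"
      unfolding proj_zero_nhd_def 
    proof (intro conjI)
      show "{c \<in> proj_space u. \<forall>i\<in>UNIV. cmod (c i) * u n i \<le> \<epsilon>} \<subseteq> proj_space u" by auto
      show "abs_convex {c \<in> proj_space u. \<forall>i\<in>UNIV. cmod (c i) * u n i \<le> \<epsilon>}"
        by (rule abs_convex_bounded[where f = "\<lambda>i. i"]) (auto intro: proj_space_linear nonneg)
      show "\<exists>m. \<exists>\<epsilon>'>0. \<forall>c\<in>proj_space u. (\<forall>i. cmod (c i) * u m i \<le> \<epsilon>') \<longrightarrow>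
          c \<in> {c \<in> proj_space u. \<forall>i\<in>UNIV. cmod (c i) * u n i \<le> \<epsilon>}"
        using n(1) by (intro exI[of _ n] exI[of _ \<epsilon>]) auto
    qed
    moreover have "(\<lambda>i. x i + w i) \<in> proj_space u" if "w \<in> proj_space u" for w
      using proj_space_linear[OF x that, of 1 1] by simp
    ultimately show "\<exists>W. proj_zero_nhd u W \<and> (\<forall>w\<in>W. (\<lambda>i. x i + w i) \<in> U)"
      by (intro exI[of _ "{c \<in> proj_space u. \<forall>i\<in>UNIV. cmod (c i) * u n i \<le> \<epsilon>}"] conjI ballI n(2)) auto
  next
    assume "\<exists>W. proj_zero_nhd u W \<and> (\<forall>w\<in>W. (\<lambda>i. x i + w i) \<in> U)"
    then obtain W n \<epsilon> where W: "\<And>w. w \<in> W \<Longrightarrow> (\<lambda>i. x i + w i) \<in> U" "\<epsilon> > 0"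
      "\<And>c. c \<in> proj_space u \<Longrightarrow> (\<And>i. cmod (c i) * u n i \<le> \<epsilon>) \<Longrightarrow> c \<in> W"
      unfolding proj_zero_nhd_def by blast
    have "y \<in> U" if y: "y \<in> proj_space u" "\<forall>i. cmod (y i - x i) * u n i \<le> \<epsilon>" for y
    proof -
      have "(\<lambda>i. y i - x i) \<in> W"
        using proj_space_linear[OF y(1) x, of 1 "-1"] y by (intro W(3)) auto
      from W(1)[OF this] show ?thesis by simp
    qed
    then show "\<exists>n. \<exists>\<epsilon>>0. \<forall>y\<in>proj_space u. (\<forall>i. cmod (y i - x i) * u n i \<le> \<epsilon>) \<longrightarrow> y \<in> U"
      using W(2) by blast
  qed
  show "openin (proj_lim {0<..} (\<lambda>r. lp_topology p (h r))) U \<longleftrightarrow> U \<subseteq> proj_space u \<and>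
     (\<forall>x\<in>U. \<exists>W. proj_zero_nhd u W \<and> (\<forall>w\<in>W. (\<lambda>i. x i + w i) \<in> U))"
    unfolding openin_proj_lim by (intro conj_cong ball_cong refl eq) auto
qed

end

section \<open>Continuous linear maps and matrices\<close>

definition linear_on :: "('i \<Rightarrow> complex) set \<Rightarrow> (('i \<Rightarrow> complex) \<Rightarrow> 'i \<Rightarrow> complex) \<Rightarrow> bool" where
  "linear_on S T \<longleftrightarrow> (\<forall>x\<in>S. \<forall>y\<in>S. \<forall>a b.
     T (\<lambda>i. a * x i + b * y i) = (\<lambda>i. a * T x i + b * T y i))"

lemma linear_onD:
  "linear_on S T \<Longrightarrow> x \<in> S \<Longrightarrow> y \<in> S \<Longrightarrow> T (\<lambda>i. a * x i + b * y i) = (\<lambda>i. a * T x i + b * T y i)"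
  by (simp add: linear_on_def)

definition unit_seq :: "'i \<Rightarrow> 'i \<Rightarrow> complex" where
  "unit_seq j = (\<lambda>i. if i = j then 1 else 0)"

text \<open>The common ground of both limits. \<open>tail\<close> makes the finitely supported
  sequences dense and \<open>nhd_coordinate\<close> makes coordinates continuous, whence unique
  extensions; \<open>nhd_half\<close> with absolute convexity stands for continuity of
  addition.\<close>

locale zero_nhd_topology =
  fixes V :: "('i \<Rightarrow> complex) topology" and S nhd
  assumes topology: "topology_with_zero_nhds V S nhd"
    and lin: "x \<in> S \<Longrightarrow> y \<in> S \<Longrightarrow> (\<lambda>i. a * x i + b * y i) \<in> S"
    and nhd_subset: "nhd W \<Longrightarrow> W \<subseteq> S"
    and nhd_abs_convex: "nhd W \<Longrightarrow> abs_convex W"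
    and nhd_half: "nhd W \<Longrightarrow> nhd {c. (\<lambda>i. 2 * c i) \<in> W}"
    and nhd_coordinate: "0 < \<delta> \<Longrightarrow> nhd {c \<in> S. cmod (c i) \<le> \<delta>}"
    and unit: "unit_seq j \<in> S"
    and tail: "x \<in> S \<Longrightarrow> nhd W \<Longrightarrow> \<exists>A. finite A \<and> (\<lambda>i. if i \<in> A then 0 else x i) \<in> W"
begin

lemma openin_iff:
  "openin V U \<longleftrightarrow> U \<subseteq> S \<and> (\<forall>x\<in>U. \<exists>W. nhd W \<and> (\<forall>w\<in>W. (\<lambda>i. x i + w i) \<in> U))"
  using topology by (auto simp: topology_with_zero_nhds_def)

lemma zero_in: "(\<lambda>_. 0) \<in> S"
  using lin[OF unit unit, of 0 _ 0] by simp

lemma add_in: "x \<in> S \<Longrightarrow> y \<in> S \<Longrightarrow> (\<lambda>i. x i + y i) \<in> S"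
  using lin[of x y 1 1] by simp

text \<open>Every tail of the zero sequence is the zero sequence.\<close>

lemma zero_in_nhd: "nhd W \<Longrightarrow> (\<lambda>_. 0) \<in> W"
  using tail[OF zero_in] by simp

lemma topspace_eq: "topspace V = S"
proof
  show "topspace V \<subseteq> S" using openin_iff openin_topspace by blast
  \<comment> \<open>Any neighbourhood would do; \<open>undefined\<close> is just some index.\<close>
  have "nhd {c \<in> S. cmod (c undefined) \<le> 1}" by (rule nhd_coordinate) simp
  then have "openin V S" unfolding openin_iff using nhd_subset add_in by blast
  then show "S \<subseteq> topspace V" by (rule openin_subset)
qed

text \<open>The open set is the interior of \<open>W\<close>: the points of which some translate of
  a neighbourhood stays in \<open>W\<close>.\<close>

lemma nhd_contains_open:
  assumes W: "nhd W" obtains U where "openin V U" "(\<lambda>_. 0) \<in> U" "U \<subseteq> W"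
proof
  let ?U = "{x \<in> S. \<exists>W'. nhd W' \<and> (\<forall>w\<in>W'. (\<lambda>i. x i + w i) \<in> W)}"
  show "openin V ?U" unfolding openin_iff
  proof (intro conjI ballI)
    fix x assume "x \<in> ?U"
    then obtain W' where x: "x \<in> S" and W': "nhd W'" "\<And>w. w \<in> W' \<Longrightarrow> (\<lambda>i. x i + w i) \<in> W" by blast
    \<comment> \<open>For \<open>y\<close> and \<open>w\<close> in \<open>H\<close>, the sum
      \<open>y + w\<close> is the mean of \<open>2 * y\<close> and \<open>2 * w\<close>, hence in
      \<open>W'\<close> by absolute convexity.\<close>
    define H where "H = {c. (\<lambda>i. 2 * c i) \<in> W'}"
    have H: "nhd H" using nhd_half[OF W'(1)] by (simp add: H_def)
    have "(\<lambda>i. x i + y i + w i) \<in> W" if "y \<in> H" "w \<in> H" for y w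
      using W'(2)[OF abs_convexD[OF nhd_abs_convex[OF W'(1)], of "\<lambda>i. 2 * y i" "\<lambda>i. 2 * w i" "1/2" "1/2"]]
        that by (simp add: H_def add.assoc)
    then show "\<exists>W'. nhd W' \<and> (\<forall>w\<in>W'. (\<lambda>i. x i + w i) \<in> ?U)"
      using H x add_in nhd_subset[OF H] by (intro exI[of _ H]) auto
  qed auto
  show "(\<lambda>_. 0) \<in> ?U" using W zero_in by auto
  show "?U \<subseteq> W"
  proof
    fix x assume "x \<in> ?U"
    then obtain W' where "nhd W'" "\<And>w. w \<in> W' \<Longrightarrow> (\<lambda>i. x i + w i) \<in> W" by blast
    then show "x \<in> W" using zero_in_nhd by force
  qed
qed

lemma linear_on_zero: "linear_on S T \<Longrightarrow> T (\<lambda>_. 0) = (\<lambda>_. 0)"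
  unfolding linear_on_def using zero_in by (auto dest!: bspec[of S _ "\<lambda>_. 0"] spec[of _ 0])

text \<open>Translation reduces continuity everywhere to continuity at zero.\<close>

lemma continuous_map_linear_iff:
  assumes T: "linear_on S T" "\<And>x. x \<in> S \<Longrightarrow> T x \<in> S"
  shows "continuous_map V V T \<longleftrightarrow> (\<forall>W. nhd W \<longrightarrow> (\<exists>W'. nhd W' \<and> (\<forall>c\<in>W'. T c \<in> W)))"
proof
  assume cont: "continuous_map V V T"
  show "\<forall>W. nhd W \<longrightarrow> (\<exists>W'. nhd W' \<and> (\<forall>c\<in>W'. T c \<in> W))"
  proof (intro allI impI)
    fix W assume "nhd W"
    then obtain U where U: "openin V U" "(\<lambda>_. 0) \<in> U" "U \<subseteq> W" by (rule nhd_contains_open)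
    have "openin V {x \<in> S. T x \<in> U}"
      using openin_continuous_map_preimage[OF cont U(1)] by (simp add: topspace_eq)
    moreover have "(\<lambda>_. 0) \<in> {x \<in> S. T x \<in> U}"
      using U(2) zero_in linear_on_zero[OF T(1)] by simp
    ultimately obtain W' where "nhd W'" "\<forall>w\<in>W'. (\<lambda>i. 0 + w i) \<in> {x \<in> S. T x \<in> U}"
      unfolding openin_iff by blast
    then show "\<exists>W'. nhd W' \<and> (\<forall>c\<in>W'. T c \<in> W)" using U(3) by auto
  qed
next
  assume cont: "\<forall>W. nhd W \<longrightarrow> (\<exists>W'. nhd W' \<and> (\<forall>c\<in>W'. T c \<in> W))"
  have "openin V {x \<in> S. T x \<in> U}" if U: "openin V U" for U
    unfolding openin_iff
  proof (intro conjI ballI)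
    fix x assume x: "x \<in> {x \<in> S. T x \<in> U}"
    then obtain W where W: "nhd W" "\<And>w. w \<in> W \<Longrightarrow> (\<lambda>i. T x i + w i) \<in> U"
      using U unfolding openin_iff by blast
    then obtain W' where W': "nhd W'" "\<And>c. c \<in> W' \<Longrightarrow> T c \<in> W" using cont by blast
    have "(\<lambda>i. x i + w i) \<in> {x \<in> S. T x \<in> U}" if w: "w \<in> W'" for w
    proof -
      have wS: "w \<in> S" using nhd_subset[OF W'(1)] w by blast
      have "T (\<lambda>i. 1 * x i + 1 * w i) = (\<lambda>i. 1 * T x i + 1 * T w i)"
        using T(1) x wS unfolding linear_on_def by blast
      then show ?thesis using W(2)[OF W'(2)[OF w]] add_in[of x w] x wS by simp
    qed
    with W'(1) show "\<exists>W. nhd W \<and> (\<forall>w\<in>W. (\<lambda>i. x i + w i) \<in> {x \<in> S. T x \<in> U})" by blast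
  qed auto
  then show "continuous_map V V T"
    using T(2) by (simp add: continuous_map_def topspace_eq)
qed

lemma openin_coordinate_ball: "openin V {c \<in> S. cmod (c i - z) < \<delta>}"
  unfolding openin_iff
proof (intro conjI ballI)
  fix x assume x: "x \<in> {c \<in> S. cmod (c i - z) < \<delta>}"
  define \<epsilon> where "\<epsilon> = (\<delta> - cmod (x i - z)) / 2"
  have \<epsilon>: "\<epsilon> > 0" "\<epsilon> + cmod (x i - z) < \<delta>" using x by (auto simp: \<epsilon>_def field_simps)
  have "cmod (x i + w i - z) < \<delta>" if "cmod (w i) \<le> \<epsilon>" for w
    using norm_triangle_ineq[of "x i - z" "w i"] that \<epsilon>(2) by (simp add: algebra_simps)
  then show "\<exists>W. nhd W \<and> (\<forall>w\<in>W. (\<lambda>i. x i + w i) \<in> {c \<in> S. cmod (c i - z) < \<delta>})"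
    using nhd_coordinate[OF \<epsilon>(1), of i] x add_in
    by (intro exI[of _ "{c \<in> S. cmod (c i) \<le> \<epsilon>}"]) auto
qed auto

lemma truncation_near:
  assumes x: "x \<in> S" and W: "nhd W"
  obtains A where "finite A" "(\<lambda>i. if i \<in> A then x i else 0) \<in> S"
    "(\<lambda>i. (if i \<in> A then x i else 0) - x i) \<in> W"
proof -
  obtain A where A: "finite A" "(\<lambda>i. if i \<in> A then 0 else x i) \<in> W" using tail[OF x W] by blast
  have "(\<lambda>i. if i \<in> A then x i else 0) = (\<lambda>i. 1 * x i + (-1) * (if i \<in> A then 0 else x i))" by auto
  also have "\<dots> \<in> S" using A x nhd_subset[OF W] by (intro lin) auto
  finally have 1: "(\<lambda>i. if i \<in> A then x i else 0) \<in> S" .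
  have "(\<lambda>i. (if i \<in> A then x i else 0) - x i) =
      (\<lambda>i. (-1) * (if i \<in> A then 0 else x i) + 0 * (if i \<in> A then 0 else x i))" by auto
  also have "\<dots> \<in> W" by (rule abs_convexD[OF nhd_abs_convex[OF W] A(2) A(2)]) simp
  finally show thesis using A 1 by (intro that)
qed

text \<open>If the maps differed in coordinate \<open>i\<close> at \<open>x\<close>, disjoint discs
  about the two values would pull back to a neighbourhood of \<open>x\<close>, which contains a
  truncation of \<open>x\<close>. The argument is purely topological because
  \<open>wick_extension\<close> asks for continuity only.\<close>

lemma continuous_extension_unique:
  assumes "continuous_map V V T" "continuous_map V V T'"
    and eq: "\<And>x. x \<in> S \<Longrightarrow> finite {i. x i \<noteq> 0} \<Longrightarrow> T x = T' x"
    and x: "x \<in> S"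
  shows "T x = T' x"
proof (rule ext, rule ccontr)
  fix i assume ne: "T x i \<noteq> T' x i"
  define \<delta> where "\<delta> = cmod (T x i - T' x i) / 2"
  have \<delta>: "\<delta> > 0" using ne by (simp add: \<delta>_def)
  let ?B = "\<lambda>z. {c \<in> S. cmod (c i - z) < \<delta>}"
  have TS: "T y \<in> S" "T' y \<in> S" if "y \<in> S" for y
    using that assms(1,2) by (auto simp: continuous_map_def topspace_eq Pi_iff)
  have "openin V ({y \<in> S. T y \<in> ?B (T x i)} \<inter> {y \<in> S. T' y \<in> ?B (T' x i)})"
    using openin_continuous_map_preimage[OF assms(1) openin_coordinate_ball]
      openin_continuous_map_preimage[OF assms(2) openin_coordinate_ball]
    by (intro openin_Int) (simp_all add: topspace_eq)
  moreover have "x \<in> {y \<in> S. T y \<in> ?B (T x i)} \<inter> {y \<in> S. T' y \<in> ?B (T' x i)}"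
    using x TS \<delta> by simp
  ultimately obtain W where W: "nhd W"
      "\<And>w. w \<in> W \<Longrightarrow> (\<lambda>i. x i + w i) \<in> {y \<in> S. T y \<in> ?B (T x i)} \<inter> {y \<in> S. T' y \<in> ?B (T' x i)}"
    unfolding openin_iff by blast
  obtain A where A: "finite A" "(\<lambda>i. if i \<in> A then x i else 0) \<in> S"
    "(\<lambda>i. (if i \<in> A then x i else 0) - x i) \<in> W" using truncation_near[OF x W(1)] .
  define y where "y = (\<lambda>i. if i \<in> A then x i else 0)"
  have "y \<in> {y \<in> S. T y \<in> ?B (T x i)} \<inter> {y \<in> S. T' y \<in> ?B (T' x i)}"
    using W(2)[OF A(3)] by (simp add: y_def)
  then have "cmod (T y i - T x i) < \<delta>" "cmod (T' y i - T' x i) < \<delta>" by auto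
  moreover have "T y = T' y"
    using A by (intro eq) (auto simp: y_def elim: rev_finite_subset)
  ultimately show False
    using norm_triangle_ineq4[of "T y i - T' x i" "T y i - T x i"] by (simp add: \<delta>_def)
qed

lemma linear_on_finite_support:
  assumes T: "linear_on S T" and A: "finite A"
  shows "(\<lambda>i. if i \<in> A then x i else 0) \<in> S"
    and "T (\<lambda>i. if i \<in> A then x i else 0) = (\<lambda>i. \<Sum>j\<in>A. T (unit_seq j) i * x j)"
proof -
  have "(\<lambda>i. if i \<in> A then x i else 0) \<in> S \<and>
    T (\<lambda>i. if i \<in> A then x i else 0) = (\<lambda>i. \<Sum>j\<in>A. T (unit_seq j) i * x j)"
    using A
  proof induction
    case empty
    then show ?case using zero_in linear_on_zero[OF T] by simp
  next
    case (insert k A)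
    let ?y = "\<lambda>i. if i \<in> A then x i else 0"
    have eq: "(\<lambda>i. if i \<in> insert k A then x i else 0) = (\<lambda>i. 1 * ?y i + x k * unit_seq k i)"
      using insert by (auto simp: unit_seq_def)
    have "T (\<lambda>i. 1 * ?y i + x k * unit_seq k i) = (\<lambda>i. 1 * T ?y i + x k * T (unit_seq k) i)"
      using insert unit by (intro linear_onD[OF T]) auto
    then show ?case unfolding eq using insert unit lin[of ?y "unit_seq k" 1 "x k"]
      by (simp add: algebra_simps)
  qed
  then show "(\<lambda>i. if i \<in> A then x i else 0) \<in> S"
    "T (\<lambda>i. if i \<in> A then x i else 0) = (\<lambda>i. \<Sum>j\<in>A. T (unit_seq j) i * x j)" by auto
qed

end

section \<open>Infinite matrices on Koethe spaces\<close>

lemma dominated_infsum: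
  fixes f :: "'i \<Rightarrow> complex" and g :: "'i \<Rightarrow> real"
  assumes g: "g summable_on UNIV" and le: "\<And>j. cmod (f j) \<le> D * g j"
  shows "f summable_on UNIV" "cmod (infsum f UNIV) \<le> D * infsum g UNIV"
proof -
  have s: "(\<lambda>j. D * g j) summable_on UNIV" using g by (rule summable_on_cmult_right)
  have abs: "(\<lambda>j. cmod (f j)) summable_on UNIV"
    by (rule summable_on_comparison_test[OF s]) (use le in auto)
  then show "f summable_on UNIV" by (rule abs_summable_summable)
  have "cmod (infsum f UNIV) \<le> infsum (\<lambda>j. cmod (f j)) UNIV" by (rule norm_infsum_bound[OF abs])
  also have "\<dots> \<le> infsum (\<lambda>j. D * g j) UNIV" by (rule infsum_mono[OF abs s]) (rule le)
  also have "\<dots> = D * infsum g UNIV" by (rule infsum_cmult_right) (use g in auto)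
  finally show "cmod (infsum f UNIV) \<le> D * infsum g UNIV" .
qed

text \<open>Supplies the finite set outside which a sequence is small, as \<open>tail\<close>
  demands.\<close>

lemma finite_ge_summable:
  fixes g :: "'i \<Rightarrow> real"
  assumes g: "g summable_on UNIV" "\<And>i. 0 \<le> g i" and \<epsilon>: "0 < \<epsilon>"
  shows "finite {i. \<epsilon> \<le> g i}"
proof (rule ccontr)
  assume inf: "infinite {i. \<epsilon> \<le> g i}"
  obtain N :: nat where N: "infsum g UNIV < N * \<epsilon>" using ex_less_of_nat_mult[OF \<epsilon>] by blast
  obtain F where F: "F \<subseteq> {i. \<epsilon> \<le> g i}" "finite F" "card F = N"
    using infinite_arbitrarily_large[OF inf] by blast
  have "N * \<epsilon> = (\<Sum>i\<in>F. \<epsilon>)" using F by simp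
  also have "\<dots> \<le> sum g F" using F by (intro sum_mono) auto
  also have "\<dots> \<le> infsum g UNIV" using g F by (intro finite_sum_le_infsum) auto
  finally show False using N by simp
qed

text \<open>\<open>summable_gain\<close> is the Grothendieck-Pietsch condition, that is, nuclearity
  of the Koethe space. It concerns ratios of weights only.\<close>

locale koethe_weights = weight_family w for w :: "nat \<Rightarrow> 'i \<Rightarrow> real" +
  assumes summable_gain: "\<exists>m g. (\<forall>i. 0 \<le> g i) \<and> g summable_on UNIV \<and> (\<forall>i. w n i \<le> g i * w m i)"

text \<open>Boundedness from step \<open>n1\<close> to step \<open>n2\<close>, tested on the columns
  alone; nuclearity makes this sufficient.\<close>

definition ind_matrix :: "(nat \<Rightarrow> 'i \<Rightarrow> real) \<Rightarrow> ('i \<Rightarrow> 'i \<Rightarrow> complex) \<Rightarrow> bool" where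
  "ind_matrix w m \<longleftrightarrow> (\<forall>n1. \<exists>n2. \<exists>C. \<forall>i j. cmod (m i j) * w n1 j \<le> C * w n2 i)"

text \<open>The estimate for projective limits is that for inductive limits of the transposed matrix.\<close>

definition proj_matrix :: "(nat \<Rightarrow> 'i \<Rightarrow> real) \<Rightarrow> ('i \<Rightarrow> 'i \<Rightarrow> complex) \<Rightarrow> bool" where
  "proj_matrix w m \<longleftrightarrow> ind_matrix w (\<lambda>i j. m j i)"

text \<open>A divergent row gives the default value 0 of the infinite sum, so results on
  \<open>matrix_op\<close> come together with summability of the rows.\<close>

definition matrix_op :: "('i \<Rightarrow> 'i \<Rightarrow> complex) \<Rightarrow> ('i \<Rightarrow> complex) \<Rightarrow> 'i \<Rightarrow> complex" where
  "matrix_op m c = (\<lambda>i. \<Sum>\<^sub>\<infinity>j. m i j * c j)"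

lemma (in weight_family) ind_matrix_linear:
  assumes "ind_matrix u m" "ind_matrix u m'"
  shows "ind_matrix u (\<lambda>i j. a * m i j + b * m' i j)"
  unfolding ind_matrix_def
proof
  fix n1
  obtain n C where n: "\<And>i j. cmod (m i j) * u n1 j \<le> C * u n i"
    using assms(1) unfolding ind_matrix_def by blast
  obtain n' C' where n': "\<And>i j. cmod (m' i j) * u n1 j \<le> C' * u n' i"
    using assms(2) unfolding ind_matrix_def by blast
  have "cmod (a * m i j + b * m' i j) * u n1 j \<le> (cmod a * \<bar>C\<bar> + cmod b * \<bar>C'\<bar>) * u (max n n') i" for i j
  proof -
    have "cmod (m i j) * u n1 j \<le> \<bar>C\<bar> * u (max n n') i"
      using mult_mono[OF abs_ge_self[of C] mono[of n "max n n'" i]] n[of i j] nonneg by fastforce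
    moreover have "cmod (m' i j) * u n1 j \<le> \<bar>C'\<bar> * u (max n n') i"
      using mult_mono[OF abs_ge_self[of C'] mono[of n' "max n n'" i]] n'[of i j] nonneg by fastforce
    ultimately have "cmod a * (cmod (m i j) * u n1 j) + cmod b * (cmod (m' i j) * u n1 j) \<le>
        cmod a * (\<bar>C\<bar> * u (max n n') i) + cmod b * (\<bar>C'\<bar> * u (max n n') i)"
      by (intro add_mono mult_left_mono) auto
    moreover have "cmod (a * m i j + b * m' i j) * u n1 j \<le>
        (cmod a * cmod (m i j) + cmod b * cmod (m' i j)) * u n1 j"
      using norm_triangle_ineq[of "a * m i j" "b * m' i j"] nonneg
      by (intro mult_right_mono) (auto simp: norm_mult)
    ultimately show ?thesis by (simp add: algebra_simps)
  qed
  then show "\<exists>n2 C. \<forall>i j. cmod (a * m i j + b * m' i j) * u n1 j \<le> C * u n2 i" by blast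
qed

lemma (in weight_family) proj_matrix_linear:
  "proj_matrix u m \<Longrightarrow> proj_matrix u m' \<Longrightarrow> proj_matrix u (\<lambda>i j. a * m i j + b * m' i j)"
  unfolding proj_matrix_def by (rule ind_matrix_linear)

text \<open>The statement that the continuous linear maps are the matrices in \<open>mat\<close>:
  \<open>mat_summable\<close>, \<open>mat_in\<close> and \<open>mat_nhd\<close> are sufficiency,
  \<open>mat_of_map\<close> is necessity.\<close>

locale matrix_topology = zero_nhd_topology V S nhd
  for V :: "('i \<Rightarrow> complex) topology" and S nhd +
  fixes mat :: "('i \<Rightarrow> 'i \<Rightarrow> complex) \<Rightarrow> bool"
  assumes mat_lin: "mat m \<Longrightarrow> mat m' \<Longrightarrow> mat (\<lambda>i j. a * m i j + b * m' i j)"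
    and mat_summable: "mat m \<Longrightarrow> c \<in> S \<Longrightarrow> (\<lambda>j. m i j * c j) summable_on UNIV"
    and mat_in: "mat m \<Longrightarrow> c \<in> S \<Longrightarrow> matrix_op m c \<in> S"
    and mat_nhd: "mat m \<Longrightarrow> nhd W \<Longrightarrow> \<exists>W'. nhd W' \<and> (\<forall>c\<in>W'. matrix_op m c \<in> W)"
    and mat_of_map: "linear_on S T \<Longrightarrow> (\<And>x. x \<in> S \<Longrightarrow> T x \<in> S) \<Longrightarrow> continuous_map V V T \<Longrightarrow>
      mat (\<lambda>i j. T (unit_seq j) i)"

lemma matrix_op_linear:
  assumes "(\<lambda>j. m i j * x j) summable_on UNIV" "(\<lambda>j. m i j * y j) summable_on UNIV"
  shows "matrix_op m (\<lambda>j. a * x j + b * y j) i = a * matrix_op m x i + b * matrix_op m y i"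
proof -
  have "(\<Sum>\<^sub>\<infinity>j. m i j * (a * x j + b * y j)) = (\<Sum>\<^sub>\<infinity>j. a * (m i j * x j) + b * (m i j * y j))"
    by (simp add: algebra_simps)
  also have "\<dots> = (\<Sum>\<^sub>\<infinity>j. a * (m i j * x j)) + (\<Sum>\<^sub>\<infinity>j. b * (m i j * y j))"
    using assms by (intro infsum_add summable_on_cmult_right)
  also have "\<dots> = a * (\<Sum>\<^sub>\<infinity>j. m i j * x j) + b * (\<Sum>\<^sub>\<infinity>j. m i j * y j)"
    using assms by (simp add: infsum_cmult_right)
  finally show ?thesis by (simp add: matrix_op_def)
qed

lemma linear_on_matrix_op:
  assumes "\<And>i c. c \<in> S \<Longrightarrow> (\<lambda>j. m i j * c j) summable_on UNIV"
  shows "linear_on S (matrix_op m)"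
  unfolding linear_on_def using assms by (auto intro!: matrix_op_linear)

lemma abs_convex_preimage:
  assumes "linear_on S T" "\<And>x y a b. x \<in> S \<Longrightarrow> y \<in> S \<Longrightarrow> (\<lambda>i. a * x i + b * y i) \<in> S" "abs_convex W"
  shows "abs_convex {c \<in> S. T c \<in> W}"
  unfolding abs_convex_def
  using assms(2) abs_convexD[OF assms(3)] linear_onD[OF assms(1)] by auto

lemma abs_convex_half: "abs_convex W \<Longrightarrow> abs_convex {c. (\<lambda>i. 2 * c i) \<in> W}"
  unfolding abs_convex_def[of "{c. _ c}"]
proof (intro ballI allI impI, unfold mem_Collect_eq)
  fix x y a b
  assume W: "abs_convex W"
    and x: "(\<lambda>i. 2 * x i) \<in> W" "(\<lambda>i. 2 * y i) \<in> W" "cmod a + cmod b \<le> 1"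
  have "(\<lambda>i. a * (2 * x i) + b * (2 * y i)) \<in> W" using abs_convexD[OF W x] .
  then show "(\<lambda>i. 2 * (a * x i + b * y i)) \<in> W" by (simp add: algebra_simps)
qed

lemma abs_convex_coordinate:
  assumes "\<And>x y a b. x \<in> S \<Longrightarrow> y \<in> S \<Longrightarrow> (\<lambda>i. a * x i + b * y i) \<in> S"
  shows "abs_convex {c \<in> S. cmod (c i) \<le> \<delta>}"
  using abs_convex_bounded[where S = S and I = "{i}" and f = "\<lambda>i. i" and v = "\<lambda>_. 1" and t = "\<lambda>_. \<delta>"]
    assms by simp

context koethe_weights begin

lemma ind_zero_nhd_topology:
  assumes "topology_with_zero_nhds V (ind_space w) (ind_zero_nhd w)"
  shows "zero_nhd_topology V (ind_space w) (ind_zero_nhd w)"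
proof
  show "topology_with_zero_nhds V (ind_space w) (ind_zero_nhd w)" by fact
  show "(\<lambda>i. a * x i + b * y i) \<in> ind_space w" if "x \<in> ind_space w" "y \<in> ind_space w" for x y a b
    using that by (rule ind_space_linear)
  show "W \<subseteq> ind_space w" if "ind_zero_nhd w W" for W using that by (simp add: ind_zero_nhd_def)
  show "abs_convex W" if "ind_zero_nhd w W" for W using that by (simp add: ind_zero_nhd_def)
  show "ind_zero_nhd w {c. (\<lambda>i. 2 * c i) \<in> W}" if W: "ind_zero_nhd w W" for W
    unfolding ind_zero_nhd_def
  proof (intro conjI allI subsetI)
    fix c assume "c \<in> {c. (\<lambda>i. 2 * c i) \<in> W}"
    then have "(\<lambda>i. 2 * c i) \<in> ind_space w" using W by (auto simp: ind_zero_nhd_def)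
    from ind_space_linear[OF this this, of "1/2" 0] show "c \<in> ind_space w" by simp
  next
    fix n
    obtain \<epsilon> where "\<epsilon> > 0" "\<And>c. (\<And>i. cmod (c i) \<le> \<epsilon> * w n i) \<Longrightarrow> c \<in> W"
      using W unfolding ind_zero_nhd_def by meson
    moreover have "cmod (2 * c i) \<le> \<epsilon> * w n i" if "\<forall>i. cmod (c i) \<le> \<epsilon> / 2 * w n i" for c i
      using spec[OF that, of i] by (simp add: norm_mult)
    ultimately show "\<exists>\<epsilon>>0. \<forall>c. (\<forall>i. cmod (c i) \<le> \<epsilon> * w n i) \<longrightarrow> c \<in> {c. (\<lambda>i. 2 * c i) \<in> W}"
      by (intro exI[of _ "\<epsilon> / 2"]) auto
  qed (use W in \<open>auto simp: ind_zero_nhd_def intro: abs_convex_half\<close>)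
  show "ind_zero_nhd w {c \<in> ind_space w. cmod (c i) \<le> \<delta>}" if \<delta>: "0 < \<delta>" for \<delta> i
    unfolding ind_zero_nhd_def
  proof (intro conjI allI)
    show "abs_convex {c \<in> ind_space w. cmod (c i) \<le> \<delta>}"
      by (rule abs_convex_coordinate) (rule ind_space_linear)
    fix n
    \<comment> \<open>The \<open>+ 1\<close> avoids division by zero where the weight
      vanishes.\<close>
    define \<epsilon> where "\<epsilon> = \<delta> / (w n i + 1)"
    have \<epsilon>: "\<epsilon> > 0" "\<epsilon> * w n i \<le> \<delta>" using \<delta> nonneg[of n i] by (auto simp: \<epsilon>_def field_simps)
    show "\<exists>\<epsilon>>0. \<forall>c. (\<forall>i. cmod (c i) \<le> \<epsilon> * w n i) \<longrightarrow> c \<in> {c \<in> ind_space w. cmod (c i) \<le> \<delta>}"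
      using \<epsilon> by (intro exI[of _ \<epsilon>]) (auto simp: ind_space_def intro: order.trans)
  qed auto
  show "unit_seq j \<in> ind_space w" for j
  proof -
    obtain n where "w n j > 0" using pos by blast
    then have "\<forall>i. cmod (unit_seq j i) \<le> (1 / w n j) * w n i" by (auto simp: unit_seq_def nonneg)
    then show ?thesis unfolding ind_space_def by blast
  qed
  show "\<exists>A. finite A \<and> (\<lambda>i. if i \<in> A then 0 else x i) \<in> W"
    if x: "x \<in> ind_space w" and W: "ind_zero_nhd w W" for x W
  proof -
    obtain n C where C: "\<And>i. cmod (x i) \<le> C * w n i" using x by (auto simp: ind_space_def)
    obtain m g where g: "\<And>i. 0 \<le> g i" "g summable_on UNIV" "\<And>i. w n i \<le> g i * w m i"
      using summable_gain by blast
    obtain \<epsilon> where \<epsilon>: "\<epsilon> > 0" "\<And>c. (\<And>i. cmod (c i) \<le> \<epsilon> * w m i) \<Longrightarrow> c \<in> W"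
      using W unfolding ind_zero_nhd_def by meson
    \<comment> \<open>Outside \<open>A\<close> one has
      \<open>(\<bar>C\<bar> + 1) * g i < \<epsilon>\<close>, so the remaining coordinates lie in the
      ball of step \<open>m\<close>. Summability of \<open>g\<close> makes \<open>A\<close>
      finite.\<close>
    define A where "A = {i. \<epsilon> / (\<bar>C\<bar> + 1) \<le> g i}"
    have "finite A" unfolding A_def by (rule finite_ge_summable) (use g \<epsilon> in auto)
    moreover have "(\<lambda>i. if i \<in> A then 0 else x i) \<in> W"
    proof (rule \<epsilon>(2))
      fix i
      show "cmod (if i \<in> A then 0 else x i) \<le> \<epsilon> * w m i"
      proof (cases "i \<in> A")
        case True
        then show ?thesis using nonneg \<epsilon> by simp
      next
        case False
        have "cmod (x i) \<le> (\<bar>C\<bar> + 1) * w n i"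
          using C[of i] mult_right_mono[of C "\<bar>C\<bar> + 1" "w n i"] nonneg[of n i] by linarith
        also have "\<dots> \<le> (\<bar>C\<bar> + 1) * (g i * w m i)" by (intro mult_left_mono g) auto
        also have "\<dots> \<le> \<epsilon> * w m i"
        proof -
          have "(\<bar>C\<bar> + 1) * g i \<le> \<epsilon>" using False by (simp add: A_def field_simps)
          from mult_right_mono[OF this nonneg[of m i]] show ?thesis by (simp add: mult.assoc)
        qed
        finally show ?thesis using False by simp
      qed
    qed
    ultimately show ?thesis by blast
  qed
qed

lemma proj_zero_nhd_topology:
  assumes "topology_with_zero_nhds V (proj_space w) (proj_zero_nhd w)"
  shows "zero_nhd_topology V (proj_space w) (proj_zero_nhd w)"
proof
  show "topology_with_zero_nhds V (proj_space w) (proj_zero_nhd w)" by fact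
  show "(\<lambda>i. a * x i + b * y i) \<in> proj_space w" if "x \<in> proj_space w" "y \<in> proj_space w" for x y a b
    using that by (rule proj_space_linear)
  show "W \<subseteq> proj_space w" if "proj_zero_nhd w W" for W using that by (simp add: proj_zero_nhd_def)
  show "abs_convex W" if "proj_zero_nhd w W" for W using that by (simp add: proj_zero_nhd_def)
  show "proj_zero_nhd w {c. (\<lambda>i. 2 * c i) \<in> W}" if W: "proj_zero_nhd w W" for W
    unfolding proj_zero_nhd_def
  proof (intro conjI allI subsetI)
    fix c assume "c \<in> {c. (\<lambda>i. 2 * c i) \<in> W}"
    then have "(\<lambda>i. 2 * c i) \<in> proj_space w" using W by (auto simp: proj_zero_nhd_def)
    from proj_space_linear[OF this this, of "1/2" 0] show "c \<in> proj_space w" by simp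
  next
    obtain n \<epsilon> where \<epsilon>: "\<epsilon> > 0" "\<And>c. c \<in> proj_space w \<Longrightarrow> (\<And>i. cmod (c i) * w n i \<le> \<epsilon>) \<Longrightarrow> c \<in> W"
      using W unfolding proj_zero_nhd_def by blast
    have "(\<lambda>i. 2 * c i) \<in> W" if "c \<in> proj_space w" "\<forall>i. cmod (c i) * w n i \<le> \<epsilon> / 2" for c
      using that proj_space_linear[of c c 2 0] by (intro \<epsilon>(2)) (auto simp: norm_mult algebra_simps)
    then show "\<exists>n. \<exists>\<epsilon>>0. \<forall>c\<in>proj_space w. (\<forall>i. cmod (c i) * w n i \<le> \<epsilon>) \<longrightarrow> c \<in> {c. (\<lambda>i. 2 * c i) \<in> W}"
      using \<epsilon>(1) by (intro exI[of _ n] exI[of _ "\<epsilon> / 2"]) auto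
  qed (use W in \<open>auto simp: proj_zero_nhd_def intro: abs_convex_half\<close>)
  show "proj_zero_nhd w {c \<in> proj_space w. cmod (c i) \<le> \<delta>}" if \<delta>: "0 < \<delta>" for \<delta> i
    unfolding proj_zero_nhd_def
  proof (intro conjI allI)
    show "abs_convex {c \<in> proj_space w. cmod (c i) \<le> \<delta>}"
      by (rule abs_convex_coordinate) (rule proj_space_linear)
    \<comment> \<open>Only a step with positive weight at \<open>i\<close> controls this
      coordinate.\<close>
    obtain n where n: "w n i > 0" using pos by blast
    show "\<exists>n. \<exists>\<epsilon>>0. \<forall>c\<in>proj_space w. (\<forall>i. cmod (c i) * w n i \<le> \<epsilon>) \<longrightarrow> c \<in> {c \<in> proj_space w. cmod (c i) \<le> \<delta>}"
      using n \<delta> by (intro exI[of _ n] exI[of _ "\<delta> * w n i"]) (auto dest: spec[of _ i])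
  qed auto
  show "unit_seq j \<in> proj_space w" for j
    unfolding proj_space_def
  proof (intro CollectI allI)
    fix n
    have "\<forall>i. cmod (unit_seq j i) * w n i \<le> w n j" by (auto simp: unit_seq_def nonneg)
    then show "\<exists>C. \<forall>i. cmod (unit_seq j i) * w n i \<le> C" by blast
  qed
  show "\<exists>A. finite A \<and> (\<lambda>i. if i \<in> A then 0 else x i) \<in> W"
    if x: "x \<in> proj_space w" and W: "proj_zero_nhd w W" for x W
  proof -
    obtain n \<epsilon> where \<epsilon>: "\<epsilon> > 0" "\<And>c. c \<in> proj_space w \<Longrightarrow> (\<And>i. cmod (c i) * w n i \<le> \<epsilon>) \<Longrightarrow> c \<in> W"
      using W unfolding proj_zero_nhd_def by blast
    obtain m g where g: "\<And>i. 0 \<le> g i" "g summable_on UNIV" "\<And>i. w n i \<le> g i * w m i"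
      using summable_gain by blast
    obtain C where C: "\<And>i. cmod (x i) * w m i \<le> C" using x unfolding proj_space_def by blast
    \<comment> \<open>The threshold of the inductive case, with \<open>C\<close> now bounding
      \<open>x\<close> in step \<open>m\<close> while \<open>W\<close> contains a ball of step
      \<open>n\<close>.\<close>
    define A where "A = {i. \<epsilon> / (\<bar>C\<bar> + 1) \<le> g i}"
    have "finite A" unfolding A_def by (rule finite_ge_summable) (use g \<epsilon> in auto)
    moreover have "(\<lambda>i. if i \<in> A then 0 else x i) \<in> W"
    proof (rule \<epsilon>(2))
      show "(\<lambda>i. if i \<in> A then 0 else x i) \<in> proj_space w"
        unfolding proj_space_def
      proof (intro CollectI allI)
        fix n
        obtain C where "\<And>i. cmod (x i) * w n i \<le> C" using x unfolding proj_space_def by blast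
        then have "\<forall>i. cmod (if i \<in> A then 0 else x i) * w n i \<le> \<bar>C\<bar>"
          by (auto intro: order.trans[OF _ abs_ge_self])
        then show "\<exists>C. \<forall>i. cmod (if i \<in> A then 0 else x i) * w n i \<le> C" by blast
      qed
      fix i
      show "cmod (if i \<in> A then 0 else x i) * w n i \<le> \<epsilon>"
      proof (cases "i \<in> A")
        case True
        then show ?thesis using \<epsilon> by simp
      next
        case False
        have "cmod (x i) * w n i \<le> cmod (x i) * (g i * w m i)" by (intro mult_left_mono g) auto
        also have "\<dots> = g i * (cmod (x i) * w m i)" by simp
        also have "\<dots> \<le> g i * (\<bar>C\<bar> + 1)"
          using C[of i] by (intro mult_left_mono g) auto
        also have "\<dots> \<le> \<epsilon>" using False by (simp add: A_def field_simps)
        finally show ?thesis using False by simp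
      qed
    qed
    ultimately show ?thesis by blast
  qed
qed

end

context koethe_weights begin

text \<open>The matrix estimate is applied at a step \<open>n\<close> beyond \<open>n1\<close>, and
  the factor \<open>g\<close> gained in between makes the row sums converge. The homogeneous
  parameter \<open>t\<close> serves both for invariance of the space and for continuity.\<close>

lemma ind_matrix_op_bound:
  assumes m: "ind_matrix w m"
  shows "\<exists>n2. \<exists>K>0. \<forall>c. \<forall>t\<ge>0. (\<forall>j. cmod (c j) \<le> t * w n1 j) \<longrightarrow>
    (\<forall>i. (\<lambda>j. m i j * c j) summable_on UNIV \<and> cmod (matrix_op m c i) \<le> t * K * w n2 i)"
proof -
  obtain n g where g: "\<And>i. 0 \<le> g i" "g summable_on UNIV" "\<And>i. w n1 i \<le> g i * w n i"
    using summable_gain by blast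
  obtain n2 C where C: "\<And>i j. cmod (m i j) * w n j \<le> C * w n2 i"
    using m unfolding ind_matrix_def by blast
  define G where "G = infsum g UNIV"
  have G: "0 \<le> G" unfolding G_def using g by (intro infsum_nonneg) auto
  have "(\<lambda>j. m i j * c j) summable_on UNIV \<and> cmod (matrix_op m c i) \<le> t * (\<bar>C\<bar> * G + 1) * w n2 i"
    if t: "t \<ge> 0" and c: "\<And>j. cmod (c j) \<le> t * w n1 j" for t c i
  proof -
    have le: "cmod (m i j * c j) \<le> (t * \<bar>C\<bar> * w n2 i) * g j" for j
    proof -
      have "cmod (m i j * c j) \<le> cmod (m i j) * (t * (g j * w n j))"
        unfolding norm_mult using t
        by (intro mult_left_mono order.trans[OF c] g) auto
      also have "\<dots> = t * g j * (cmod (m i j) * w n j)" by simp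
      also have "\<dots> \<le> t * g j * (\<bar>C\<bar> * w n2 i)"
        using C[of i j] mult_right_mono[OF abs_ge_self[of C] nonneg[of n2 i]] t g
        by (intro mult_left_mono) auto
      finally show ?thesis by (simp add: algebra_simps)
    qed
    have "t * \<bar>C\<bar> * w n2 i * G \<le> t * (\<bar>C\<bar> * G + 1) * w n2 i"
      using t nonneg[of n2 i] by (simp add: algebra_simps)
    with dominated_infsum[OF g(2) le] show ?thesis by (simp add: matrix_op_def G_def)
  qed
  moreover have "\<bar>C\<bar> * G + 1 > 0" using G by (simp add: add_nonneg_pos)
  ultimately show ?thesis by blast
qed

text \<open>A row \<open>i\<close> with \<open>w n2 i = 0\<close> is not controlled by this step,
  hence the guard on summability; the norm estimate holds trivially there, and \<open>pos\<close>
  provides another step that sees the row.\<close>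

lemma proj_matrix_op_bound:
  assumes m: "proj_matrix w m"
  shows "\<exists>n1. \<exists>K>0. \<forall>c. \<forall>t\<ge>0. (\<forall>j. cmod (c j) * w n1 j \<le> t) \<longrightarrow>
    (\<forall>i. (0 < w n2 i \<longrightarrow> (\<lambda>j. m i j * c j) summable_on UNIV) \<and> cmod (matrix_op m c i) * w n2 i \<le> t * K)"
proof -
  obtain n C where C: "\<And>i j. cmod (m i j) * w n2 i \<le> C * w n j"
    using m unfolding proj_matrix_def ind_matrix_def by blast
  obtain n1 g where g: "\<And>i. 0 \<le> g i" "g summable_on UNIV" "\<And>i. w n i \<le> g i * w n1 i"
    using summable_gain by blast
  define G where "G = infsum g UNIV"
  have G: "0 \<le> G" unfolding G_def using g by (intro infsum_nonneg) auto
  have "(0 < w n2 i \<longrightarrow> (\<lambda>j. m i j * c j) summable_on UNIV) \<and> cmod (matrix_op m c i) * w n2 i \<le> t * (\<bar>C\<bar> * G + 1)"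
    if t: "t \<ge> 0" and c: "\<And>j. cmod (c j) * w n1 j \<le> t" for t c i
  proof (cases "w n2 i = 0")
    case True
    then show ?thesis using t G by simp
  next
    case False
    then have wi: "w n2 i > 0" using nonneg[of n2 i] by simp
    have le: "cmod (m i j * c j) \<le> (t * \<bar>C\<bar> / w n2 i) * g j" for j
    proof -
      have "cmod (m i j * c j) * w n2 i = (cmod (m i j) * w n2 i) * cmod (c j)" by (simp add: norm_mult)
      also have "\<dots> \<le> (\<bar>C\<bar> * w n j) * cmod (c j)"
        using C[of i j] mult_right_mono[OF abs_ge_self[of C] nonneg[of n j]]
        by (intro mult_right_mono) auto
      also have "\<dots> \<le> (\<bar>C\<bar> * (g j * w n1 j)) * cmod (c j)"
        by (intro mult_right_mono mult_left_mono g) auto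
      also have "\<dots> = \<bar>C\<bar> * g j * (cmod (c j) * w n1 j)" by simp
      also have "\<dots> \<le> \<bar>C\<bar> * g j * t" using g by (intro mult_left_mono c) auto
      finally show ?thesis using wi by (simp add: field_simps)
    qed
    have "cmod (matrix_op m c i) \<le> t * \<bar>C\<bar> / w n2 i * G"
      using dominated_infsum(2)[OF g(2) le] by (simp add: matrix_op_def G_def)
    from mult_right_mono[OF this less_imp_le[OF wi]]
    have "cmod (matrix_op m c i) * w n2 i \<le> t * \<bar>C\<bar> * G" using wi by (simp add: field_simps)
    also have "\<dots> \<le> t * (\<bar>C\<bar> * G + 1)" using t by (simp add: algebra_simps)
    finally show ?thesis using dominated_infsum(1)[OF g(2) le] by simp
  qed
  moreover have "\<bar>C\<bar> * G + 1 > 0" using G by (simp add: add_nonneg_pos)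
  ultimately show ?thesis by blast
qed

text \<open>If the estimate failed, the neighbourhood of zero that bounds the coordinate \<open>f N\<close> by
  \<open>\<theta> N\<close> would absorb no multiple of the images of the normalized unit sequences.\<close>

lemma ind_matrix_of_continuous:
  assumes V: "topology_with_zero_nhds V (ind_space w) (ind_zero_nhd w)"
    and T: "linear_on (ind_space w) T" "\<And>x. x \<in> ind_space w \<Longrightarrow> T x \<in> ind_space w" "continuous_map V V T"
  shows "ind_matrix w (\<lambda>i j. T (unit_seq j) i)"
proof (rule ccontr)
  interpret zero_nhd_topology V "ind_space w" "ind_zero_nhd w" by (rule ind_zero_nhd_topology) fact
  assume "\<not> ind_matrix w (\<lambda>i j. T (unit_seq j) i)"
  then obtain n1 where "\<forall>n2 C. \<exists>i j. cmod (T (unit_seq j) i) * w n1 j > C * w n2 i"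
    unfolding ind_matrix_def by (meson not_le)
  \<comment> \<open>The diagonal choice: step and constant grow together, \<open>n2 = N\<close> and
    \<open>C = N + 1\<close>.\<close>
  then have "\<forall>N. \<exists>i j. cmod (T (unit_seq j) i) * w n1 j > (real N + 1) * w N i" by blast
  then obtain f k where big: "\<And>N. cmod (T (unit_seq (k N)) (f N)) * w n1 (k N) > (real N + 1) * w N (f N)"
    by metis
  define A where "A N = cmod (T (unit_seq (k N)) (f N)) * w n1 (k N)" for N
  \<comment> \<open>Chosen between two requirements: \<open>\<theta> N\<close> exceeds
    \<open>w N (f N)\<close>, so step \<open>n\<close> can violate the bounds only for
    \<open>N < n\<close>, yet the quotient of \<open>A N\<close> by \<open>\<theta> N\<close> is
    unbounded.\<close>
  define \<theta> where "\<theta> N = A N / (real N + 1)" for N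
  have \<theta>: "\<theta> N > w N (f N)" for N
    using big[of N] by (simp add: \<theta>_def A_def field_simps)
  then have \<theta>pos: "\<theta> N > 0" for N using nonneg[of N "f N"] by (meson le_less_trans)
  define W where "W = {c \<in> ind_space w. \<forall>N\<in>UNIV. cmod (c (f N)) * 1 \<le> \<theta> N}"
  have "ind_zero_nhd w W"
    unfolding ind_zero_nhd_def
  proof (intro conjI allI)
    show "W \<subseteq> ind_space w" by (auto simp: W_def)
    show "abs_convex W" unfolding W_def
      by (rule abs_convex_bounded[where v = "\<lambda>_. 1"]) (auto intro: ind_space_linear)
    fix n
    \<comment> \<open>The finitely many \<open>N < n\<close> are met by the minimum. The entry 1
      covers \<open>n = 0\<close> and gives \<open>\<epsilon> \<le> 1\<close>, so that monotonicity
      of \<open>w\<close> settles all \<open>N \<ge> n\<close>.\<close>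
    define \<epsilon> where "\<epsilon> = Min (insert 1 ((\<lambda>N. \<theta> N / (w n (f N) + 1)) ` {..<n}))"
    have \<epsilon>: "\<epsilon> > 0" "\<epsilon> \<le> 1" "\<And>N. N < n \<Longrightarrow> \<epsilon> \<le> \<theta> N / (w n (f N) + 1)"
      using \<theta>pos nonneg by (auto simp: \<epsilon>_def add_nonneg_pos)
    have "\<epsilon> * w n (f N) \<le> \<theta> N" for N
    proof (cases "N < n")
      case True
      have "\<epsilon> * w n (f N) \<le> \<epsilon> * (w n (f N) + 1)" using \<epsilon>(1) by (simp add: algebra_simps)
      also have "\<dots> \<le> \<theta> N" using \<epsilon>(3)[OF True] nonneg[of n "f N"] by (simp add: field_simps)
      finally show ?thesis .
    next
      case False
      have "\<epsilon> * w n (f N) \<le> w n (f N)" using \<epsilon> nonneg by (simp add: mult_left_le_one_le)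
      also have "\<dots> \<le> w N (f N)" using False by (intro mono) simp
      finally show ?thesis using \<theta>[of N] by simp
    qed
    then have "c \<in> W" if "\<forall>i. cmod (c i) \<le> \<epsilon> * w n i" for c
      using that by (auto simp: W_def ind_space_def intro: order.trans)
    then show "\<exists>\<epsilon>>0. \<forall>c. (\<forall>i. cmod (c i) \<le> \<epsilon> * w n i) \<longrightarrow> c \<in> W" using \<epsilon>(1) by blast
  qed
  then obtain W' where W': "ind_zero_nhd w W'" "\<And>c. c \<in> W' \<Longrightarrow> T c \<in> W"
    using continuous_map_linear_iff[OF T(1,2)] T(3) by blast
  then obtain \<epsilon> where \<epsilon>: "\<epsilon> > 0" "\<And>c. (\<And>i. cmod (c i) \<le> \<epsilon> * w n1 i) \<Longrightarrow> c \<in> W'"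
    unfolding ind_zero_nhd_def by meson
  have le: "\<epsilon> * A N \<le> \<theta> N" for N
  proof -
    \<comment> \<open>The largest multiple of the unit sequence at \<open>k N\<close> inside the
      \<open>\<epsilon>\<close>-ball of step \<open>n1\<close>.\<close>
    define a where "a = complex_of_real (\<epsilon> * w n1 (k N))"
    have "(\<lambda>i. a * unit_seq (k N) i) \<in> W'"
      using \<epsilon>(1) nonneg[of n1] by (intro \<epsilon>(2)) (auto simp: unit_seq_def a_def norm_mult)
    then have "cmod (T (\<lambda>i. a * unit_seq (k N) i) (f N)) \<le> \<theta> N"
      using W'(2) by (force simp: W_def)
    moreover have "T (\<lambda>i. a * unit_seq (k N) i) = (\<lambda>i. a * T (unit_seq (k N)) i)"
      using linear_onD[OF T(1) unit unit, of a "k N" 0] by simp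
    ultimately show ?thesis
      using \<epsilon>(1) nonneg[of n1 "k N"] by (simp add: norm_mult a_def A_def algebra_simps)
  qed
  \<comment> \<open>Since \<open>\<theta> N\<close> is \<open>A N / (N + 1)\<close>, the bound
    \<open>le\<close> gives \<open>\<epsilon> * (N + 1) \<le> 1\<close>, which fails for large
    \<open>N\<close>.\<close>
  obtain N where N: "1 / \<epsilon> < real N" using reals_Archimedean2 by blast
  have "\<epsilon> * A N * (real N + 1) \<le> A N" using le[of N] by (simp add: \<theta>_def field_simps)
  moreover have "A N > 0" using \<theta>pos[of N] by (simp add: \<theta>_def zero_less_divide_iff)
  ultimately have "A N * (\<epsilon> * (real N + 1)) \<le> A N * 1" "A N > 0" by (simp_all add: ac_simps)
  then have "\<epsilon> * (real N + 1) \<le> 1" by (subst (asm) mult_le_cancel_left_pos)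
  moreover have "1 < \<epsilon> * real N" using N \<epsilon>(1) by (simp add: field_simps)
  ultimately show False using \<epsilon>(1) by (simp add: algebra_simps)
qed

text \<open>Here one ball of a single step already gives the estimate: its preimage contains a ball
  of some step \<open>n1\<close>, and it suffices to test multiples of unit sequences in that
  ball.\<close>

lemma proj_matrix_of_continuous:
  assumes V: "topology_with_zero_nhds V (proj_space w) (proj_zero_nhd w)"
    and T: "linear_on (proj_space w) T" "\<And>x. x \<in> proj_space w \<Longrightarrow> T x \<in> proj_space w" "continuous_map V V T"
  shows "proj_matrix w (\<lambda>i j. T (unit_seq j) i)"
  unfolding proj_matrix_def ind_matrix_def
proof
  interpret zero_nhd_topology V "proj_space w" "proj_zero_nhd w" by (rule proj_zero_nhd_topology) fact
  fix n2
  define W where "W = {c \<in> proj_space w. \<forall>i\<in>UNIV. cmod (c i) * w n2 i \<le> 1}"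
  have "proj_zero_nhd w W"
    unfolding proj_zero_nhd_def
  proof (intro conjI)
    show "W \<subseteq> proj_space w" by (auto simp: W_def)
    show "abs_convex W" unfolding W_def
      by (rule abs_convex_bounded[where f = "\<lambda>i. i"]) (auto intro: proj_space_linear nonneg)
    show "\<exists>n. \<exists>\<epsilon>>0. \<forall>c\<in>proj_space w. (\<forall>i. cmod (c i) * w n i \<le> \<epsilon>) \<longrightarrow> c \<in> W"
      by (intro exI[of _ n2] exI[of _ 1]) (auto simp: W_def)
  qed
  then obtain W' where W': "proj_zero_nhd w W'" "\<And>c. c \<in> W' \<Longrightarrow> T c \<in> W"
    using continuous_map_linear_iff[OF T(1,2)] T(3) by blast
  then obtain n1 \<epsilon> where \<epsilon>: "\<epsilon> > 0" "\<And>c. c \<in> proj_space w \<Longrightarrow> (\<And>i. cmod (c i) * w n1 i \<le> \<epsilon>) \<Longrightarrow> c \<in> W'"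
    unfolding proj_zero_nhd_def by blast
  have key: "t * (cmod (T (unit_seq j) i) * w n2 i) \<le> 1" if t: "0 \<le> t" "t * w n1 j \<le> \<epsilon>" for t i j
  proof -
    have "(\<lambda>i. of_real t * unit_seq j i) \<in> W'"
      using lin[OF unit unit, of "of_real t" j 0] t \<epsilon>(1)
      by (intro \<epsilon>(2)) (auto simp: unit_seq_def norm_mult)
    then have "cmod (T (\<lambda>i. of_real t * unit_seq j i) i) * w n2 i \<le> 1"
      using W'(2) by (force simp: W_def)
    moreover have "T (\<lambda>i. of_real t * unit_seq j i) = (\<lambda>i. of_real t * T (unit_seq j) i)"
      using linear_onD[OF T(1) unit unit, of "of_real t" j 0] by simp
    ultimately show ?thesis using t(1) by (simp add: norm_mult algebra_simps)
  qed
  have "cmod (T (unit_seq j) i) * w n2 i \<le> (1 / \<epsilon>) * w n1 j" for i j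
  proof (cases "w n1 j = 0")
    case True
    \<comment> \<open>Where the weight vanishes, every multiple of the unit sequence lies in the
      ball, so the image entry \<open>a\<close> must be zero; the multiple \<open>2 / a\<close>
      refutes \<open>a > 0\<close>.\<close>
    show ?thesis
    proof (rule ccontr)
      define a where "a = cmod (T (unit_seq j) i) * w n2 i"
      assume "\<not> ?thesis"
      then have "a > 0" using True by (simp add: a_def)
      with key[of "2 / a" j i] True \<epsilon>(1) show False by (simp add: a_def[symmetric])
    qed
  next
    case False
    then have "w n1 j > 0" using nonneg[of n1 j] by simp
    with key[of "\<epsilon> / w n1 j" j i] \<epsilon>(1) show ?thesis by (simp add: field_simps)
  qed
  then show "\<exists>n1 C. \<forall>j i. cmod (T (unit_seq j) i) * w n2 i \<le> C * w n1 j" by blast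
qed

lemma ind_matrix_topology:
  assumes V: "topology_with_zero_nhds V (ind_space w) (ind_zero_nhd w)"
  shows "matrix_topology V (ind_space w) (ind_zero_nhd w) (ind_matrix w)"
proof -
  interpret zero_nhd_topology V "ind_space w" "ind_zero_nhd w" by (rule ind_zero_nhd_topology) fact
  have bound: "(\<forall>i. (\<lambda>j. m i j * c j) summable_on UNIV) \<and> matrix_op m c \<in> ind_space w"
    if m: "ind_matrix w m" and c: "c \<in> ind_space w" for m c
  proof -
    obtain n C where C: "\<And>i. cmod (c i) \<le> C * w n i" using c by (auto simp: ind_space_def)
    have C': "cmod (c i) \<le> \<bar>C\<bar> * w n i" for i
      using C[of i] mult_right_mono[OF abs_ge_self[of C] nonneg[of n i]] by linarith
    obtain n2 K where K: "\<forall>c. \<forall>t\<ge>0. (\<forall>j. cmod (c j) \<le> t * w n j) \<longrightarrow>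
      (\<forall>i. (\<lambda>j. m i j * c j) summable_on UNIV \<and> cmod (matrix_op m c i) \<le> t * K * w n2 i)"
      using ind_matrix_op_bound[OF m, of n] by blast
    have "\<forall>i. (\<lambda>j. m i j * c j) summable_on UNIV \<and> cmod (matrix_op m c i) \<le> \<bar>C\<bar> * K * w n2 i"
      using spec[OF spec[OF K, of c], of "\<bar>C\<bar>"] C' by simp
    then show ?thesis unfolding ind_space_def by blast
  qed
  show ?thesis
  proof unfold_locales
    show "ind_matrix w (\<lambda>i j. a * m i j + b * m' i j)" if "ind_matrix w m" "ind_matrix w m'" for m m' a b
      using that by (rule ind_matrix_linear)
    show "\<exists>W'. ind_zero_nhd w W' \<and> (\<forall>c\<in>W'. matrix_op m c \<in> W)"
      if m: "ind_matrix w m" and W: "ind_zero_nhd w W" for m W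
    \<comment> \<open>The full preimage is taken: linearity makes it absolutely convex, and
      \<open>ind_matrix_op_bound\<close> puts a ball of every step into it.\<close>
    proof (intro exI[of _ "{c \<in> ind_space w. matrix_op m c \<in> W}"] conjI)
      have "linear_on (ind_space w) (matrix_op m)" using bound[OF m] by (intro linear_on_matrix_op) auto
      then have "abs_convex {c \<in> ind_space w. matrix_op m c \<in> W}"
        using W by (intro abs_convex_preimage ind_space_linear) (auto simp: ind_zero_nhd_def)
      moreover have "\<exists>\<epsilon>>0. \<forall>c. (\<forall>i. cmod (c i) \<le> \<epsilon> * w n i) \<longrightarrow> c \<in> {c \<in> ind_space w. matrix_op m c \<in> W}" for n
      proof -
        obtain n2 K where K: "K > 0" "\<forall>c. \<forall>t\<ge>0. (\<forall>j. cmod (c j) \<le> t * w n j) \<longrightarrow>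
          (\<forall>i. (\<lambda>j. m i j * c j) summable_on UNIV \<and> cmod (matrix_op m c i) \<le> t * K * w n2 i)"
          using ind_matrix_op_bound[OF m, of n] by blast
        obtain \<epsilon> where \<epsilon>: "\<epsilon> > 0" "\<And>c. (\<And>i. cmod (c i) \<le> \<epsilon> * w n2 i) \<Longrightarrow> c \<in> W"
          using W unfolding ind_zero_nhd_def by meson
        have "c \<in> {c \<in> ind_space w. matrix_op m c \<in> W}" if c: "\<forall>i. cmod (c i) \<le> \<epsilon> / K * w n i" for c
        proof -
          have "\<forall>i. cmod (matrix_op m c i) \<le> \<epsilon> / K * K * w n2 i"
            using spec[OF K(2), of c] c K(1) \<epsilon>(1) by (metis divide_nonneg_pos less_imp_le)
          then have "matrix_op m c \<in> W" using K(1) by (intro \<epsilon>(2)) simp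
          moreover have "c \<in> ind_space w" using c unfolding ind_space_def by blast
          ultimately show ?thesis by blast
        qed
        then show ?thesis using K(1) \<epsilon>(1) by (intro exI[of _ "\<epsilon> / K"]) auto
      qed
      ultimately show "ind_zero_nhd w {c \<in> ind_space w. matrix_op m c \<in> W}"
        by (auto simp: ind_zero_nhd_def)
    qed auto
  qed (use bound ind_matrix_of_continuous[OF V] in auto)
qed

lemma proj_matrix_topology:
  assumes V: "topology_with_zero_nhds V (proj_space w) (proj_zero_nhd w)"
  shows "matrix_topology V (proj_space w) (proj_zero_nhd w) (proj_matrix w)"
proof -
  interpret zero_nhd_topology V "proj_space w" "proj_zero_nhd w" by (rule proj_zero_nhd_topology) fact
  have bound: "\<exists>n1. \<exists>K>0. \<forall>c. \<forall>t\<ge>0. (\<forall>j. cmod (c j) * w n1 j \<le> t) \<longrightarrow>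
    (\<forall>i. (0 < w n2 i \<longrightarrow> (\<lambda>j. m i j * c j) summable_on UNIV) \<and> cmod (matrix_op m c i) * w n2 i \<le> t * K)"
    if "proj_matrix w m" for m n2 using that by (rule proj_matrix_op_bound)
  have pbound: "\<exists>t\<ge>0. \<forall>j. cmod (c j) * w n j \<le> t" if "c \<in> proj_space w" for c n
  proof -
    obtain t where "\<And>j. cmod (c j) * w n j \<le> t" using \<open>c \<in> proj_space w\<close> unfolding proj_space_def by blast
    then show ?thesis by (intro exI[of _ "\<bar>t\<bar>"]) (auto intro: order.trans[OF _ abs_ge_self])
  qed
  have sm: "(\<lambda>j. m i j * c j) summable_on UNIV" if m: "proj_matrix w m" and c: "c \<in> proj_space w" for m c i
  proof -
    obtain n2 where "0 < w n2 i" using pos by blast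
    then show ?thesis using bound[OF m, of n2] pbound[OF c] by meson
  qed
  have inS: "matrix_op m c \<in> proj_space w" if m: "proj_matrix w m" and c: "c \<in> proj_space w" for m c
    unfolding proj_space_def
  proof (intro CollectI allI)
    fix n2
    show "\<exists>C. \<forall>i. cmod (matrix_op m c i) * w n2 i \<le> C"
      using bound[OF m, of n2] pbound[OF c] by meson
  qed
  show ?thesis
  proof unfold_locales
    show "proj_matrix w (\<lambda>i j. a * m i j + b * m' i j)" if "proj_matrix w m" "proj_matrix w m'" for m m' a b
      using that by (rule proj_matrix_linear)
    show "\<exists>W'. proj_zero_nhd w W' \<and> (\<forall>c\<in>W'. matrix_op m c \<in> W)"
      if m: "proj_matrix w m" and W: "proj_zero_nhd w W" for m W
    proof (intro exI[of _ "{c \<in> proj_space w. matrix_op m c \<in> W}"] conjI)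
      have "linear_on (proj_space w) (matrix_op m)" using sm[OF m] by (intro linear_on_matrix_op) auto
      then have "abs_convex {c \<in> proj_space w. matrix_op m c \<in> W}"
        using W by (intro abs_convex_preimage proj_space_linear) (auto simp: proj_zero_nhd_def)
      moreover have "\<exists>n. \<exists>\<epsilon>>0. \<forall>c\<in>proj_space w. (\<forall>i. cmod (c i) * w n i \<le> \<epsilon>) \<longrightarrow>
          c \<in> {c \<in> proj_space w. matrix_op m c \<in> W}"
      proof -
        obtain n2 \<epsilon> where \<epsilon>: "\<epsilon> > 0" "\<And>c. c \<in> proj_space w \<Longrightarrow> (\<And>i. cmod (c i) * w n2 i \<le> \<epsilon>) \<Longrightarrow> c \<in> W"
          using W unfolding proj_zero_nhd_def by blast
        obtain n1 K where K: "K > 0" "\<forall>c. \<forall>t\<ge>0. (\<forall>j. cmod (c j) * w n1 j \<le> t) \<longrightarrow>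
            (\<forall>i. (0 < w n2 i \<longrightarrow> (\<lambda>j. m i j * c j) summable_on UNIV) \<and> cmod (matrix_op m c i) * w n2 i \<le> t * K)"
          using bound[OF m, of n2] by blast
        have "matrix_op m c \<in> W" if c: "c \<in> proj_space w" "\<forall>i. cmod (c i) * w n1 i \<le> \<epsilon> / K" for c
        proof (rule \<epsilon>(2))
          show "matrix_op m c \<in> proj_space w" using inS[OF m] c(1) .
          show "cmod (matrix_op m c i) * w n2 i \<le> \<epsilon>" for i
            using spec[OF spec[OF K(2), of c], of "\<epsilon> / K"] c(2) K(1) \<epsilon>(1) by simp
        qed
        then show ?thesis using K(1) \<epsilon>(1) by (intro exI[of _ n1] exI[of _ "\<epsilon> / K"]) auto
      qed
      ultimately show "proj_zero_nhd w {c \<in> proj_space w. matrix_op m c \<in> W}"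
        by (auto simp: proj_zero_nhd_def)
    qed auto
  qed (use sm inS proj_matrix_of_continuous[OF V] in auto)
qed

end

section \<open>The kernel of a Wick operator\<close>

text \<open>Multiplication by \<open>e\<^bsup>t(z,w)\<^esup>\<close>.\<close>

definition exp_shift :: "complex \<Rightarrow> 'd::finite series2 \<Rightarrow> 'd series2" where
  "exp_shift t a = (\<lambda>(\<alpha>, \<beta>). \<Sum>\<gamma> | \<gamma> \<le> \<alpha> \<and> \<gamma> \<le> \<beta>. t ^ mdeg \<gamma> / of_real (mfact \<gamma>) * a (\<alpha> - \<gamma>, \<beta> - \<gamma>))"

lemma mfact_pos [simp]: "0 < mfact \<alpha>"
  by (simp add: mfact_def prod_pos)

lemma mfact_nonzero [simp]: "mfact \<alpha> \<noteq> 0"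
  by (rule less_imp_neq[symmetric]) (rule mfact_pos)

lemma mdeg_add: "mdeg (\<alpha> + \<beta>) = mdeg \<alpha> + mdeg \<beta>"
  by (simp add: mdeg_def sum.distrib)

lemma multiindex_diff_add: "\<gamma> \<le> \<alpha> \<Longrightarrow> \<alpha> - \<gamma> + \<gamma> = (\<alpha> :: nat ^ 'd::finite)"
  by (simp add: vec_eq_iff less_eq_vec_def)

lemma finite_below2: "finite {\<gamma> :: nat ^ 'd::finite. \<gamma> \<le> \<alpha> \<and> \<gamma> \<le> \<beta>}"
  by (rule finite_subset[OF _ finite_below[of \<alpha>]]) auto

lemma decompositions_pair:
  "{(i, l). i + l = (\<alpha> :: nat ^ 'd::finite, \<beta> :: nat ^ 'd)} =
     (\<lambda>(\<gamma>, \<delta>). ((\<gamma>, \<delta>), (\<alpha> - \<gamma>, \<beta> - \<delta>))) ` ({\<gamma>. \<gamma> \<le> \<alpha>} \<times> {\<delta>. \<delta> \<le> \<beta>})"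
  (is "?L = ?R")
proof (intro equalityI subsetI)
  fix x assume x: "x \<in> ?L"
  obtain \<gamma> \<delta> \<alpha>' \<beta>' where x': "x = ((\<gamma>, \<delta>), (\<alpha>', \<beta>'))" by (metis surj_pair)
  have "\<alpha> $ j = \<gamma> $ j + \<alpha>' $ j" "\<beta> $ j = \<delta> $ j + \<beta>' $ j" for j using x x' by auto
  then show "x \<in> ?R" unfolding x'
    by (intro image_eqI[of _ _ "(\<gamma>, \<delta>)"]) (simp_all add: vec_eq_iff less_eq_vec_def)
next
  fix x assume "x \<in> ?R"
  then show "x \<in> ?L" by (auto simp: vec_eq_iff less_eq_vec_def)
qed

lemma fps_prod_pair:
  "fps_prod f g (\<alpha> :: nat ^ 'd::finite, \<beta> :: nat ^ 'd) =
     (\<Sum>\<gamma> | \<gamma> \<le> \<alpha>. \<Sum>\<delta> | \<delta> \<le> \<beta>. f (\<gamma>, \<delta>) * g (\<alpha> - \<gamma>, \<beta> - \<delta>))"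
proof -
  have "inj_on (\<lambda>(\<gamma>, \<delta>). ((\<gamma>, \<delta>), (\<alpha> - \<gamma>, \<beta> - \<delta>))) ({\<gamma>. \<gamma> \<le> \<alpha>} \<times> {\<delta>. \<delta> \<le> \<beta>})"
    by (auto simp: inj_on_def)
  then show ?thesis
    unfolding fps_prod_def
    by (subst decompositions_pair, subst sum.reindex) (auto simp: sum.cartesian_product case_prod_unfold comp_def)
qed

lemma axis_le_iff: "axis j (Suc 0) \<le> \<alpha> \<longleftrightarrow> 0 < \<alpha> $ j"
  by (auto simp: less_eq_vec_def axis_def)

text \<open>Multiplication by one monomial \<open>z_j v_j\<close> lowers the \<open>j\<close>-th
  index in both variables, when possible.\<close>

lemma fps_prod_pairing:
  "fps_prod pairing g (\<alpha> :: nat ^ 'd::finite, \<beta> :: nat ^ 'd) =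
     (\<Sum>j | 0 < \<alpha> $ j \<and> 0 < \<beta> $ j. g (\<alpha> - axis j 1, \<beta> - axis j 1))"
proof -
  have "fps_prod pairing g (\<alpha>, \<beta>) = (\<Sum>\<gamma> | \<gamma> \<le> \<alpha>. \<Sum>\<delta> | \<delta> \<le> \<beta>. \<Sum>j\<in>UNIV.
      if \<gamma> = axis j 1 \<and> \<delta> = axis j 1 then g (\<alpha> - axis j 1, \<beta> - axis j 1) else 0)"
    unfolding fps_prod_pair pairing_def sum_distrib_right by (intro sum.cong refl) auto
  also have "\<dots> = (\<Sum>\<gamma> | \<gamma> \<le> \<alpha>. \<Sum>j\<in>UNIV. \<Sum>\<delta> | \<delta> \<le> \<beta>.
      if \<gamma> = axis j 1 \<and> \<delta> = axis j 1 then g (\<alpha> - axis j 1, \<beta> - axis j 1) else 0)"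
    by (intro sum.cong refl sum.swap)
  also have "\<dots> = (\<Sum>j\<in>UNIV. \<Sum>\<gamma> | \<gamma> \<le> \<alpha>. \<Sum>\<delta> | \<delta> \<le> \<beta>.
      if \<gamma> = axis j 1 \<and> \<delta> = axis j 1 then g (\<alpha> - axis j 1, \<beta> - axis j 1) else 0)"
    by (rule sum.swap)
  also have "\<dots> = (\<Sum>j\<in>UNIV. if 0 < \<alpha> $ j \<and> 0 < \<beta> $ j then g (\<alpha> - axis j 1, \<beta> - axis j 1) else 0)"
  proof (intro sum.cong refl)
    fix j
    let ?h = "g (\<alpha> - axis j 1, \<beta> - axis j 1)"
    have "(\<Sum>\<gamma> | \<gamma> \<le> \<alpha>. \<Sum>\<delta> | \<delta> \<le> \<beta>. if \<gamma> = axis j 1 \<and> \<delta> = axis j 1 then ?h else 0) =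
        (\<Sum>\<gamma> | \<gamma> \<le> \<alpha>. if \<gamma> = axis j 1 then (\<Sum>\<delta> | \<delta> \<le> \<beta>. if \<delta> = axis j 1 then ?h else 0) else 0)"
      by (intro sum.cong refl) auto
    also have "\<dots> = (if 0 < \<alpha> $ j \<and> 0 < \<beta> $ j then ?h else 0)"
      by (simp add: sum.delta finite_below axis_le_iff)
    finally show "(\<Sum>\<gamma> | \<gamma> \<le> \<alpha>. \<Sum>\<delta> | \<delta> \<le> \<beta>. if \<gamma> = axis j 1 \<and> \<delta> = axis j 1 then ?h else 0) =
        (if 0 < \<alpha> $ j \<and> 0 < \<beta> $ j then ?h else 0)" .
  qed
  also have "\<dots> = (\<Sum>j | 0 < \<alpha> $ j \<and> 0 < \<beta> $ j. g (\<alpha> - axis j 1, \<beta> - axis j 1))"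
    by (simp add: sum.If_cases)
  finally show ?thesis .
qed

lemma mdeg_axis [simp]: "mdeg (axis j (Suc 0)) = Suc 0"
  by (simp add: mdeg_def axis_def sum.delta)

lemma mfact_diff_axis:
  assumes "0 < \<alpha> $ j" shows "mfact \<alpha> = of_nat (\<alpha> $ j) * mfact (\<alpha> - axis j 1)"
proof -
  have "mfact \<alpha> = fact (\<alpha> $ j) * (\<Prod>i\<in>UNIV - {j}. fact (\<alpha> $ i))"
    unfolding mfact_def by (rule prod.remove) auto
  moreover have "mfact (\<alpha> - axis j 1) = fact (\<alpha> $ j - 1) * (\<Prod>i\<in>UNIV - {j}. fact ((\<alpha> - axis j 1) $ i))"
    unfolding mfact_def by (subst prod.remove[of _ j]) (auto simp: axis_def)
  moreover have "(\<Prod>i\<in>UNIV - {j}. fact ((\<alpha> - axis j 1) $ i)) = (\<Prod>i\<in>UNIV - {j}. fact (\<alpha> $ i) :: real)"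
    by (intro prod.cong) (auto simp: axis_def)
  moreover have "fact (\<alpha> $ j) = of_nat (\<alpha> $ j) * (fact (\<alpha> $ j - 1) :: real)"
    using assms by (simp add: fact_reduce)
  ultimately show ?thesis by simp
qed

text \<open>The multinomial theorem for the \<open>n\<close>-th power of the sum of the
  \<open>z_j v_j\<close>.\<close>

lemma pairing_power:
  "(fps_prod pairing ^^ n) fps_one (\<alpha>, \<beta> :: nat ^ 'd::finite) =
     (if \<alpha> = \<beta> \<and> mdeg \<alpha> = n then fact n / of_real (mfact \<alpha>) else 0)"
proof (induction n arbitrary: \<alpha> \<beta>)
  case 0
  have "mdeg \<alpha> = 0 \<longleftrightarrow> \<alpha> = 0" by (auto simp: mdeg_def vec_eq_iff)
  then show ?case by (auto simp: fps_one_def zero_prod_def mfact_def)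
next
  case (Suc n)
  have *: "(fps_prod pairing ^^ n) fps_one (\<alpha> - axis j 1, \<beta> - axis j 1) =
      (if \<alpha> = \<beta> \<and> mdeg \<alpha> = Suc n then fact n * of_nat (\<alpha> $ j) / of_real (mfact \<alpha>) else 0)"
    if j: "0 < \<alpha> $ j" "0 < \<beta> $ j" for j
  proof -
    have le: "axis j 1 \<le> \<alpha>" "axis j 1 \<le> \<beta>" using j by (auto simp: axis_le_iff)
    have "\<alpha> - axis j 1 = \<beta> - axis j 1 \<longleftrightarrow> \<alpha> = \<beta>"
      using multiindex_diff_add[OF le(1)] multiindex_diff_add[OF le(2)] by metis
    moreover have "mdeg \<alpha> = mdeg (\<alpha> - axis j 1) + 1"
      using multiindex_diff_add[OF le(1)] mdeg_add[of "\<alpha> - axis j 1" "axis j 1"] by simp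
    moreover have "complex_of_real (mfact \<alpha>) = of_nat (\<alpha> $ j) * of_real (mfact (\<alpha> - axis j 1))"
      by (subst mfact_diff_axis[OF j(1)]) simp
    ultimately show ?thesis
      unfolding Suc.IH using j(1) by (cases "\<alpha> = \<beta>") (simp_all add: field_simps)
  qed
  have "(fps_prod pairing ^^ Suc n) fps_one (\<alpha>, \<beta>) =
      (\<Sum>j | 0 < \<alpha> $ j \<and> 0 < \<beta> $ j. if \<alpha> = \<beta> \<and> mdeg \<alpha> = Suc n then fact n * of_nat (\<alpha> $ j) / of_real (mfact \<alpha>) else 0)"
    using * by (simp add: fps_prod_pairing)
  also have "\<dots> = (if \<alpha> = \<beta> \<and> mdeg \<alpha> = Suc n then fact n * of_nat (mdeg \<alpha>) / of_real (mfact \<alpha>) else 0)"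
  proof (cases "\<alpha> = \<beta>")
    case True
    \<comment> \<open>The entries of the multi-index sum to its degree \<open>n + 1\<close>, the
      factor that turns \<open>fact n\<close> into \<open>fact (Suc n)\<close>.\<close>
    have "(\<Sum>j | 0 < \<beta> $ j. of_nat (\<beta> $ j)) = (of_nat (mdeg \<beta>) :: complex)"
      unfolding mdeg_def of_nat_sum by (rule sum.mono_neutral_left) auto
    with True show ?thesis by (simp flip: sum_distrib_left sum_divide_distrib)
  qed simp
  also have "\<dots> = (if \<alpha> = \<beta> \<and> mdeg \<alpha> = Suc n then fact (Suc n) / of_real (mfact \<alpha>) else 0)"
    by (cases "\<alpha> = \<beta>") (simp_all add: mult.commute)
  finally show ?case .
qed

text \<open>Only \<open>n = mdeg \<alpha>\<close> contributes to the series, so no convergence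
  question arises.\<close>

lemma fps_exponential_pairing:
  "fps_exponential pairing (\<alpha>, \<beta> :: nat ^ 'd::finite) = (if \<alpha> = \<beta> then 1 / of_real (mfact \<alpha>) else 0)"
proof -
  have "(\<Sum>n. (fps_prod pairing ^^ n) fps_one (\<alpha>, \<beta>) / fact n) =
      (\<Sum>n\<in>{mdeg \<alpha>}. (fps_prod pairing ^^ n) fps_one (\<alpha>, \<beta>) / fact n)"
    by (rule suminf_finite) (auto simp: pairing_power)
  then show ?thesis by (simp add: fps_exponential_def pairing_power)
qed

lemma wick_kernel_eq: "wick_kernel (a :: 'd::finite series2) = exp_shift 1 a"
proof (intro ext)
  fix k :: "(nat ^ 'd) \<times> (nat ^ 'd)"
  obtain \<alpha> \<beta> where k: "k = (\<alpha>, \<beta>)" by (cases k)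
  have "wick_kernel a (\<alpha>, \<beta>) = (\<Sum>\<gamma> | \<gamma> \<le> \<alpha>. \<Sum>\<delta> | \<delta> \<le> \<beta>.
      if \<delta> = \<gamma> then 1 / of_real (mfact \<gamma>) * a (\<alpha> - \<gamma>, \<beta> - \<gamma>) else 0)"
    unfolding wick_kernel_def fps_prod_pair fps_exponential_pairing
    by (intro sum.cong refl) auto
  also have "\<dots> = (\<Sum>\<gamma> | \<gamma> \<le> \<alpha>. if \<gamma> \<le> \<beta> then 1 / of_real (mfact \<gamma>) * a (\<alpha> - \<gamma>, \<beta> - \<gamma>) else 0)"
    by (simp add: sum.delta finite_below)
  also have "\<dots> = (\<Sum>\<gamma> | \<gamma> \<le> \<alpha> \<and> \<gamma> \<le> \<beta>. 1 / of_real (mfact \<gamma>) * a (\<alpha> - \<gamma>, \<beta> - \<gamma>))"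
    by (subst sum.inter_filter[OF finite_below, symmetric]) simp
  finally show "wick_kernel a k = exp_shift 1 a k" by (simp add: k exp_shift_def)
qed

text \<open>The binomial theorem in each coordinate, multiplied out by
  \<open>sum_prod_below\<close>.\<close>

lemma exponential_coefficients_add:
  "(\<Sum>\<gamma> | \<gamma> \<le> \<eta>. s ^ mdeg \<gamma> / of_real (mfact \<gamma>) * (t ^ mdeg (\<eta> - \<gamma>) / of_real (mfact (\<eta> - \<gamma>)))) =
     (s + t) ^ mdeg (\<eta> :: nat ^ 'd::finite) / (of_real (mfact \<eta>) :: complex)"
proof -
  have 1: "s ^ mdeg \<gamma> / of_real (mfact \<gamma>) = (\<Prod>j\<in>UNIV. s ^ (\<gamma> $ j) / fact (\<gamma> $ j))"
    for s :: complex and \<gamma> :: "nat ^ 'd"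
    by (simp add: mdeg_def mfact_def power_sum prod_dividef)
  have 2: "(\<Sum>k\<le>n. s ^ k / fact k * (t ^ (n - k) / fact (n - k))) = (s + t) ^ n / fact n" for n
  proof -
    have "(s + t) ^ n / fact n = (\<Sum>k\<le>n. of_nat (n choose k) * s ^ k * t ^ (n - k) / fact n)"
      by (simp add: binomial_ring sum_divide_distrib)
    also have "\<dots> = (\<Sum>k\<le>n. s ^ k / fact k * (t ^ (n - k) / fact (n - k)))"
      by (intro sum.cong refl) (simp add: binomial_fact field_simps)
    finally show ?thesis ..
  qed
  have "(\<Sum>\<gamma> | \<gamma> \<le> \<eta>. s ^ mdeg \<gamma> / of_real (mfact \<gamma>) * (t ^ mdeg (\<eta> - \<gamma>) / of_real (mfact (\<eta> - \<gamma>)))) =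
      (\<Sum>\<gamma> | \<gamma> \<le> \<eta>. \<Prod>j\<in>UNIV. s ^ (\<gamma> $ j) / fact (\<gamma> $ j) * (t ^ (\<eta> $ j - \<gamma> $ j) / fact (\<eta> $ j - \<gamma> $ j)))"
    unfolding 1 by (simp only: prod.distrib vector_minus_component)
  also have "\<dots> = (\<Prod>j\<in>UNIV. (s + t) ^ (\<eta> $ j) / fact (\<eta> $ j))"
    by (simp only: sum_prod_below[where f = "\<lambda>j k. s ^ k / fact k * (t ^ (\<eta> $ j - k) / fact (\<eta> $ j - k))"] 2)
  finally show ?thesis unfolding 1 .
qed

lemma exp_shift_zero: "exp_shift 0 (a :: 'd::finite series2) = a"
proof (intro ext)
  fix k :: "(nat ^ 'd) \<times> (nat ^ 'd)"
  obtain \<alpha> \<beta> where k: "k = (\<alpha>, \<beta>)" by (cases k)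
  have "mdeg \<gamma> = 0 \<longleftrightarrow> \<gamma> = 0" for \<gamma> :: "nat ^ 'd" by (auto simp: mdeg_def vec_eq_iff)
  then have "exp_shift 0 a (\<alpha>, \<beta>) =
      (\<Sum>\<gamma> | \<gamma> \<le> \<alpha> \<and> \<gamma> \<le> \<beta>. if \<gamma> = 0 then a (\<alpha>, \<beta>) else 0)"
    unfolding exp_shift_def prod.case by (intro sum.cong) (auto simp: power_0_left mfact_def)
  also have "\<dots> = a (\<alpha>, \<beta>)"
    by (subst sum.delta[OF finite_below2]) (simp add: less_eq_vec_def)
  finally show "exp_shift 0 a k = a k" by (simp add: k)
qed

text \<open>The substitution \<open>\<eta> = \<gamma> + \<delta>\<close> collects the double sum
  into convolutions of exponential coefficients.\<close>

lemma exp_shift_add: "exp_shift s (exp_shift t (a :: 'd::finite series2)) = exp_shift (s + t) a"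
proof (intro ext)
  fix k :: "(nat ^ 'd) \<times> (nat ^ 'd)"
  obtain \<alpha> \<beta> where k: "k = (\<alpha>, \<beta>)" by (cases k)
  let ?e = "\<lambda>t (\<gamma> :: nat ^ 'd). t ^ mdeg \<gamma> / (of_real (mfact \<gamma>) :: complex)"
  let ?L = "\<lambda>\<alpha> \<beta>. {\<gamma> :: nat ^ 'd. \<gamma> \<le> \<alpha> \<and> \<gamma> \<le> \<beta>}"
  have "exp_shift s (exp_shift t a) (\<alpha>, \<beta>) = (\<Sum>\<gamma>\<in>?L \<alpha> \<beta>. \<Sum>\<delta>\<in>?L (\<alpha> - \<gamma>) (\<beta> - \<gamma>).
      ?e s \<gamma> * (?e t \<delta> * a (\<alpha> - \<gamma> - \<delta>, \<beta> - \<gamma> - \<delta>)))"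
    by (simp add: exp_shift_def sum_distrib_left)
  also have "\<dots> = (\<Sum>(\<gamma>, \<delta>)\<in>Sigma (?L \<alpha> \<beta>) (\<lambda>\<gamma>. ?L (\<alpha> - \<gamma>) (\<beta> - \<gamma>)).
      ?e s \<gamma> * (?e t \<delta> * a (\<alpha> - \<gamma> - \<delta>, \<beta> - \<gamma> - \<delta>)))"
    by (intro sum.Sigma ballI finite_below2)
  also have "\<dots> = (\<Sum>(\<eta>, \<gamma>)\<in>Sigma (?L \<alpha> \<beta>) (\<lambda>\<eta>. {\<gamma>. \<gamma> \<le> \<eta>}).
      ?e s \<gamma> * (?e t (\<eta> - \<gamma>) * a (\<alpha> - \<eta>, \<beta> - \<eta>)))"
  proof (rule sum.reindex_bij_witness[of _ "\<lambda>(\<eta>, \<gamma>). (\<gamma>, \<eta> - \<gamma>)" "\<lambda>(\<gamma>, \<delta>). (\<gamma> + \<delta>, \<gamma>)"], goal_cases)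
    case (1 x) then show ?case by (auto simp: vec_eq_iff)
  next
    case (2 x)
    obtain \<gamma> \<delta> where "x = (\<gamma>, \<delta>)" by (cases x)
    with 2 show ?case
      by (auto simp: less_eq_vec_def) (metis add.commute le_diff_conv2)+
  next
    case (3 x) then show ?case by (auto simp: vec_eq_iff less_eq_vec_def)
  next
    case (4 x)
    obtain \<eta> \<gamma> where x: "x = (\<eta>, \<gamma>)" by (cases x)
    have "\<gamma> \<le> \<alpha>" "\<gamma> \<le> \<beta>" using 4 x by auto
    moreover have "\<eta> - \<gamma> \<le> \<alpha> - \<gamma>" "\<eta> - \<gamma> \<le> \<beta> - \<gamma>"
      using 4 x by (auto simp: less_eq_vec_def diff_le_mono)
    ultimately show ?case using x by simp
  next
    case (5 x)
    obtain \<gamma> \<delta> where x: "x = (\<gamma>, \<delta>)" by (cases x)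
    have "\<alpha> - (\<gamma> + \<delta>) = \<alpha> - \<gamma> - \<delta>" "\<beta> - (\<gamma> + \<delta>) = \<beta> - \<gamma> - \<delta>" "\<gamma> + \<delta> - \<gamma> = \<delta>"
      by (auto simp: vec_eq_iff)
    then show ?case by (simp add: x)
  qed
  also have "\<dots> = (\<Sum>\<eta>\<in>?L \<alpha> \<beta>. \<Sum>\<gamma> | \<gamma> \<le> \<eta>. ?e s \<gamma> * (?e t (\<eta> - \<gamma>) * a (\<alpha> - \<eta>, \<beta> - \<eta>)))"
    by (intro sum.Sigma[symmetric] ballI finite_below2 finite_below)
  also have "\<dots> = (\<Sum>\<eta>\<in>?L \<alpha> \<beta>. ?e (s + t) \<eta> * a (\<alpha> - \<eta>, \<beta> - \<eta>))"
    by (intro sum.cong refl, subst exponential_coefficients_add[symmetric])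
       (simp only: sum_distrib_right mult.assoc)
  also have "\<dots> = exp_shift (s + t) a (\<alpha>, \<beta>)" by (simp add: exp_shift_def)
  finally show "exp_shift s (exp_shift t a) k = exp_shift (s + t) a k" by (simp add: k)
qed

lemma wick_kernel_inverse:
  "wick_kernel (exp_shift (-1) a) = a" "exp_shift (-1) (wick_kernel a) = a"
  by (simp_all add: wick_kernel_eq exp_shift_add exp_shift_zero)

section \<open>Estimates for multiplication by the exponential\<close>

lemma mfact_le_binomial:
  assumes "\<gamma> \<le> \<alpha>" shows "mfact \<alpha> \<le> 2 ^ mdeg \<alpha> * (mfact \<gamma> * mfact (\<alpha> - \<gamma>))"
proof -
  have "fact n \<le> 2 ^ n * (fact k * fact (n - k) :: real)" if "k \<le> n" for n k :: nat
  proof -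
    have "fact n = real (n choose k) * (fact k * fact (n - k))"
      using that by (simp add: binomial_fact)
    also have "\<dots> \<le> 2 ^ n * (fact k * fact (n - k))"
    proof (intro mult_right_mono)
      have "n choose k \<le> 2 ^ n" by (rule binomial_le_pow2)
      then show "real (n choose k) \<le> 2 ^ n" by (metis of_nat_le_iff of_nat_numeral of_nat_power)
    qed auto
    finally show ?thesis .
  qed
  then have "mfact \<alpha> \<le> (\<Prod>j\<in>UNIV. 2 ^ (\<alpha> $ j) * (fact (\<gamma> $ j) * fact ((\<alpha> - \<gamma>) $ j)))"
    unfolding mfact_def using assms by (intro prod_mono) (auto simp: less_eq_vec_def)
  then show ?thesis by (simp add: prod.distrib mdeg_def mfact_def power_sum)
qed

lemma mfact_add_ge: "mfact \<alpha> * mfact \<beta> \<le> mfact (\<alpha> + \<beta>)"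
proof -
  have "fact m * fact n \<le> (fact (m + n) :: real)" for m n
    by (metis fact_fact_dvd_fact dvd_imp_le fact_gt_zero of_nat_fact of_nat_le_iff of_nat_mult)
  then have "(\<Prod>j\<in>UNIV. fact (\<alpha> $ j) * fact (\<beta> $ j)) \<le> mfact (\<alpha> + \<beta>)"
    unfolding mfact_def by (intro prod_mono) auto
  then show ?thesis by (simp add: mfact_def prod.distrib)
qed

lemma card_below_le: "real (card {\<gamma> :: nat ^ 'd::finite. \<gamma> \<le> \<alpha>}) \<le> 2 ^ mdeg \<alpha>"
proof -
  have "real (card {\<gamma>. \<gamma> \<le> \<alpha>}) = (\<Sum>\<gamma> | \<gamma> \<le> \<alpha>. \<Prod>j\<in>(UNIV :: 'd set). 1)" by simp
  also have "\<dots> = (\<Prod>j\<in>UNIV. \<Sum>k\<le>\<alpha> $ j. 1)" by (rule sum_prod_below)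
  also have "\<dots> \<le> (\<Prod>j\<in>UNIV. 2 ^ (\<alpha> $ j))"
  proof (intro prod_mono conjI)
    fix j
    have "Suc n \<le> 2 ^ n" for n :: nat by (induction n) auto
    then show "(\<Sum>k\<le>\<alpha> $ j. 1) \<le> (2::real) ^ (\<alpha> $ j)"
      by (simp, metis of_nat_Suc of_nat_le_iff of_nat_numeral of_nat_power add.commute)
  qed auto
  finally show ?thesis by (simp add: mdeg_def power_sum)
qed

definition coef_matrix :: "'d::finite series2 \<Rightarrow> nat ^ 'd \<Rightarrow> nat ^ 'd \<Rightarrow> complex" where
  "coef_matrix a \<alpha> \<beta> = coef2 a (\<alpha>, \<beta>)"

text \<open>In normalized coefficients, the term with index \<open>\<gamma>\<close> carries the
  square root of the product of the binomial coefficients of \<open>\<alpha>\<close> and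
  \<open>\<beta>\<close> over \<open>\<gamma>\<close>: the factorial of \<open>\<gamma>\<close>
  cancels. The powers of 2 bound these roots crudely.\<close>

lemma norm_coef_matrix_exp_shift_le:
  assumes t: "cmod t \<le> 1"
  shows "cmod (coef_matrix (exp_shift t a) \<alpha> \<beta>) \<le>
    2 ^ mdeg \<alpha> * 2 ^ mdeg \<beta> * (\<Sum>\<gamma> | \<gamma> \<le> \<alpha> \<and> \<gamma> \<le> \<beta>. cmod (coef_matrix a (\<alpha> - \<gamma>) (\<beta> - \<gamma>)))"
proof -
  have root: "sqrt (mfact \<alpha>) \<le> 2 ^ mdeg \<alpha> * (sqrt (mfact \<gamma>) * sqrt (mfact (\<alpha> - \<gamma>)))"
    if "\<gamma> \<le> \<alpha>" for \<alpha> \<gamma> :: "nat ^ 'd"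
  proof -
    have "sqrt (mfact \<alpha>) \<le> sqrt (2 ^ mdeg \<alpha> * (mfact \<gamma> * mfact (\<alpha> - \<gamma>)))"
      using mfact_le_binomial[OF that] by simp
    also have "\<dots> = sqrt (2 ^ mdeg \<alpha>) * (sqrt (mfact \<gamma>) * sqrt (mfact (\<alpha> - \<gamma>)))"
      by (simp add: real_sqrt_mult)
    also have "\<dots> \<le> 2 ^ mdeg \<alpha> * (sqrt (mfact \<gamma>) * sqrt (mfact (\<alpha> - \<gamma>)))"
    proof (intro mult_right_mono)
      have "sqrt (2 ^ mdeg \<alpha>) \<le> sqrt ((2 ^ mdeg \<alpha>)\<^sup>2)"
        by (intro real_sqrt_le_mono) (simp add: power2_eq_square)
      then show "sqrt (2 ^ mdeg \<alpha>) \<le> 2 ^ mdeg \<alpha>" by simp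
    qed (simp add: less_imp_le[OF mfact_pos])
    finally show ?thesis .
  qed
  have "cmod (coef_matrix (exp_shift t a) \<alpha> \<beta>) \<le>
      (\<Sum>\<gamma> | \<gamma> \<le> \<alpha> \<and> \<gamma> \<le> \<beta>. cmod (t ^ mdeg \<gamma> / of_real (mfact \<gamma>) * a (\<alpha> - \<gamma>, \<beta> - \<gamma>) *
        of_real (sqrt (mfact \<alpha>) * sqrt (mfact \<beta>))))"
    unfolding coef_matrix_def coef2_def exp_shift_def prod.case sum_distrib_right by (rule norm_sum)
  also have "\<dots> \<le> (\<Sum>\<gamma> | \<gamma> \<le> \<alpha> \<and> \<gamma> \<le> \<beta>. 2 ^ mdeg \<alpha> * 2 ^ mdeg \<beta> * cmod (coef_matrix a (\<alpha> - \<gamma>) (\<beta> - \<gamma>)))"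
  proof (intro sum_mono)
    fix \<gamma> assume "\<gamma> \<in> {\<gamma>. \<gamma> \<le> \<alpha> \<and> \<gamma> \<le> \<beta>}"
    then have \<gamma>: "\<gamma> \<le> \<alpha>" "\<gamma> \<le> \<beta>" by auto
    define s where "s = cmod (a (\<alpha> - \<gamma>, \<beta> - \<gamma>))"
    have pos: "mfact x \<ge> 0" for x :: "nat ^ 'd" by (rule less_imp_le[OF mfact_pos])
    have "cmod (t ^ mdeg \<gamma> / of_real (mfact \<gamma>) * a (\<alpha> - \<gamma>, \<beta> - \<gamma>) * of_real (sqrt (mfact \<alpha>) * sqrt (mfact \<beta>))) =
        cmod t ^ mdeg \<gamma> * (s / mfact \<gamma> * (sqrt (mfact \<alpha>) * sqrt (mfact \<beta>)))"
      by (simp add: norm_mult norm_divide norm_power s_def abs_mult abs_of_nonneg[OF pos]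
          abs_of_nonneg[OF real_sqrt_ge_zero[OF pos]])
    also have "\<dots> \<le> 1 * (s / mfact \<gamma> * (sqrt (mfact \<alpha>) * sqrt (mfact \<beta>)))"
      using t pos
      by (intro mult_right_mono power_le_one)
         (auto simp: s_def intro!: divide_nonneg_nonneg mult_nonneg_nonneg)
    also have "\<dots> \<le> 1 * (s / mfact \<gamma> * ((2 ^ mdeg \<alpha> * (sqrt (mfact \<gamma>) * sqrt (mfact (\<alpha> - \<gamma>)))) *
        (2 ^ mdeg \<beta> * (sqrt (mfact \<gamma>) * sqrt (mfact (\<beta> - \<gamma>))))))"
      using pos \<gamma> by (intro mult_left_mono mult_mono root) (auto simp: s_def)
    also have "\<dots> = 2 ^ mdeg \<alpha> * 2 ^ mdeg \<beta> * (s * (sqrt (mfact (\<alpha> - \<gamma>)) * sqrt (mfact (\<beta> - \<gamma>)))) *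
        ((sqrt (mfact \<gamma>) * sqrt (mfact \<gamma>)) / mfact \<gamma>)" by simp
    also have "(sqrt (mfact \<gamma>) * sqrt (mfact \<gamma>)) / mfact \<gamma> = 1" by (simp add: abs_of_nonneg[OF pos])
    also have "s * (sqrt (mfact (\<alpha> - \<gamma>)) * sqrt (mfact (\<beta> - \<gamma>))) = cmod (coef_matrix a (\<alpha> - \<gamma>) (\<beta> - \<gamma>))"
      by (simp add: coef_matrix_def coef2_def norm_mult s_def abs_mult abs_of_nonneg[OF real_sqrt_ge_zero[OF pos]])
    finally show "cmod (t ^ mdeg \<gamma> / of_real (mfact \<gamma>) * a (\<alpha> - \<gamma>, \<beta> - \<gamma>) * of_real (sqrt (mfact \<alpha>) * sqrt (mfact \<beta>)))
      \<le> 2 ^ mdeg \<alpha> * 2 ^ mdeg \<beta> * cmod (coef_matrix a (\<alpha> - \<gamma>) (\<beta> - \<gamma>))" by simp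
  qed
  finally show ?thesis by (simp add: sum_distrib_left)
qed

context weight_scale begin

text \<open>The weight at \<open>\<beta>\<close> is split into weights at
  \<open>\<beta> - \<gamma>\<close> and \<open>\<gamma>\<close>. The hypothesis trades the first for
  a weight at \<open>\<alpha> - \<gamma>\<close>, which is joined with the second to a weight at
  \<open>\<alpha>\<close>, so \<open>\<gamma>\<close> disappears.\<close>

lemma ind_matrix_exp_shift:
  assumes t: "cmod t \<le> 1" and a: "ind_matrix u (coef_matrix a)"
  shows "ind_matrix u (coef_matrix (exp_shift t a))"
  unfolding ind_matrix_def
proof
  fix n1
  obtain n C1 where C1: "C1 > 0" "\<And>\<beta>. 2 ^ mdeg \<beta> * u n1 \<beta> \<le> C1 * u n \<beta>"
    using absorb_power[of 2 n1] by auto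
  obtain n' C2 where C2: "C2 > 0" "\<And>\<alpha> \<beta>. u n (\<alpha> + \<beta>) \<le> C2 * (u n' \<alpha> * u n' \<beta>)"
    using split_add[of n] by blast
  obtain n2 C3 where C3: "\<And>\<alpha> \<beta>. cmod (coef_matrix a \<alpha> \<beta>) * u n' \<beta> \<le> C3 * u n2 \<alpha>"
    using a unfolding ind_matrix_def by blast
  \<comment> \<open>One common step for the two weights that are to be joined.\<close>
  define N where "N = max n2 n'"
  obtain N' C4 where C4: "C4 > 0" "\<And>\<alpha> \<beta>. u N \<alpha> * u N \<beta> \<le> C4 * u N' (\<alpha> + \<beta>)"
    using join_add[of N] by blast
  \<comment> \<open>One factor \<open>2 ^ mdeg \<alpha>\<close> comes from the binomial
    coefficients, the other from the number of \<open>\<gamma>\<close>.\<close>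
  obtain N'' C5 where C5: "C5 > 0" "\<And>\<alpha>. 4 ^ mdeg \<alpha> * u N' \<alpha> \<le> C5 * u N'' \<alpha>"
    using absorb_power[of 4 N'] by auto
  have "cmod (coef_matrix (exp_shift t a) \<alpha> \<beta>) * u n1 \<beta> \<le> (C1 * C2 * \<bar>C3\<bar> * C4 * C5) * u N'' \<alpha>" for \<alpha> \<beta>
  proof -
    let ?L = "{\<gamma>. \<gamma> \<le> \<alpha> \<and> \<gamma> \<le> \<beta>}"
    let ?B = "C1 * C2 * \<bar>C3\<bar> * C4 * u N' \<alpha>"
    have B: "0 \<le> ?B" using C1 C2 C4 nonneg by simp
    have term_le: "2 ^ mdeg \<beta> * u n1 \<beta> * cmod (coef_matrix a (\<alpha> - \<gamma>) (\<beta> - \<gamma>)) \<le> ?B"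
      if \<gamma>: "\<gamma> \<in> ?L" for \<gamma>
    proof -
      have "2 ^ mdeg \<beta> * u n1 \<beta> \<le> C1 * u n (\<beta> - \<gamma> + \<gamma>)"
        using C1(2)[of \<beta>] \<gamma> by (simp add: multiindex_diff_add)
      also have "\<dots> \<le> C1 * (C2 * (u n' (\<beta> - \<gamma>) * u n' \<gamma>))"
        using C1(1) by (intro mult_left_mono C2) auto
      finally have "2 ^ mdeg \<beta> * u n1 \<beta> * cmod (coef_matrix a (\<alpha> - \<gamma>) (\<beta> - \<gamma>)) \<le>
          C1 * (C2 * (u n' (\<beta> - \<gamma>) * u n' \<gamma>)) * cmod (coef_matrix a (\<alpha> - \<gamma>) (\<beta> - \<gamma>))"
        by (rule mult_right_mono) simp
      also have "\<dots> = C1 * C2 * u n' \<gamma> * (cmod (coef_matrix a (\<alpha> - \<gamma>) (\<beta> - \<gamma>)) * u n' (\<beta> - \<gamma>))"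
        by simp
      also have "\<dots> \<le> C1 * C2 * u N \<gamma> * (\<bar>C3\<bar> * u N (\<alpha> - \<gamma>))"
      proof (rule mult_mono)
        show "C1 * C2 * u n' \<gamma> \<le> C1 * C2 * u N \<gamma>"
          using C1(1) C2(1) by (intro mult_left_mono mono) (auto simp: N_def)
        have "cmod (coef_matrix a (\<alpha> - \<gamma>) (\<beta> - \<gamma>)) * u n' (\<beta> - \<gamma>) \<le> C3 * u n2 (\<alpha> - \<gamma>)" by (rule C3)
        also have "\<dots> \<le> \<bar>C3\<bar> * u N (\<alpha> - \<gamma>)"
          unfolding N_def by (intro mult_mono mono nonneg) auto
        finally show "cmod (coef_matrix a (\<alpha> - \<gamma>) (\<beta> - \<gamma>)) * u n' (\<beta> - \<gamma>) \<le> \<bar>C3\<bar> * u N (\<alpha> - \<gamma>)" .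
      qed (use C1(1) C2(1) nonneg in auto)
      also have "\<dots> = C1 * C2 * \<bar>C3\<bar> * (u N (\<alpha> - \<gamma>) * u N \<gamma>)" by simp
      also have "\<dots> \<le> C1 * C2 * \<bar>C3\<bar> * (C4 * u N' (\<alpha> - \<gamma> + \<gamma>))"
        using C1 C2 by (intro mult_left_mono C4) auto
      finally show ?thesis using \<gamma> by (simp add: multiindex_diff_add)
    qed
    have "cmod (coef_matrix (exp_shift t a) \<alpha> \<beta>) * u n1 \<beta> \<le>
        2 ^ mdeg \<alpha> * 2 ^ mdeg \<beta> * (\<Sum>\<gamma>\<in>?L. cmod (coef_matrix a (\<alpha> - \<gamma>) (\<beta> - \<gamma>))) * u n1 \<beta>"
      using norm_coef_matrix_exp_shift_le[OF t, of a \<alpha> \<beta>] nonneg by (intro mult_right_mono) auto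
    also have "\<dots> = 2 ^ mdeg \<alpha> * (\<Sum>\<gamma>\<in>?L. 2 ^ mdeg \<beta> * u n1 \<beta> * cmod (coef_matrix a (\<alpha> - \<gamma>) (\<beta> - \<gamma>)))"
      by (simp add: sum_distrib_left mult_ac)
    also have "\<dots> \<le> 2 ^ mdeg \<alpha> * (\<Sum>\<gamma>\<in>?L. ?B)"
      by (intro mult_left_mono sum_mono term_le) auto
    also have "\<dots> = 2 ^ mdeg \<alpha> * (real (card ?L) * ?B)" by simp
    also have "\<dots> \<le> 2 ^ mdeg \<alpha> * (2 ^ mdeg \<alpha> * ?B)"
    proof (intro mult_left_mono mult_right_mono B)
      have "card ?L \<le> card {\<gamma>. \<gamma> \<le> \<alpha>}" by (intro card_mono finite_below) auto
      then show "real (card ?L) \<le> 2 ^ mdeg \<alpha>" using card_below_le[of \<alpha>] by linarith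
    qed auto
    also have "\<dots> = C1 * C2 * \<bar>C3\<bar> * C4 * (4 ^ mdeg \<alpha> * u N' \<alpha>)"
    proof -
      have "(4::real) ^ mdeg \<alpha> = 2 ^ mdeg \<alpha> * 2 ^ mdeg \<alpha>" by (simp flip: power_mult_distrib)
      then show ?thesis by simp
    qed
    also have "\<dots> \<le> C1 * C2 * \<bar>C3\<bar> * C4 * (C5 * u N'' \<alpha>)"
      using C1 C2 C4 by (intro mult_left_mono C5) auto
    finally show ?thesis by simp
  qed
  then show "\<exists>n2 C. \<forall>\<alpha> \<beta>. cmod (coef_matrix (exp_shift t a) \<alpha> \<beta>) * u n1 \<beta> \<le> C * u n2 \<alpha>" by blast
qed

text \<open>The kernel of the exponential is symmetric, so its multiplication commutes with
  transposition.\<close>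

lemma proj_matrix_exp_shift:
  assumes t: "cmod t \<le> 1" and a: "proj_matrix u (coef_matrix a)"
  shows "proj_matrix u (coef_matrix (exp_shift t a))"
proof -
  have swap: "(\<lambda>\<alpha> \<beta>. coef_matrix b \<beta> \<alpha>) = coef_matrix (\<lambda>(\<alpha>, \<beta>). b (\<beta>, \<alpha>))" for b :: "'d series2"
    by (simp add: coef_matrix_def coef2_def fun_eq_iff)
  have "(\<lambda>(\<alpha>, \<beta>). exp_shift t a (\<beta>, \<alpha>)) = exp_shift t (\<lambda>(\<alpha>, \<beta>). a (\<beta>, \<alpha>))"
    by (auto simp: exp_shift_def fun_eq_iff conj_commute)
  with ind_matrix_exp_shift[OF t, of "\<lambda>(\<alpha>, \<beta>). a (\<beta>, \<alpha>)"] a show ?thesis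
    by (simp add: proj_matrix_def swap)
qed

lemma ind_matrix_wick_kernel:
  "ind_matrix u (coef_matrix (wick_kernel a)) \<longleftrightarrow> ind_matrix u (coef_matrix a)"
  using ind_matrix_exp_shift[of 1 a] ind_matrix_exp_shift[of "-1" "wick_kernel a"]
  by (auto simp: wick_kernel_inverse simp flip: wick_kernel_eq)

lemma proj_matrix_wick_kernel:
  "proj_matrix u (coef_matrix (wick_kernel a)) \<longleftrightarrow> proj_matrix u (coef_matrix a)"
  using proj_matrix_exp_shift[of 1 a] proj_matrix_exp_shift[of "-1" "wick_kernel a"]
  by (auto simp: wick_kernel_inverse simp flip: wick_kernel_eq)

end

section \<open>From sequence spaces to power series\<close>

lemma lp_norm_swap: "lp_norm p (\<lambda>(\<alpha>, \<beta>). f (\<beta>, \<alpha>)) = lp_norm p f"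
proof -
  have eq: "(\<lambda>(\<alpha>, \<beta>). f (\<beta>, \<alpha>)) = f \<circ> prod.swap" by auto
  have "(SUP i. (f \<circ> prod.swap) i) = (SUP i. f i)"
    by (metis image_comp surj_swap)
  moreover have "(\<Sum>\<^sub>\<infinity>i. epowr ((f \<circ> prod.swap) i) q) = (\<Sum>\<^sub>\<infinity>i. epowr (f i) q)" for q
    using infsum_reindex_bij_betw[of prod.swap UNIV UNIV "\<lambda>i. epowr (f i) q"] by (simp add: bij_swap)
  ultimately show ?thesis unfolding eq lp_norm_def by simp
qed

text \<open>Lets the projective \<open>\<B>\<close>-space be read off from the inductive one by
  transposition.\<close>

lemma lp_space_swap:
  "c \<in> lp_space p (\<lambda>(\<alpha>, \<beta>). \<omega> \<alpha> \<beta>) \<longleftrightarrow> (\<lambda>(\<alpha>, \<beta>). c (\<beta>, \<alpha>)) \<in> lp_space p (\<lambda>(\<alpha>, \<beta>). \<omega> \<beta> \<alpha>)"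
proof -
  have "(\<lambda>i. ennreal (cmod (case i of (\<alpha>, \<beta>) \<Rightarrow> c (\<beta>, \<alpha>))) * (case i of (\<alpha>, \<beta>) \<Rightarrow> \<omega> \<beta> \<alpha>)) =
      (\<lambda>(\<alpha>, \<beta>). (\<lambda>i. ennreal (cmod (c i)) * (case i of (\<alpha>, \<beta>) \<Rightarrow> \<omega> \<alpha> \<beta>)) (\<beta>, \<alpha>))" by auto
  from trans[OF arg_cong[where f = "lp_norm p", OF this] lp_norm_swap]
  show ?thesis unfolding lp_space_def wnorm_def mem_Collect_eq by (rule arg_cong[OF sym])
qed

context weight_limit begin

text \<open>Here \<open>p\<close> disappears from the \<open>\<B>\<close>-spaces. A double sequence
  must gain decay in both variables, by raising the step in \<open>\<beta>\<close> before the
  hypothesis is used and the step in \<open>\<alpha>\<close> after it.\<close>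

lemma ind_matrix_space_iff:
  "c \<in> (\<Inter>r1\<in>{0<..}. \<Union>r2\<in>{0<..}. lp_space p (\<lambda>(\<alpha>, \<beta>). h r1 \<beta> / h r2 \<alpha>)) \<longleftrightarrow>
     ind_matrix u (\<lambda>\<alpha> \<beta>. c (\<alpha>, \<beta>))" (is "?L \<longleftrightarrow> ?R")
proof
  assume L: ?L
  show ?R unfolding ind_matrix_def
  proof
    fix n1
    obtain r1 where r1: "r1 > 0" "\<And>\<alpha>. ennreal (u n1 \<alpha>) \<le> h r1 \<alpha>" using below_step by blast
    obtain r2 where r2: "r2 > 0" "wnorm p (\<lambda>(\<alpha>, \<beta>). h r1 \<beta> / h r2 \<alpha>) c < \<infinity>"
      using L r1(1) by (auto simp: lp_space_def)
    obtain C where C: "C > 0" "\<And>i. ennreal (cmod (c i)) * (case i of (\<alpha>, \<beta>) \<Rightarrow> h r1 \<beta> / h r2 \<alpha>) \<le> ennreal C"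
      using wnorm_less_imp_bound[OF p r2(2)] by blast
    obtain n2 where n2: "\<And>\<alpha>. h r2 \<alpha> \<le> ennreal (u n2 \<alpha>)" using above_step[OF r2(1)] by blast
    have "cmod (c (\<alpha>, \<beta>)) * u n1 \<beta> \<le> C * u n2 \<alpha>" for \<alpha> \<beta>
    proof -
      have "ennreal (cmod (c (\<alpha>, \<beta>)) * u n1 \<beta>) \<le> ennreal (cmod (c (\<alpha>, \<beta>))) * h r1 \<beta>"
        using nonneg by (simp add: ennreal_mult mult_left_mono r1)
      also have "\<dots> \<le> ennreal C * h r2 \<alpha>"
        using C(2)[of "(\<alpha>, \<beta>)"] C(1) step_finite[OF r2(1), of \<alpha>]
        by (simp add: ennreal_times_divide ennreal_divide_le_iff_mult)
      also have "\<dots> \<le> ennreal C * ennreal (u n2 \<alpha>)" by (intro mult_left_mono n2) auto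
      finally show ?thesis using C(1) nonneg by (simp flip: ennreal_mult)
    qed
    then show "\<exists>n2 C. \<forall>\<alpha> \<beta>. cmod (c (\<alpha>, \<beta>)) * u n1 \<beta> \<le> C * u n2 \<alpha>" by blast
  qed
next
  assume R: ?R
  have "\<exists>r2>0. wnorm p (\<lambda>(\<alpha>, \<beta>). h r1 \<beta> / h r2 \<alpha>) c < \<infinity>" if r1: "r1 > 0" for r1
  proof -
    obtain n1 where n1: "\<And>\<beta>. h r1 \<beta> \<le> ennreal (u n1 \<beta>)" using above_step[OF r1] by blast
    \<comment> \<open>The decay in \<open>\<beta>\<close> has to be secured first, since
      \<open>n2\<close> depends on the step at which the hypothesis is applied.\<close>
    obtain n1' C1 where C1: "C1 > 0" "\<And>\<beta>. gain p ^ mdeg \<beta> * u n1 \<beta> \<le> C1 * u n1' \<beta>"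
      using absorb_power[OF gain_ge_1] by blast
    obtain n2 C where C: "\<And>\<alpha> \<beta>. cmod (c (\<alpha>, \<beta>)) * u n1' \<beta> \<le> C * u n2 \<alpha>"
      using R unfolding ind_matrix_def by blast
    obtain n2' C2 where C2: "C2 > 0" "\<And>\<alpha>. gain p ^ mdeg \<alpha> * u n2 \<alpha> \<le> C2 * u n2' \<alpha>"
      using absorb_power[OF gain_ge_1] by blast
    obtain r2 where r2: "r2 > 0" "\<And>\<alpha>. ennreal (u n2' \<alpha>) \<le> h r2 \<alpha>" using below_step by blast
    define K where "K = C1 * (\<bar>C\<bar> + 1) * C2"
    have K: "K > 0" using C1(1) C2(1) by (simp add: K_def)
    obtain D where D: "\<And>K (f :: (nat ^ 'd) \<times> (nat ^ 'd) \<Rightarrow> ennreal). 0 \<le> K \<Longrightarrow>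
        (\<And>i. f i \<le> ennreal (K * (1 / gain p ^ mdeg (fst i) * (1 / gain p ^ mdeg (snd i))))) \<Longrightarrow>
        lp_norm p f \<le> ennreal (K * D)"
      using lp_norm_le_mdeg2[OF p] by meson
    have "wnorm p (\<lambda>(\<alpha>, \<beta>). h r1 \<beta> / h r2 \<alpha>) c \<le> ennreal (K * D)"
      unfolding wnorm_def
    proof (rule D)
      fix i :: "(nat ^ 'd) \<times> (nat ^ 'd)"
      obtain \<alpha> \<beta> where i: "i = (\<alpha>, \<beta>)" by (cases i)
      define G H where "G = gain p ^ mdeg \<alpha>" and "H = gain p ^ mdeg \<beta>"
      have G: "G > 0" "H > 0" using gain_ge_1[of p] by (auto simp: G_def H_def)
      have "G * H * (cmod (c (\<alpha>, \<beta>)) * u n1 \<beta>) = G * (cmod (c (\<alpha>, \<beta>)) * (H * u n1 \<beta>))" by simp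
      also have "\<dots> \<le> G * (cmod (c (\<alpha>, \<beta>)) * (C1 * u n1' \<beta>))"
        using G C1(2)[of \<beta>] by (intro mult_left_mono) (auto simp: H_def)
      also have "\<dots> = G * C1 * (cmod (c (\<alpha>, \<beta>)) * u n1' \<beta>)" by simp
      also have "\<dots> \<le> G * C1 * ((\<bar>C\<bar> + 1) * u n2 \<alpha>)"
      proof (intro mult_left_mono)
        have "C * u n2 \<alpha> \<le> (\<bar>C\<bar> + 1) * u n2 \<alpha>" by (intro mult_right_mono nonneg) auto
        then show "cmod (c (\<alpha>, \<beta>)) * u n1' \<beta> \<le> (\<bar>C\<bar> + 1) * u n2 \<alpha>" using C[of \<alpha> \<beta>] by linarith
      qed (use G C1(1) in auto)
      also have "\<dots> = C1 * (\<bar>C\<bar> + 1) * (G * u n2 \<alpha>)" by simp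
      also have "\<dots> \<le> C1 * (\<bar>C\<bar> + 1) * (C2 * u n2' \<alpha>)"
        using C1(1) C2(2)[of \<alpha>] by (intro mult_left_mono) (auto simp: G_def)
      finally have le: "cmod (c (\<alpha>, \<beta>)) * u n1 \<beta> \<le> K * (1 / G * (1 / H)) * u n2' \<alpha>"
        using G by (simp add: K_def field_simps)
      have "ennreal (cmod (c (\<alpha>, \<beta>))) * h r1 \<beta> \<le> ennreal (cmod (c (\<alpha>, \<beta>)) * u n1 \<beta>)"
        using nonneg by (simp add: ennreal_mult mult_left_mono n1)
      also have "\<dots> \<le> ennreal (K * (1 / G * (1 / H))) * ennreal (u n2' \<alpha>)"
        using le K G nonneg by (simp flip: ennreal_mult)
      also have "\<dots> \<le> ennreal (K * (1 / G * (1 / H))) * h r2 \<alpha>" by (intro mult_left_mono r2) auto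
      finally have "ennreal (cmod (c (\<alpha>, \<beta>))) * h r1 \<beta> / h r2 \<alpha> \<le> ennreal (K * (1 / G * (1 / H)))"
        by (subst ennreal_divide_le_iff_mult) (use K G step_finite[OF r2(1)] in auto)
      then show "ennreal (cmod (c i)) * (case i of (\<alpha>, \<beta>) \<Rightarrow> h r1 \<beta> / h r2 \<alpha>) \<le>
          ennreal (K * (1 / gain p ^ mdeg (fst i) * (1 / gain p ^ mdeg (snd i))))"
        by (simp add: i G_def H_def ennreal_times_divide)
    qed (use K in auto)
    then show ?thesis using r2(1) by (intro exI[of _ r2]) (auto elim: le_less_trans)
  qed
  then show ?L by (auto simp: lp_space_def)
qed

lemma proj_matrix_space_iff:
  "c \<in> (\<Inter>r2\<in>{0<..}. \<Union>r1\<in>{0<..}. lp_space p (\<lambda>(\<alpha>, \<beta>). h r2 \<alpha> / h r1 \<beta>)) \<longleftrightarrow>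
     proj_matrix u (\<lambda>\<alpha> \<beta>. c (\<alpha>, \<beta>))"
proof -
  have "c \<in> (\<Inter>r2\<in>{0<..}. \<Union>r1\<in>{0<..}. lp_space p (\<lambda>(\<alpha>, \<beta>). h r2 \<alpha> / h r1 \<beta>)) \<longleftrightarrow>
      (\<lambda>(\<alpha>, \<beta>). c (\<beta>, \<alpha>)) \<in> (\<Inter>r1\<in>{0<..}. \<Union>r2\<in>{0<..}. lp_space p (\<lambda>(\<alpha>, \<beta>). h r1 \<beta> / h r2 \<alpha>))"
    by (simp add: lp_space_swap[of c])
  then show ?thesis unfolding ind_matrix_space_iff proj_matrix_def by simp
qed

end

text \<open>The summability condition sees only the ratios \<open>u n / u m\<close>, so a common
  factor \<open>f\<close> is harmless. Taking \<open>f\<close> to be a root of the factorial or its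
  inverse passes to monomial coefficients.\<close>

lemma (in weight_scale) koethe_weights_mult:
  assumes f: "\<And>\<alpha>. 0 < f \<alpha>"
  shows "koethe_weights (\<lambda>n \<alpha>. u n \<alpha> * f \<alpha>)"
proof
  show "0 \<le> u n i * f i" for n i using nonneg[of n i] f[of i] by simp
  show "u n i * f i \<le> u m i * f i" if "n \<le> m" for n m i
    using mono[OF that, of i] f[of i] by simp
  show "\<exists>n. 0 < u n i * f i" for i using pos[of i] f[of i] by (auto intro: mult_pos_pos)
  show "\<exists>m g. (\<forall>i. 0 \<le> g i) \<and> g summable_on UNIV \<and> (\<forall>i. u n i * f i \<le> g i * (u m i * f i))" for n
  proof -
    obtain m C where C: "C > 0" "\<And>\<alpha>. 2 ^ mdeg \<alpha> * u n \<alpha> \<le> C * u m \<alpha>"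
      using absorb_power[of 2 n] by auto
    have "u n i * f i \<le> C * (1/2) ^ mdeg i * (u m i * f i)" for i
    proof -
      have "u n i \<le> C * (1/2) ^ mdeg i * u m i" using C(2)[of i] by (simp add: field_simps power_one_over)
      from mult_right_mono[OF this less_imp_le[OF f[of i]]] show ?thesis by (simp add: mult.assoc)
    qed
    moreover have "(\<lambda>\<alpha> :: nat ^ 'd. C * (1/2) ^ mdeg \<alpha>) summable_on UNIV"
      by (rule summable_on_cmult_right[OF summable_half_power_mdeg])
    ultimately show ?thesis using C(1)
      by (intro exI[of _ m] exI[of _ "\<lambda>\<alpha>. C * (1/2) ^ mdeg \<alpha>"]) auto
  qed
qed

section \<open>Transport from normalized to monomial coefficients\<close>

lemma sqrt_mfact_pos: "0 < sqrt (mfact (\<alpha> :: nat ^ 'd::finite))"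
  by simp

lemma coef_surj: "\<exists>F. coef F = c"
  using sqrt_mfact_pos
  by (intro exI[of _ "\<lambda>\<alpha>. c \<alpha> / of_real (sqrt (mfact \<alpha>))"]) (auto simp: coef_def fun_eq_iff)

lemma coef_eq_iff: "coef F = coef G \<longleftrightarrow> F = G"
  by (auto simp: coef_def fun_eq_iff)

lemma coef_linear: "coef (\<lambda>\<alpha>. a * F \<alpha> + b * G \<alpha>) = (\<lambda>\<alpha>. a * coef F \<alpha> + b * coef G \<alpha>)"
  by (simp add: coef_def fun_eq_iff algebra_simps)

lemma norm_coef: "cmod (coef F \<alpha>) = cmod (F \<alpha>) * sqrt (mfact \<alpha>)"
  by (simp add: coef_def norm_mult abs_of_pos[OF sqrt_mfact_pos])

text \<open>\<open>coef\<close> is a linear bijection, so open sets and neighbourhoods of zero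
  correspond under images.\<close>

lemma topology_with_zero_nhds_pullback:
  assumes X: "topology_with_zero_nhds X S nhd"
  shows "topology_with_zero_nhds (pullback_topology UNIV coef X) {F. coef F \<in> S} (\<lambda>W. nhd (coef ` W))"
  unfolding topology_with_zero_nhds_def
proof
  fix U
  have "openin (pullback_topology UNIV coef X) U \<longleftrightarrow> openin X (coef ` U)"
  proof -
    have vi: "coef ` (coef -` U') = U'" for U' :: "(nat ^ 'a \<Rightarrow> complex) set"
      using coef_surj by (metis surj_def surj_image_vimage_eq)
    have iv: "coef -` (coef ` U) = U" by (auto simp: coef_eq_iff)
    show ?thesis unfolding openin_pullback_topology using vi iv by auto metis
  qed
  also have "\<dots> \<longleftrightarrow> coef ` U \<subseteq> S \<and> (\<forall>x\<in>coef ` U. \<exists>W. nhd W \<and> (\<forall>w\<in>W. (\<lambda>i. x i + w i) \<in> coef ` U))"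
    by (rule spec[OF X[unfolded topology_with_zero_nhds_def]])
  also have "\<dots> \<longleftrightarrow> U \<subseteq> {F. coef F \<in> S} \<and>
      (\<forall>x\<in>U. \<exists>W. nhd (coef ` W) \<and> (\<forall>w\<in>W. (\<lambda>i. x i + w i) \<in> U))"
  proof (intro conj_cong)
    have add: "(\<lambda>i. coef x i + coef w i) \<in> coef ` U \<longleftrightarrow> (\<lambda>i. x i + w i) \<in> U" for x w
    proof -
      have "(\<lambda>i. coef x i + coef w i) = coef (\<lambda>i. x i + w i)" using coef_linear[of 1 x 1 w] by simp
      then show ?thesis by (simp add: image_iff coef_eq_iff)
    qed
    have vi: "coef ` (coef -` W) = W" for W :: "(nat ^ 'a \<Rightarrow> complex) set"
      using coef_surj by (metis surj_def surj_image_vimage_eq)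
    have ex: "(\<exists>W. nhd W \<and> Q W) \<longleftrightarrow> (\<exists>W. nhd (coef ` W) \<and> Q (coef ` W))" for Q
      using vi by metis
    show "(\<forall>x\<in>coef ` U. \<exists>W. nhd W \<and> (\<forall>w\<in>W. (\<lambda>i. x i + w i) \<in> coef ` U)) \<longleftrightarrow>
        (\<forall>x\<in>U. \<exists>W. nhd (coef ` W) \<and> (\<forall>w\<in>W. (\<lambda>i. x i + w i) \<in> U))"
      unfolding ex by (simp only: ball_simps(9) add)
  qed auto
  finally show "openin (pullback_topology UNIV coef X) U \<longleftrightarrow> U \<subseteq> {F. coef F \<in> S} \<and>
      (\<forall>x\<in>U. \<exists>W. nhd (coef ` W) \<and> (\<forall>w\<in>W. (\<lambda>i. x i + w i) \<in> U))" .
qed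

lemma abs_convex_coef_image: "abs_convex (coef ` W) \<longleftrightarrow> abs_convex W"
  unfolding abs_convex_def by (simp add: coef_linear[symmetric] image_iff coef_eq_iff)

lemma coef_in_ind_space: "coef F \<in> ind_space u \<longleftrightarrow> F \<in> ind_space (\<lambda>n \<alpha>. u n \<alpha> * (1 / sqrt (mfact \<alpha>)))"
  using sqrt_mfact_pos by (simp add: ind_space_def norm_coef pos_le_divide_eq)

lemma coef_in_proj_space: "coef F \<in> proj_space u \<longleftrightarrow> F \<in> proj_space (\<lambda>n \<alpha>. u n \<alpha> * sqrt (mfact \<alpha>))"
  by (simp add: proj_space_def norm_coef mult_ac)

lemma ind_zero_nhd_coef_image:
  "ind_zero_nhd u (coef ` W) \<longleftrightarrow> ind_zero_nhd (\<lambda>n \<alpha>. u n \<alpha> * (1 / sqrt (mfact \<alpha>))) W"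
proof -
  have "(\<forall>c. (\<forall>i. cmod (c i) \<le> \<epsilon> * u n i) \<longrightarrow> c \<in> coef ` W) \<longleftrightarrow>
      (\<forall>c. (\<forall>i. cmod (c i) \<le> \<epsilon> * (u n i * (1 / sqrt (mfact i)))) \<longrightarrow> c \<in> W)" (is "?L \<longleftrightarrow> ?R") for \<epsilon> n
  proof -
    have "?L \<longleftrightarrow> (\<forall>c. (\<forall>i. cmod (coef c i) \<le> \<epsilon> * u n i) \<longrightarrow> coef c \<in> coef ` W)"
      using coef_surj by metis
    also have "\<dots> \<longleftrightarrow> ?R"
      using sqrt_mfact_pos by (simp add: norm_coef pos_le_divide_eq image_iff coef_eq_iff)
    finally show ?thesis .
  qed
  then show ?thesis
    unfolding ind_zero_nhd_def abs_convex_coef_image by (auto simp: coef_in_ind_space)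
qed

lemma proj_zero_nhd_coef_image:
  "proj_zero_nhd u (coef ` W) \<longleftrightarrow> proj_zero_nhd (\<lambda>n \<alpha>. u n \<alpha> * sqrt (mfact \<alpha>)) W"
proof -
  have "(\<forall>c\<in>proj_space u. (\<forall>i. cmod (c i) * u n i \<le> \<epsilon>) \<longrightarrow> c \<in> coef ` W) \<longleftrightarrow>
      (\<forall>c\<in>proj_space (\<lambda>n \<alpha>. u n \<alpha> * sqrt (mfact \<alpha>)).
        (\<forall>i. cmod (c i) * (u n i * sqrt (mfact i)) \<le> \<epsilon>) \<longrightarrow> c \<in> W)" (is "?L \<longleftrightarrow> ?R") for \<epsilon> n
  proof -
    have "?L \<longleftrightarrow> (\<forall>c. coef c \<in> proj_space u \<longrightarrow> (\<forall>i. cmod (coef c i) * u n i \<le> \<epsilon>) \<longrightarrow> coef c \<in> coef ` W)"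
      using coef_surj by metis
    also have "\<dots> \<longleftrightarrow> ?R"
      by (simp add: norm_coef image_iff coef_eq_iff coef_in_proj_space Ball_def mult_ac)
    finally show ?thesis .
  qed
  then show ?thesis
    unfolding proj_zero_nhd_def abs_convex_coef_image by (auto simp: coef_in_proj_space)
qed

text \<open>The matrix of the operator with kernel \<open>K\<close> with respect to the monomials \<open>z\<^sup>\<alpha>\<close> instead of the
  normalized ones.\<close>

definition monomial_matrix :: "'d::finite series2 \<Rightarrow> nat ^ 'd \<Rightarrow> nat ^ 'd \<Rightarrow> complex" where
  "monomial_matrix K \<alpha> \<beta> = K (\<alpha>, \<beta>) * of_real (mfact \<beta>)"

lemma norm_coef_matrix:
  "cmod (coef_matrix K \<alpha> \<beta>) = cmod (monomial_matrix K \<alpha> \<beta>) * sqrt (mfact \<alpha>) / sqrt (mfact \<beta>)"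
proof -
  have "mfact \<beta> / sqrt (mfact \<beta>) = sqrt (mfact \<beta>)" by (rule real_div_sqrt) (rule less_imp_le[OF mfact_pos])
  then have "cmod (monomial_matrix K \<alpha> \<beta>) * sqrt (mfact \<alpha>) / sqrt (mfact \<beta>) =
      cmod (K (\<alpha>, \<beta>)) * sqrt (mfact \<alpha>) * sqrt (mfact \<beta>)"
    by (simp add: monomial_matrix_def norm_mult abs_of_nonneg[OF less_imp_le[OF mfact_pos]])
       (metis mult.assoc mult.commute times_divide_eq_right)
  then show ?thesis
    by (simp add: coef_matrix_def coef2_def norm_mult abs_mult abs_of_pos[OF sqrt_mfact_pos])
qed

lemma ind_matrix_coef:
  "ind_matrix u (coef_matrix K) \<longleftrightarrow> ind_matrix (\<lambda>n \<alpha>. u n \<alpha> * (1 / sqrt (mfact \<alpha>))) (monomial_matrix K)"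
proof -
  have "cmod (coef_matrix K \<alpha> \<beta>) * u n1 \<beta> \<le> C * u n2 \<alpha> \<longleftrightarrow>
      cmod (monomial_matrix K \<alpha> \<beta>) * (u n1 \<beta> * (1 / sqrt (mfact \<beta>))) \<le> C * (u n2 \<alpha> * (1 / sqrt (mfact \<alpha>)))"
    for n1 n2 C \<alpha> \<beta>
    using sqrt_mfact_pos[of \<alpha>] by (simp add: norm_coef_matrix pos_le_divide_eq mult_ac)
  then show ?thesis unfolding ind_matrix_def by simp
qed

lemma proj_matrix_coef:
  "proj_matrix u (coef_matrix K) \<longleftrightarrow> proj_matrix (\<lambda>n \<alpha>. u n \<alpha> * sqrt (mfact \<alpha>)) (monomial_matrix K)"
proof -
  have "cmod (coef_matrix K \<alpha> \<beta>) * u n2 \<alpha> \<le> C * u n1 \<beta> \<longleftrightarrow>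
      cmod (monomial_matrix K \<alpha> \<beta>) * (u n2 \<alpha> * sqrt (mfact \<alpha>)) \<le> C * (u n1 \<beta> * sqrt (mfact \<beta>))"
    for n1 n2 C \<alpha> \<beta>
    using sqrt_mfact_pos[of \<beta>] by (simp add: norm_coef_matrix pos_divide_le_eq mult_ac)
  then show ?thesis unfolding proj_matrix_def ind_matrix_def by simp
qed

lemma exp_shift_linear:
  "exp_shift t (\<lambda>k. c * a k + d * b k) k = c * exp_shift t a k + d * exp_shift t b k"
  by (cases k) (simp add: exp_shift_def sum_distrib_left sum.distrib algebra_simps)

lemma monomial_matrix_linear:
  "monomial_matrix (wick_kernel (\<lambda>k. c * a k + d * b k)) =
     (\<lambda>\<alpha> \<beta>. c * monomial_matrix (wick_kernel a) \<alpha> \<beta> + d * monomial_matrix (wick_kernel b) \<alpha> \<beta>)"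
  by (simp add: fun_eq_iff monomial_matrix_def wick_kernel_eq exp_shift_linear algebra_simps)

lemma monomial_matrix_wick_kernel_inj:
  assumes "monomial_matrix (wick_kernel a) = monomial_matrix (wick_kernel b)" shows "a = b"
proof -
  have "wick_kernel a k = wick_kernel b k" for k
    using fun_cong[OF fun_cong[OF assms], of "fst k" "snd k"] by (simp add: monomial_matrix_def)
  then have "wick_kernel a = wick_kernel b" by blast
  then show ?thesis by (metis wick_kernel_inverse(2))
qed

lemma monomial_matrix_wick_kernel_surj: "\<exists>a. monomial_matrix (wick_kernel a) = m"
  by (intro exI[of _ "exp_shift (-1) (\<lambda>(\<alpha>, \<beta>). m \<alpha> \<beta> / of_real (mfact \<beta>))"])
     (simp add: wick_kernel_inverse monomial_matrix_def fun_eq_iff)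

section \<open>Wick operators as matrices and the abstract isomorphism\<close>

lemma matrix_op_finite_support:
  assumes "finite A" "\<And>j. j \<notin> A \<Longrightarrow> c j = 0"
  shows "matrix_op m c i = (\<Sum>j\<in>A. m i j * c j)"
proof -
  have "(\<Sum>\<^sub>\<infinity>j. m i j * c j) = (\<Sum>\<^sub>\<infinity>j\<in>A. m i j * c j)"
    by (rule infsum_cong_neutral) (use assms in auto)
  then show ?thesis using assms(1) by (simp add: matrix_op_def)
qed

lemma matrix_op_unit_seq: "matrix_op m (unit_seq j) i = m i j"
  by (subst matrix_op_finite_support[of "{j}"]) (auto simp: unit_seq_def)

lemma wick_op_eq_matrix_op:
  assumes "F \<in> polynomials"
  shows "wick_op a F = matrix_op (monomial_matrix (wick_kernel a)) F"
proof (rule ext)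
  fix \<alpha>
  have supp: "{\<beta>. coef F \<beta> \<noteq> 0} = {\<beta>. F \<beta> \<noteq> 0}" by (auto simp: coef_def)
  have "coef2 (wick_kernel a) (\<alpha>, \<beta>) * coef F \<beta> / of_real (sqrt (mfact \<alpha>)) =
      monomial_matrix (wick_kernel a) \<alpha> \<beta> * F \<beta>" for \<beta>
  proof -
    have "complex_of_real (sqrt (mfact \<beta>)) * of_real (sqrt (mfact \<beta>)) = of_real (mfact \<beta>)"
      using less_imp_le[OF mfact_pos[of \<beta>]] by (simp flip: of_real_mult)
    then show ?thesis
      using sqrt_mfact_pos[of \<alpha>]
      by (simp add: coef2_def coef_def monomial_matrix_def)
  qed
  then have "wick_op a F \<alpha> = (\<Sum>\<beta> | F \<beta> \<noteq> 0. monomial_matrix (wick_kernel a) \<alpha> \<beta> * F \<beta>)"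
    by (simp add: wick_op_def supp sum_divide_distrib)
  also have "\<dots> = matrix_op (monomial_matrix (wick_kernel a)) F \<alpha>"
    using assms by (intro matrix_op_finite_support[symmetric]) (auto simp: polynomials_def)
  finally show "wick_op a F \<alpha> = matrix_op (monomial_matrix (wick_kernel a)) F \<alpha>" .
qed

text \<open>The symbol enters only through the matrix of its kernel, and every matrix is the kernel
  matrix of exactly one symbol; the isomorphism thus reduces to the description of continuous maps
  by \<open>mat\<close>.\<close>

locale wick_space = matrix_topology V S nhd mat
  for V :: "'d::finite series topology" and S nhd mat +
  fixes B :: "'d series2 set"
  assumes B_iff: "a \<in> B \<longleftrightarrow> mat (monomial_matrix (wick_kernel a))"
begin

abbreviation "M a \<equiv> monomial_matrix (wick_kernel a)"

lemma linear_on_op: "mat m \<Longrightarrow> linear_on S (matrix_op m)"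
  by (intro linear_on_matrix_op mat_summable)

lemma continuous_op: "mat m \<Longrightarrow> continuous_map V V (matrix_op m)"
  using continuous_map_linear_iff[OF linear_on_op mat_in] mat_nhd by blast

lemma op_in_cont_lin:
  assumes m: "mat m" shows "restrict (matrix_op m) S \<in> cont_lin V"
proof -
  have "continuous_map V V (restrict (matrix_op m) S)"
    by (rule continuous_map_eq[OF continuous_op[OF m]]) (simp add: topspace_eq)
  moreover have "restrict (matrix_op m) S (\<lambda>\<alpha>. c * F \<alpha> + d * G \<alpha>) =
      (\<lambda>\<alpha>. c * restrict (matrix_op m) S F \<alpha> + d * restrict (matrix_op m) S G \<alpha>)"
    if "F \<in> S" "G \<in> S" for F G c d
    using that lin[OF that] linear_onD[OF linear_on_op[OF m] that] by simp
  ultimately show ?thesis by (simp add: cont_lin_def topspace_eq)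
qed

text \<open>Existence is continuity of the matrix operator, uniqueness is density of the
  polynomials; together they make the description in \<open>Op\<close> meaningful.\<close>

lemma wick_extension_iff:
  assumes a: "a \<in> B"
  shows "wick_extension V a T \<longleftrightarrow> T = restrict (matrix_op (M a)) S"
proof
  have m: "mat (M a)" using a B_iff by simp
  have ext: "wick_extension V a (restrict (matrix_op (M a)) S)"
    using op_in_cont_lin[OF m] unfolding wick_extension_def cont_lin_def
    by (simp add: topspace_eq wick_op_eq_matrix_op)
  then show "T = restrict (matrix_op (M a)) S \<Longrightarrow> wick_extension V a T" by simp
  assume T: "wick_extension V a T"
  have cont: "continuous_map V V T" "continuous_map V V (restrict (matrix_op (M a)) S)"
    using T ext unfolding wick_extension_def by blast+
  have "T x = restrict (matrix_op (M a)) S x" if x: "x \<in> S" for x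
  proof (rule continuous_extension_unique[OF cont _ x])
    fix y assume "y \<in> S" "finite {i. y i \<noteq> 0}"
    then show "T y = restrict (matrix_op (M a)) S y"
      using T ext unfolding wick_extension_def polynomials_def topspace_eq by (metis IntI mem_Collect_eq)
  qed
  moreover have "T \<in> extensional S" using T by (simp add: wick_extension_def topspace_eq)
  ultimately show "T = restrict (matrix_op (M a)) S" by (intro extensionalityI[of T S]) auto
qed

lemma Op_eq: "a \<in> B \<Longrightarrow> Op V a = restrict (matrix_op (M a)) S"
  unfolding Op_def by (rule the_equality) (simp_all add: wick_extension_iff)

text \<open>The map and the operator of its matrix agree on finitely supported sequences by
  linearity, hence everywhere by density.\<close>

lemma cont_lin_is_op:
  assumes T: "T \<in> cont_lin V"
  obtains m where "mat m" "T = restrict (matrix_op m) S"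
proof
  have lin_T: "linear_on S T" and cont: "continuous_map V V T" and undef: "T \<in> extensional S"
    using T by (auto simp: cont_lin_def linear_on_def topspace_eq)
  have TS: "T x \<in> S" if "x \<in> S" for x
    using continuous_map_image_subset_topspace[OF cont] that by (auto simp: topspace_eq)
  let ?m = "\<lambda>i j. T (unit_seq j) i"
  show m: "mat ?m" by (rule mat_of_map[OF lin_T TS cont])
  have "T x = matrix_op ?m x" if x: "x \<in> S" for x
  proof (rule continuous_extension_unique[OF cont continuous_op[OF m] _ x])
    fix y assume y: "y \<in> S" "finite {i. y i \<noteq> 0}"
    have "T y = T (\<lambda>i. if i \<in> {i. y i \<noteq> 0} then y i else 0)"
      by (rule arg_cong[of _ _ T]) auto
    also have "\<dots> = (\<lambda>i. \<Sum>j | y j \<noteq> 0. ?m i j * y j)"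
      by (rule linear_on_finite_support(2)[OF lin_T y(2)])
    also have "\<dots> = matrix_op ?m y"
      by (rule ext, rule matrix_op_finite_support[symmetric]) (use y in auto)
    finally show "T y = matrix_op ?m y" .
  qed
  then show "T = restrict (matrix_op ?m) S"
    using undef by (intro extensionalityI[of T S]) auto
qed

text \<open>Injectivity is seen on unit sequences, which recover the matrix entries; surjectivity
  inverts the kernel by \<open>exp_shift (-1)\<close>.\<close>

lemma is_wick_isomorphism: "wick_isomorphism B V"
  unfolding wick_isomorphism_def linear_bijection_def
proof (intro conjI ballI allI)
  show "\<exists>!T. wick_extension V a T" if "a \<in> B" for a
    by (simp add: wick_extension_iff[OF that])
  show "bij_betw (Op V) B (cont_lin V)"
    unfolding bij_betw_def
  proof
    show "inj_on (Op V) B"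
    proof
      fix a b assume ab: "a \<in> B" "b \<in> B" "Op V a = Op V b"
      have "M a i j = M b i j" for i j
        using ab unit[of j] matrix_op_unit_seq by (metis Op_eq restrict_apply')
      then show "a = b" by (intro monomial_matrix_wick_kernel_inj ext)
    qed
    show "Op V ` B = cont_lin V"
    proof (intro equalityI subsetI)
      fix T assume "T \<in> Op V ` B"
      then show "T \<in> cont_lin V" using Op_eq B_iff op_in_cont_lin by auto
    next
      fix T assume "T \<in> cont_lin V"
      then obtain m where m: "mat m" "T = restrict (matrix_op m) S" by (rule cont_lin_is_op)
      obtain a where "M a = m" using monomial_matrix_wick_kernel_surj by blast
      with m show "T \<in> Op V ` B" by (intro image_eqI[of _ _ a]) (simp_all add: Op_eq B_iff)
    qed
  qed
  fix a b c d assume a: "a \<in> B" and b: "b \<in> B"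
  have ma: "mat (M a)" and mb: "mat (M b)" using a b B_iff by auto
  show ab: "(\<lambda>k. c * a k + d * b k) \<in> B"
    unfolding B_iff monomial_matrix_linear by (rule mat_lin[OF ma mb])
  \<comment> \<open>\<open>matrix_op_linear\<close> is used with the roles exchanged:
    \<open>F\<close> is taken as the matrix row and the rows of \<open>M a\<close> and
    \<open>M b\<close> as the vectors.\<close>
  have "matrix_op (\<lambda>i j. c * M a i j + d * M b i j) F i = c * matrix_op (M a) F i + d * matrix_op (M b) F i"
    if F: "F \<in> S" for F i
    using matrix_op_linear[of "\<lambda>_. F" i "M a i" "M b i" c d] mat_summable[OF ma F, of i] mat_summable[OF mb F, of i]
    by (simp add: matrix_op_def mult.commute)
  then show "Op V (\<lambda>k. c * a k + d * b k) =
      restrict (\<lambda>F \<alpha>. c * Op V a F \<alpha> + d * Op V b F \<alpha>) (topspace V)"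
    using a b ab by (auto simp: Op_eq monomial_matrix_linear topspace_eq fun_eq_iff)
qed

end

context weight_limit begin

lemma wick_isomorphism_ind:
  assumes B: "\<And>a. a \<in> B \<longleftrightarrow> coef2 a \<in> (\<Inter>r1\<in>{0<..}. \<Union>r2\<in>{0<..}. lp_space p (\<lambda>(\<alpha>, \<beta>). h r1 \<beta> / h r2 \<alpha>))"
  shows "wick_isomorphism B (pullback_topology UNIV coef (ind_lim {0<..} (\<lambda>r. lp_topology p (\<lambda>\<alpha>. 1 / h r \<alpha>))))"
    (is "wick_isomorphism B ?V")
proof -
  let ?w = "\<lambda>n \<alpha>. u n \<alpha> * (1 / sqrt (mfact \<alpha>))"
  interpret K: koethe_weights ?w by (rule koethe_weights_mult) simp
  have "topology_with_zero_nhds ?V (ind_space ?w) (ind_zero_nhd ?w)"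
    using topology_with_zero_nhds_pullback[OF ind_lim_topology]
    by (simp add: ind_zero_nhd_coef_image coef_in_ind_space)
  then interpret matrix_topology ?V "ind_space ?w" "ind_zero_nhd ?w" "ind_matrix ?w"
    by (rule K.ind_matrix_topology)
  interpret wick_space ?V "ind_space ?w" "ind_zero_nhd ?w" "ind_matrix ?w" B
  proof
    show "a \<in> B \<longleftrightarrow> ind_matrix ?w (monomial_matrix (wick_kernel a))" for a
      unfolding B ind_matrix_space_iff ind_matrix_coef[symmetric] ind_matrix_wick_kernel
      by (simp add: coef_matrix_def[abs_def])
  qed
  show ?thesis by (rule is_wick_isomorphism)
qed

lemma wick_isomorphism_proj:
  assumes B: "\<And>a. a \<in> B \<longleftrightarrow> coef2 a \<in> (\<Inter>r2\<in>{0<..}. \<Union>r1\<in>{0<..}. lp_space p (\<lambda>(\<alpha>, \<beta>). h r2 \<alpha> / h r1 \<beta>))"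
  shows "wick_isomorphism B (pullback_topology UNIV coef (proj_lim {0<..} (\<lambda>r. lp_topology p (h r))))"
    (is "wick_isomorphism B ?V")
proof -
  let ?w = "\<lambda>n \<alpha>. u n \<alpha> * sqrt (mfact \<alpha>)"
  interpret K: koethe_weights ?w by (rule koethe_weights_mult) simp
  have "topology_with_zero_nhds ?V (proj_space ?w) (proj_zero_nhd ?w)"
    using topology_with_zero_nhds_pullback[OF proj_lim_topology]
    by (simp add: proj_zero_nhd_coef_image coef_in_proj_space)
  then interpret matrix_topology ?V "proj_space ?w" "proj_zero_nhd ?w" "proj_matrix ?w"
    by (rule K.proj_matrix_topology)
  interpret wick_space ?V "proj_space ?w" "proj_zero_nhd ?w" "proj_matrix ?w" B
  proof
    show "a \<in> B \<longleftrightarrow> proj_matrix ?w (monomial_matrix (wick_kernel a))" for a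
      unfolding B proj_matrix_space_iff proj_matrix_coef[symmetric] proj_matrix_wick_kernel
      by (simp add: coef_matrix_def[abs_def])
  qed
  show ?thesis by (rule is_wick_isomorphism)
qed

end

section \<open>The concrete weights\<close>

lemma ex_Suc_ge: "\<exists>n. x \<le> real n + 1"
  using real_arch_simple[of x] by (meson le_add_same_cancel1 order_trans zero_le_one)

lemma powr_add_le:
  assumes "1 \<le> t" "0 \<le> x" "0 \<le> (y::real)"
  shows "(x + y) powr t \<le> 2 powr t * (x powr t + y powr t)"
proof -
  have "(x + y) powr t \<le> (2 * max x y) powr t" using assms by (intro powr_mono2) auto
  also have "\<dots> = 2 powr t * (max x y) powr t" using assms by (subst powr_mult) auto
  also have "\<dots> \<le> 2 powr t * (x powr t + y powr t)" by (intro mult_left_mono) (auto simp: max_def)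
  finally show ?thesis .
qed

lemma powr_add_ge:
  assumes "1 \<le> t" "0 \<le> x" "0 \<le> (y::real)"
  shows "x powr t + y powr t \<le> 2 * (x + y) powr t"
  using powr_mono2[of t x "x + y"] powr_mono2[of t y "x + y"] assms by simp

text \<open>Restricted to naturals because it fails for reals between 0 and 1 when
  \<open>t > 1\<close>.\<close>

lemma nat_le_powr:
  assumes "1 \<le> t" shows "real k \<le> real k powr t"
  using assms powr_mono[of 1 t "real k"] by (cases "k = 0") auto

text \<open>The scale for \<open>s = 0\<close>: its inductive limit is the space of polynomials, its
  projective limit that of all formal series.\<close>

lemma weight_scale_indicator:
  "weight_scale (\<lambda>n (\<alpha> :: nat ^ 'd::finite). if mdeg \<alpha> \<le> Suc n then 1 else 0 :: real)"
proof
  fix n :: nat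
  show "\<exists>m. 0 < (if mdeg \<alpha> \<le> Suc m then 1 else 0 :: real)" for \<alpha> :: "nat ^ 'd"
    by (intro exI[of _ "mdeg \<alpha>"]) auto
  show "\<exists>m. \<exists>C>0. \<forall>\<alpha> :: nat ^ 'd. M ^ mdeg \<alpha> * (if mdeg \<alpha> \<le> Suc n then 1 else 0) \<le>
      C * (if mdeg \<alpha> \<le> Suc m then 1 else 0 :: real)" if "1 \<le> M" for M
    using that by (intro exI[of _ n] exI[of _ "M ^ Suc n"]) (auto intro!: power_increasing simp del: power_Suc)
  show "\<exists>m. \<exists>C>0. \<forall>\<alpha> \<beta> :: nat ^ 'd. (if mdeg (\<alpha> + \<beta>) \<le> Suc n then 1 else 0 :: real) \<le>
      C * ((if mdeg \<alpha> \<le> Suc m then 1 else 0) * (if mdeg \<beta> \<le> Suc m then 1 else 0))"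
    by (intro exI[of _ n] exI[of _ 1]) (auto simp: mdeg_add)
  show "\<exists>m. \<exists>C>0. \<forall>\<alpha> \<beta> :: nat ^ 'd. (if mdeg \<alpha> \<le> Suc n then 1 else 0 :: real) *
      (if mdeg \<beta> \<le> Suc n then 1 else 0) \<le> C * (if mdeg (\<alpha> + \<beta>) \<le> Suc m then 1 else 0)"
    \<comment> \<open>Two degrees of at most \<open>Suc n\<close> add up to at most
      \<open>2 * Suc n = Suc (2 * n + 1)\<close>.\<close>
    by (intro exI[of _ "2 * n + 1"] exI[of _ 1]) (auto simp: mdeg_add)
qed auto

text \<open>For \<open>t \<ge> 1\<close> the factor \<open>M ^ k\<close> is at most
  \<open>exp (ln M * k powr t)\<close>, which merely raises the coefficient of
  \<open>k powr t\<close>.\<close>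

lemma weight_scale_exp:
  assumes t: "1 \<le> t"
  shows "weight_scale (\<lambda>n (\<alpha> :: nat ^ 'd::finite). exp ((real n + 1) * real (mdeg \<alpha>) powr t))"
proof
  fix n :: nat
  show "exp ((real n + 1) * real (mdeg \<alpha>) powr t) \<le> exp ((real m + 1) * real (mdeg \<alpha>) powr t)"
    if "n \<le> m" for m and \<alpha> :: "nat ^ 'd" using that by (auto intro: mult_right_mono)
  show "\<exists>m. \<exists>C>0. \<forall>\<alpha> :: nat ^ 'd. M ^ mdeg \<alpha> * exp ((real n + 1) * real (mdeg \<alpha>) powr t) \<le>
      C * exp ((real m + 1) * real (mdeg \<alpha>) powr t)" if M: "1 \<le> M" for M
  proof -
    obtain m where m: "ln M + n \<le> real m" using real_arch_simple by blast
    have "M ^ mdeg \<alpha> * exp ((real n + 1) * real (mdeg \<alpha>) powr t) \<le>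
        1 * exp ((real m + 1) * real (mdeg \<alpha>) powr t)" for \<alpha> :: "nat ^ 'd"
    proof -
      have "M ^ mdeg \<alpha> = exp (real (mdeg \<alpha>) * ln M)" using M by (simp add: exp_of_nat_mult)
      also have "\<dots> \<le> exp (real (mdeg \<alpha>) powr t * ln M)"
        using M nat_le_powr[OF t] by (simp add: mult_right_mono)
      finally have "M ^ mdeg \<alpha> * exp ((real n + 1) * real (mdeg \<alpha>) powr t) \<le>
          exp (real (mdeg \<alpha>) powr t * ln M) * exp ((real n + 1) * real (mdeg \<alpha>) powr t)"
        by (rule mult_right_mono) simp
      also have "\<dots> = exp ((ln M + n + 1) * real (mdeg \<alpha>) powr t)"
        by (simp add: algebra_simps flip: exp_add)
      also have "\<dots> \<le> exp ((real m + 1) * real (mdeg \<alpha>) powr t)" using m by (auto intro: mult_right_mono)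
      finally show ?thesis by simp
    qed
    then show ?thesis using zero_less_one by blast
  qed
  show "\<exists>m. \<exists>C>0. \<forall>\<alpha> \<beta> :: nat ^ 'd. exp ((real n + 1) * real (mdeg (\<alpha> + \<beta>)) powr t) \<le>
      C * (exp ((real m + 1) * real (mdeg \<alpha>) powr t) * exp ((real m + 1) * real (mdeg \<beta>) powr t))"
  proof -
    obtain m where m: "(real n + 1) * 2 powr t \<le> real m + 1" using ex_Suc_ge by blast
    have "(real n + 1) * real (mdeg (\<alpha> + \<beta>)) powr t \<le>
        (real m + 1) * real (mdeg \<alpha>) powr t + (real m + 1) * real (mdeg \<beta>) powr t" for \<alpha> \<beta> :: "nat ^ 'd"
    proof -
      have "(real n + 1) * real (mdeg (\<alpha> + \<beta>)) powr t \<le>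
          (real n + 1) * (2 powr t * (real (mdeg \<alpha>) powr t + real (mdeg \<beta>) powr t))"
        using powr_add_le[OF t, of "mdeg \<alpha>" "mdeg \<beta>"] by (intro mult_left_mono) (auto simp: mdeg_add)
      also have "\<dots> = (real n + 1) * 2 powr t * (real (mdeg \<alpha>) powr t + real (mdeg \<beta>) powr t)" by simp
      also have "\<dots> \<le> (real m + 1) * (real (mdeg \<alpha>) powr t + real (mdeg \<beta>) powr t)"
        using m by (intro mult_right_mono) auto
      finally show ?thesis by (simp add: algebra_simps)
    qed
    then show ?thesis by (intro exI[of _ m] exI[of _ 1]) (simp flip: exp_add)
  qed
  show "\<exists>m. \<exists>C>0. \<forall>\<alpha> \<beta> :: nat ^ 'd. exp ((real n + 1) * real (mdeg \<alpha>) powr t) *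
      exp ((real n + 1) * real (mdeg \<beta>) powr t) \<le> C * exp ((real m + 1) * real (mdeg (\<alpha> + \<beta>)) powr t)"
  proof -
    have "(real n + 1) * real (mdeg \<alpha>) powr t + (real n + 1) * real (mdeg \<beta>) powr t \<le>
        (real (2 * n + 1) + 1) * real (mdeg (\<alpha> + \<beta>)) powr t" for \<alpha> \<beta> :: "nat ^ 'd"
      using mult_left_mono[OF powr_add_ge[OF t, of "mdeg \<alpha>" "mdeg \<beta>"], of "real n + 1"]
      by (simp add: algebra_simps mdeg_add)
    then show ?thesis by (intro exI[of _ "2 * n + 1"] exI[of _ 1]) (simp flip: exp_add)
  qed
qed auto

text \<open>Half of the exponent is given up to absorb \<open>M ^ k\<close>: for
  \<open>t > 1\<close>, \<open>k * ln M\<close> is eventually below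
  \<open>k powr t / (2 * n + 2)\<close>. For \<open>t = 1\<close> this would fail for large
  \<open>M\<close>. The index \<open>2 * n + 1\<close> has exactly the halved rate.\<close>

lemma weight_scale_exp_minus:
  assumes t: "1 < t"
  shows "weight_scale (\<lambda>n (\<alpha> :: nat ^ 'd::finite). exp (- (real (mdeg \<alpha>) powr t / (real n + 1))))"
proof
  fix n :: nat
  have half: "x / (2 * real n + 2) + x / (2 * real n + 2) = x / (real n + 1)" for x
  proof -
    have "x / (2 * real n + 2) = x / (real n + 1) / 2" by (simp add: algebra_simps)
    then show ?thesis by (simp only: field_sum_of_halves)
  qed
  have split_exp: "exp (- z) \<le> 1 * (exp (- x) * exp (- y))" if "x + y \<le> z" for x y z :: real
    using that by (simp flip: exp_add)
  have join_exp: "exp (- x) * exp (- y) \<le> 1 * exp (- z)" if "z \<le> x + y" for x y z :: real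
    using that by (simp flip: exp_add)
  show "exp (- (real (mdeg \<alpha>) powr t / (real n + 1))) \<le> exp (- (real (mdeg \<alpha>) powr t / (real m + 1)))"
    if "n \<le> m" for m and \<alpha> :: "nat ^ 'd" using that by (auto intro: divide_left_mono)
  show "\<exists>m. \<exists>C>0. \<forall>\<alpha> :: nat ^ 'd. M ^ mdeg \<alpha> * exp (- (real (mdeg \<alpha>) powr t / (real n + 1))) \<le>
      C * exp (- (real (mdeg \<alpha>) powr t / (real m + 1)))" if M: "1 \<le> M" for M
  proof -
    define L where "L = ln M * (2 * real n + 2)"
    \<comment> \<open>The point at which \<open>k * ln M = k powr t / (2 * n + 2)\<close>; below it
      the excess is at most the constant \<open>k0 * ln M\<close>.\<close>
    define k0 where "k0 = L powr (1 / (t - 1))"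
    have L: "0 \<le> L" using M by (simp add: L_def)
    have "real k * ln M \<le> k0 * ln M + real k powr t / (2 * real n + 2)" for k
    proof (cases "real k \<le> k0")
      case True
      then have "real k * ln M \<le> k0 * ln M" using M by (intro mult_right_mono) auto
      then show ?thesis by (simp add: add_increasing2)
    next
      case False
      have "0 \<le> k0" by (simp add: k0_def)
      with False have k: "k0 < real k" "0 < real k" by linarith+
      have "L = k0 powr (t - 1)" using t L by (simp add: k0_def powr_powr)
      also have "\<dots> \<le> real k powr (t - 1)" using k t by (intro powr_mono2) (auto simp: k0_def)
      finally have "real k * L \<le> real k * real k powr (t - 1)" by (intro mult_left_mono) auto
      also have "\<dots> = real k powr t" using k(2) powr_mult_base[of "real k" "t - 1"] by simp
      finally have "real k * ln M \<le> real k powr t / (2 * real n + 2)" by (simp add: L_def field_simps)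
      moreover have "0 \<le> k0 * ln M" using M by (simp add: k0_def)
      ultimately show ?thesis by linarith
    qed
    note key = this
    have "M ^ mdeg \<alpha> * exp (- (real (mdeg \<alpha>) powr t / (real n + 1))) \<le>
        exp (k0 * ln M) * exp (- (real (mdeg \<alpha>) powr t / (real (2 * n + 1) + 1)))" for \<alpha> :: "nat ^ 'd"
    proof -
      define X where "X = real (mdeg \<alpha>) powr t / (2 * real n + 2)"
      have "M ^ mdeg \<alpha> = exp (real (mdeg \<alpha>) * ln M)" using M by (simp add: exp_of_nat_mult)
      then have "M ^ mdeg \<alpha> * exp (- (real (mdeg \<alpha>) powr t / (real n + 1))) =
          exp (real (mdeg \<alpha>) * ln M + - (X + X))"
        unfolding exp_add X_def half by simp
      also have "\<dots> \<le> exp (k0 * ln M + - X)" using key[of "mdeg \<alpha>"] by (simp add: X_def[symmetric])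
      also have "\<dots> = exp (k0 * ln M) * exp (- (real (mdeg \<alpha>) powr t / (real (2 * n + 1) + 1)))"
        unfolding exp_add X_def by (simp add: add.commute)
      finally show ?thesis .
    qed
    then show ?thesis by (intro exI[of _ "2 * n + 1"] exI[of _ "exp (k0 * ln M)"]) auto
  qed
  show "\<exists>m. \<exists>C>0. \<forall>\<alpha> \<beta> :: nat ^ 'd. exp (- (real (mdeg (\<alpha> + \<beta>)) powr t / (real n + 1))) \<le>
      C * (exp (- (real (mdeg \<alpha>) powr t / (real m + 1))) * exp (- (real (mdeg \<beta>) powr t / (real m + 1))))"
  proof -
    have "real (mdeg \<alpha>) powr t / (real (2 * n + 1) + 1) + real (mdeg \<beta>) powr t / (real (2 * n + 1) + 1) \<le>
        real (mdeg (\<alpha> + \<beta>)) powr t / (real n + 1)" for \<alpha> \<beta> :: "nat ^ 'd"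
    proof -
      have "real (mdeg \<alpha>) powr t + real (mdeg \<beta>) powr t \<le> 2 * real (mdeg (\<alpha> + \<beta>)) powr t"
        using powr_add_ge[of t "mdeg \<alpha>" "mdeg \<beta>"] t by (simp add: mdeg_add)
      from divide_right_mono[OF this, of "2 * real n + 2"]
      have "real (mdeg \<alpha>) powr t / (2 * real n + 2) + real (mdeg \<beta>) powr t / (2 * real n + 2) \<le>
          real (mdeg (\<alpha> + \<beta>)) powr t / (2 * real n + 2) + real (mdeg (\<alpha> + \<beta>)) powr t / (2 * real n + 2)"
        by (simp only: add_divide_distrib mult_2)
      moreover have "real (2 * n + 1) + 1 = 2 * real n + 2" by simp
      ultimately show ?thesis by (simp only: half)
    qed
    then show ?thesis by (intro exI[of _ "2 * n + 1"] exI[of _ 1] conjI allI zero_less_one split_exp)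
  qed
  show "\<exists>m. \<exists>C>0. \<forall>\<alpha> \<beta> :: nat ^ 'd. exp (- (real (mdeg \<alpha>) powr t / (real n + 1))) *
      exp (- (real (mdeg \<beta>) powr t / (real n + 1))) \<le> C * exp (- (real (mdeg (\<alpha> + \<beta>)) powr t / (real m + 1)))"
  proof -
    \<comment> \<open>The factor \<open>2 powr t\<close> lost in \<open>powr_add_le\<close> is paid
      for by a slower rate.\<close>
    obtain m where m: "(real n + 1) * 2 powr t \<le> real m + 1" using ex_Suc_ge by blast
    have "real (mdeg (\<alpha> + \<beta>)) powr t / (real m + 1) \<le>
        real (mdeg \<alpha>) powr t / (real n + 1) + real (mdeg \<beta>) powr t / (real n + 1)" for \<alpha> \<beta> :: "nat ^ 'd"
    proof -
      have "real (mdeg (\<alpha> + \<beta>)) powr t / (real m + 1) \<le>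
          (2 powr t * (real (mdeg \<alpha>) powr t + real (mdeg \<beta>) powr t)) / ((real n + 1) * 2 powr t)"
        using powr_add_le[of t "mdeg \<alpha>" "mdeg \<beta>"] t m by (intro frac_le) (auto simp: mdeg_add)
      also have "\<dots> = (real (mdeg \<alpha>) powr t + real (mdeg \<beta>) powr t) / (real n + 1)" by simp
      finally show ?thesis by (simp add: add_divide_distrib)
    qed
    then show ?thesis by (intro exI[of _ m] exI[of _ 1] conjI allI zero_less_one join_exp)
  qed
qed auto

text \<open>The quotient of \<open>x\<close> by \<open>y\<close> lies between 1 and
  \<open>2 ^ k\<close>, so its powers with exponents \<open>\<tau>\<close> and
  \<open>- \<tau>\<close> obey the same bound. Hence \<open>\<tau>\<close> may have either
  sign.\<close>

lemma powr_ratio_le: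
  assumes "0 < y" "y \<le> x" "x \<le> 2 ^ k * (y::real)"
  shows "x powr \<tau> \<le> (2 powr \<bar>\<tau>\<bar>) ^ k * y powr \<tau>" "y powr \<tau> \<le> (2 powr \<bar>\<tau>\<bar>) ^ k * x powr \<tau>"
proof -
  define q where "q = x / y"
  have q: "1 \<le> q" "q \<le> 2 ^ k" "x = q * y" using assms by (auto simp: q_def field_simps)
  have bound: "q powr \<sigma> \<le> (2 powr \<bar>\<tau>\<bar>) ^ k" if "\<bar>\<sigma>\<bar> = \<bar>\<tau>\<bar>" for \<sigma>
  proof -
    have "q powr \<sigma> \<le> q powr \<bar>\<tau>\<bar>" using q(1) that by (intro powr_mono) auto
    also have "\<dots> \<le> (2 ^ k) powr \<bar>\<tau>\<bar>" using q by (intro powr_mono2) auto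
    also have "\<dots> = (2 powr \<bar>\<tau>\<bar>) ^ k" by (simp add: powr_powr mult.commute flip: powr_realpow)
    finally show ?thesis .
  qed
  show "x powr \<tau> \<le> (2 powr \<bar>\<tau>\<bar>) ^ k * y powr \<tau>"
    using bound[of \<tau>] q assms(1) by (simp add: powr_mult mult_right_mono)
  have "y powr \<tau> = q powr (- \<tau>) * x powr \<tau>"
    using q assms(1) by (simp add: powr_mult powr_minus)
  also have "\<dots> \<le> (2 powr \<bar>\<tau>\<bar>) ^ k * x powr \<tau>" using bound[of "- \<tau>"] by (intro mult_right_mono) auto
  finally show "y powr \<tau> \<le> (2 powr \<bar>\<tau>\<bar>) ^ k * x powr \<tau>" .
qed

lemma mfact_add_le: "mfact (\<alpha> + \<beta>) \<le> 2 ^ mdeg (\<alpha> + \<beta>) * (mfact \<alpha> * mfact \<beta>)"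
  using mfact_le_binomial[of \<alpha> "\<alpha> + \<beta>"] by (simp add: less_eq_vec_def)

text \<open>The base \<open>n + 1\<close> absorbs powers by growing, so both signs of
  \<open>\<tau>\<close> are admissible, and with them flat weights as well as their
  inverses.\<close>

lemma weight_scale_factorial:
  "weight_scale (\<lambda>n (\<alpha> :: nat ^ 'd::finite). (real n + 1) ^ mdeg \<alpha> * mfact \<alpha> powr \<tau>)"
proof
  fix n :: nat
  show "0 \<le> (real n + 1) ^ mdeg \<alpha> * mfact \<alpha> powr \<tau>" for \<alpha> :: "nat ^ 'd" by simp
  show "(real n + 1) ^ mdeg \<alpha> * mfact \<alpha> powr \<tau> \<le> (real m + 1) ^ mdeg \<alpha> * mfact \<alpha> powr \<tau>"
    if "n \<le> m" for m and \<alpha> :: "nat ^ 'd"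
    using that by (intro mult_right_mono power_mono) auto
  show "\<exists>n. 0 < (real n + 1) ^ mdeg \<alpha> * mfact \<alpha> powr \<tau>" for \<alpha> :: "nat ^ 'd"
    by (intro exI[of _ 0]) simp
  show "\<exists>m. \<exists>C>0. \<forall>\<alpha> :: nat ^ 'd. M ^ mdeg \<alpha> * ((real n + 1) ^ mdeg \<alpha> * mfact \<alpha> powr \<tau>) \<le>
      C * ((real m + 1) ^ mdeg \<alpha> * mfact \<alpha> powr \<tau>)" if M: "1 \<le> M" for M
  proof -
    obtain m where m: "M * (real n + 1) \<le> real m + 1" using ex_Suc_ge by blast
    have "M ^ mdeg \<alpha> * ((real n + 1) ^ mdeg \<alpha> * mfact \<alpha> powr \<tau>) \<le>
        1 * ((real m + 1) ^ mdeg \<alpha> * mfact \<alpha> powr \<tau>)" for \<alpha> :: "nat ^ 'd"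
    proof -
      have "(M * (real n + 1)) ^ mdeg \<alpha> \<le> (real m + 1) ^ mdeg \<alpha>" using m M by (intro power_mono) auto
      from mult_right_mono[OF this, of "mfact \<alpha> powr \<tau>"] show ?thesis
        by (simp add: power_mult_distrib mult.assoc)
    qed
    then show ?thesis using zero_less_one by blast
  qed
  \<comment> \<open>One \<open>m\<close> serves for splitting and for joining, since the ratio
    estimate is symmetric.\<close>
  obtain m where m: "(real n + 1) * 2 powr \<bar>\<tau>\<bar> \<le> real m + 1" using ex_Suc_ge by blast
  have pow: "(real n + 1) ^ k * (2 powr \<bar>\<tau>\<bar>) ^ k \<le> (real m + 1) ^ k" for k
    using power_mono[OF m, of k] by (simp add: power_mult_distrib)
  note ratio = powr_ratio_le[OF _ mfact_add_ge mfact_add_le, of _ _ \<tau>]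
  have "(real n + 1) ^ mdeg (\<alpha> + \<beta>) * mfact (\<alpha> + \<beta>) powr \<tau> \<le>
      1 * (((real m + 1) ^ mdeg \<alpha> * mfact \<alpha> powr \<tau>) * ((real m + 1) ^ mdeg \<beta> * mfact \<beta> powr \<tau>))" for \<alpha> \<beta> :: "nat ^ 'd"
  proof -
    have "(real n + 1) ^ mdeg (\<alpha> + \<beta>) * mfact (\<alpha> + \<beta>) powr \<tau> \<le>
        (real n + 1) ^ mdeg (\<alpha> + \<beta>) * ((2 powr \<bar>\<tau>\<bar>) ^ mdeg (\<alpha> + \<beta>) * (mfact \<alpha> * mfact \<beta>) powr \<tau>)"
      by (intro mult_left_mono ratio) auto
    also have "\<dots> \<le> (real m + 1) ^ mdeg (\<alpha> + \<beta>) * (mfact \<alpha> * mfact \<beta>) powr \<tau>"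
      using mult_right_mono[OF pow[of "mdeg (\<alpha> + \<beta>)"], of "(mfact \<alpha> * mfact \<beta>) powr \<tau>"] by (simp add: mult.assoc)
    also have "\<dots> = 1 * (((real m + 1) ^ mdeg \<alpha> * mfact \<alpha> powr \<tau>) * ((real m + 1) ^ mdeg \<beta> * mfact \<beta> powr \<tau>))"
      by (simp add: mdeg_add power_add powr_mult less_imp_le[OF mfact_pos])
    finally show ?thesis .
  qed
  then show "\<exists>m. \<exists>C>0. \<forall>\<alpha> \<beta> :: nat ^ 'd. (real n + 1) ^ mdeg (\<alpha> + \<beta>) * mfact (\<alpha> + \<beta>) powr \<tau> \<le>
      C * (((real m + 1) ^ mdeg \<alpha> * mfact \<alpha> powr \<tau>) * ((real m + 1) ^ mdeg \<beta> * mfact \<beta> powr \<tau>))"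
    using zero_less_one by blast
  have "((real n + 1) ^ mdeg \<alpha> * mfact \<alpha> powr \<tau>) * ((real n + 1) ^ mdeg \<beta> * mfact \<beta> powr \<tau>) \<le>
      1 * ((real m + 1) ^ mdeg (\<alpha> + \<beta>) * mfact (\<alpha> + \<beta>) powr \<tau>)" for \<alpha> \<beta> :: "nat ^ 'd"
  proof -
    have "((real n + 1) ^ mdeg \<alpha> * mfact \<alpha> powr \<tau>) * ((real n + 1) ^ mdeg \<beta> * mfact \<beta> powr \<tau>) =
        (real n + 1) ^ mdeg (\<alpha> + \<beta>) * (mfact \<alpha> * mfact \<beta>) powr \<tau>"
      by (simp add: mdeg_add power_add powr_mult less_imp_le[OF mfact_pos])
    also have "\<dots> \<le> (real n + 1) ^ mdeg (\<alpha> + \<beta>) * ((2 powr \<bar>\<tau>\<bar>) ^ mdeg (\<alpha> + \<beta>) * mfact (\<alpha> + \<beta>) powr \<tau>)"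
      by (intro mult_left_mono ratio) auto
    also have "\<dots> \<le> (real m + 1) ^ mdeg (\<alpha> + \<beta>) * mfact (\<alpha> + \<beta>) powr \<tau>"
      using mult_right_mono[OF pow[of "mdeg (\<alpha> + \<beta>)"], of "mfact (\<alpha> + \<beta>) powr \<tau>"] by (simp add: mult.assoc)
    finally show ?thesis by simp
  qed
  then show "\<exists>m. \<exists>C>0. \<forall>\<alpha> \<beta> :: nat ^ 'd. ((real n + 1) ^ mdeg \<alpha> * mfact \<alpha> powr \<tau>) *
      ((real n + 1) ^ mdeg \<beta> * mfact \<beta> powr \<tau>) \<le> C * ((real m + 1) ^ mdeg (\<alpha> + \<beta>) * mfact (\<alpha> + \<beta>) powr \<tau>)"
    using zero_less_one by blast
qed

lemma one_divide_ennreal: "0 < x \<Longrightarrow> 1 / ennreal x = ennreal (1 / x)"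
  using divide_ennreal[of 1 x] by simp

text \<open>For \<open>s \<noteq> Num 0\<close> the inverse weights increase as \<open>r\<close>
  decreases, so \<open>u n\<close> is taken at \<open>r = 1 / (n + 1)\<close>. For
  \<open>s = Num 0\<close> they are indicators that increase with \<open>r\<close>, and
  \<open>u n\<close> is taken at \<open>r = n + 1\<close>.\<close>

lemma weight_limit_inverse_weight:
  assumes p: "0 < p" and s: "s \<in> Rflat_bar" "s < Num (1/2)"
  obtains u where "weight_limit u (\<lambda>r (\<alpha> :: nat ^ 'd::finite). 1 / weight r s \<alpha>) p"
proof -
  have inv_le: "1 / (real n + 1) \<le> r" if "1 / r \<le> real n + 1" "0 < r" for n r
    using that by (simp add: field_simps)
  consider "s = Num 0" | x where "s = Num x" "0 < x" "x < 1/2" | \<sigma> where "s = Flat \<sigma>" "0 < \<sigma>"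
  proof (cases s)
    case (Num x)
    with s that show ?thesis by (cases "x = 0") (auto simp: Rflat_bar_def)
  qed (use s that in \<open>auto simp: Rflat_bar_def\<close>)
  then show thesis
  proof cases
    case 1
    have "cofinal_weights (\<lambda>n (\<alpha> :: nat ^ 'd). if mdeg \<alpha> \<le> Suc n then 1 else 0) (\<lambda>r \<alpha>. 1 / weight r s \<alpha>)"
      unfolding cofinal_weights_def
    proof (intro conjI allI impI)
      fix n :: nat
      show "\<exists>r>0. \<forall>\<alpha> :: nat ^ 'd. ennreal (if mdeg \<alpha> \<le> Suc n then 1 else 0) \<le> 1 / weight r s \<alpha>"
        by (intro exI[of _ "real (Suc n)"]) (auto simp: 1)
    next
      fix r :: real
      obtain n where "r \<le> real n + 1" using ex_Suc_ge by blast
      then show "\<exists>n. \<forall>\<alpha> :: nat ^ 'd. 1 / weight r s \<alpha> \<le> ennreal (if mdeg \<alpha> \<le> Suc n then 1 else 0)"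
        by (intro exI[of _ n]) (auto simp: 1)
    qed
    with weight_scale_indicator p show thesis
      by (intro that weight_limit.intro weight_limit_axioms.intro)
  next
    case (2 x)
    have w: "1 / weight r s \<alpha> = ennreal (exp (- (r * real (mdeg \<alpha>) powr (1 / (2 * x)))))" for r and \<alpha> :: "nat ^ 'd"
      using 2 by (simp add: one_divide_ennreal exp_minus inverse_eq_divide)
    have "cofinal_weights (\<lambda>n (\<alpha> :: nat ^ 'd). exp (- (real (mdeg \<alpha>) powr (1 / (2 * x)) / (real n + 1)))) (\<lambda>r \<alpha>. 1 / weight r s \<alpha>)"
      unfolding cofinal_weights_def w
    proof (intro conjI allI impI)
      fix n :: nat
      show "\<exists>r>0. \<forall>\<alpha> :: nat ^ 'd. ennreal (exp (- (real (mdeg \<alpha>) powr (1 / (2 * x)) / (real n + 1)))) \<le>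
          ennreal (exp (- (r * real (mdeg \<alpha>) powr (1 / (2 * x)))))"
        by (intro exI[of _ "1 / (real n + 1)"]) auto
    next
      fix r :: real assume r: "0 < r"
      obtain n where n: "1 / r \<le> real n + 1" using ex_Suc_ge by blast
      have "real (mdeg \<alpha>) powr (1 / (2 * x)) / (real n + 1) \<le> r * real (mdeg \<alpha>) powr (1 / (2 * x))" for \<alpha> :: "nat ^ 'd"
        using mult_right_mono[OF inv_le[OF n r], of "real (mdeg \<alpha>) powr (1 / (2 * x))"] by simp
      then show "\<exists>n. \<forall>\<alpha> :: nat ^ 'd. ennreal (exp (- (r * real (mdeg \<alpha>) powr (1 / (2 * x))))) \<le>
          ennreal (exp (- (real (mdeg \<alpha>) powr (1 / (2 * x)) / (real n + 1))))"
        by (intro exI[of _ n] allI ennreal_leI) simp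
    qed
    moreover have "1 < 1 / (2 * x)" using 2 by (simp add: field_simps)
    ultimately show thesis using weight_scale_exp_minus p
      by (intro that weight_limit.intro weight_limit_axioms.intro)
  next
    case (3 \<sigma>)
    have w: "1 / weight r s \<alpha> = ennreal ((1 / r) ^ mdeg \<alpha> * mfact \<alpha> powr (- 1 / (2 * \<sigma>)))" if "r > 0" for r and \<alpha> :: "nat ^ 'd"
      using 3 that by (simp add: one_divide_ennreal powr_minus_divide power_one_over)
    have "cofinal_weights (\<lambda>n (\<alpha> :: nat ^ 'd). (real n + 1) ^ mdeg \<alpha> * mfact \<alpha> powr (- 1 / (2 * \<sigma>))) (\<lambda>r \<alpha>. 1 / weight r s \<alpha>)"
      unfolding cofinal_weights_def
    proof (intro conjI allI impI)
      fix n :: nat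
      show "\<exists>r>0. \<forall>\<alpha> :: nat ^ 'd. ennreal ((real n + 1) ^ mdeg \<alpha> * mfact \<alpha> powr (- 1 / (2 * \<sigma>))) \<le> 1 / weight r s \<alpha>"
        by (intro exI[of _ "1 / (real n + 1)"] conjI allI) (simp_all add: w del: weight.simps)
    next
      fix r :: real assume r: "0 < r"
      obtain n where n: "1 / r \<le> real n + 1" using ex_Suc_ge by blast
      have "1 / weight r s \<alpha> \<le> ennreal ((real n + 1) ^ mdeg \<alpha> * mfact \<alpha> powr (- 1 / (2 * \<sigma>)))" for \<alpha> :: "nat ^ 'd"
        unfolding w[OF r] using n r by (intro ennreal_leI mult_right_mono power_mono) auto
      then show "\<exists>n. \<forall>\<alpha> :: nat ^ 'd. 1 / weight r s \<alpha> \<le> ennreal ((real n + 1) ^ mdeg \<alpha> * mfact \<alpha> powr (- 1 / (2 * \<sigma>)))"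
        by blast
    qed
    with weight_scale_factorial p show thesis
      by (intro that weight_limit.intro weight_limit_axioms.intro)
  qed
qed

text \<open>These weights increase with \<open>r\<close>, so \<open>u n\<close> is the weight at
  \<open>r = n + 1\<close>.\<close>

lemma weight_limit_weight:
  assumes p: "0 < p" and s: "s \<in> Rflat_bar" "s \<le> Num (1/2)" "s \<noteq> Num 0"
  obtains u where "weight_limit u (\<lambda>r (\<alpha> :: nat ^ 'd::finite). weight r s \<alpha>) p"
proof -
  consider x where "s = Num x" "0 < x" "x \<le> 1/2" | \<sigma> where "s = Flat \<sigma>" "0 < \<sigma>"
  proof (cases s)
    case (Num x)
    with s have "0 < x" "x \<le> 1/2" by (auto simp: Rflat_bar_def less_eq_rflat_def)
    with Num that show ?thesis by blast
  qed (use s that in \<open>auto simp: Rflat_bar_def\<close>)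
  then show thesis
  proof cases
    case (1 x)
    have "cofinal_weights (\<lambda>n (\<alpha> :: nat ^ 'd). exp ((real n + 1) * real (mdeg \<alpha>) powr (1 / (2 * x)))) (\<lambda>r. weight r s)"
      unfolding cofinal_weights_def
    proof (intro conjI allI impI)
      fix n :: nat
      show "\<exists>r>0. \<forall>\<alpha> :: nat ^ 'd. ennreal (exp ((real n + 1) * real (mdeg \<alpha>) powr (1 / (2 * x)))) \<le> weight r s \<alpha>"
        using 1 by (intro exI[of _ "real n + 1"]) auto
    next
      fix r :: real assume r: "0 < r"
      obtain n where n: "r \<le> real n + 1" using ex_Suc_ge by blast
      then show "\<exists>n. \<forall>\<alpha> :: nat ^ 'd. weight r s \<alpha> \<le> ennreal (exp ((real n + 1) * real (mdeg \<alpha>) powr (1 / (2 * x))))"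
        using 1 by (intro exI[of _ n]) (auto intro!: ennreal_leI mult_right_mono)
    qed
    moreover have "1 \<le> 1 / (2 * x)" using 1 by (simp add: field_simps)
    ultimately show thesis using weight_scale_exp p
      by (intro that weight_limit.intro weight_limit_axioms.intro)
  next
    case (2 \<sigma>)
    have "cofinal_weights (\<lambda>n (\<alpha> :: nat ^ 'd). (real n + 1) ^ mdeg \<alpha> * mfact \<alpha> powr (1 / (2 * \<sigma>))) (\<lambda>r. weight r s)"
      unfolding cofinal_weights_def
    proof (intro conjI allI impI)
      fix n :: nat
      show "\<exists>r>0. \<forall>\<alpha> :: nat ^ 'd. ennreal ((real n + 1) ^ mdeg \<alpha> * mfact \<alpha> powr (1 / (2 * \<sigma>))) \<le> weight r s \<alpha>"
        using 2 by (intro exI[of _ "real n + 1"]) auto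
    next
      fix r :: real assume r: "0 < r"
      obtain n where n: "r \<le> real n + 1" using ex_Suc_ge by blast
      then show "\<exists>n. \<forall>\<alpha> :: nat ^ 'd. weight r s \<alpha> \<le> ennreal ((real n + 1) ^ mdeg \<alpha> * mfact \<alpha> powr (1 / (2 * \<sigma>)))"
        using 2 r by (intro exI[of _ n]) (auto intro!: ennreal_leI mult_right_mono power_mono)
    qed
    with weight_scale_factorial p show thesis
      by (intro that weight_limit.intro weight_limit_axioms.intro)
  qed
qed

text \<open>On the zero space there is exactly one map, and it is the restriction of every Wick
  operator.\<close>

lemma wick_isomorphism_trivial:
  assumes V: "topspace V = {\<lambda>_. 0 :: complex}"
  shows "wick_isomorphism {\<lambda>_. 0 :: complex} (V :: 'd::finite series topology)"
proof -
  let ?T = "restrict (\<lambda>_ _. 0) {\<lambda>_. 0} :: 'd series \<Rightarrow> 'd series"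
  have eq: "T = ?T" if "T \<in> extensional (topspace V)" "continuous_map V V T" for T
  proof (rule extensionalityI[of _ "topspace V"])
    show "T x = ?T x" if "x \<in> topspace V" for x
      using continuous_map_image_subset_topspace[OF \<open>continuous_map V V T\<close>] that by (auto simp: V)
  qed (use that V in auto)
  have cont: "continuous_map V V ?T"
  proof (rule continuous_map_eq)
    show "continuous_map V V (\<lambda>_ _. 0)" by (simp add: V)
  qed (simp add: V)
  have wick: "wick_op a (\<lambda>_. 0) = (\<lambda>_. 0)" for a :: "'d series2"
    by (simp add: wick_op_def coef_def)
  have iff: "wick_extension V a T \<longleftrightarrow> T = ?T" for a T
    using eq[of T] cont wick unfolding wick_extension_def by (auto simp: V)
  have L: "cont_lin V = {?T}"
    using eq cont by (auto simp: cont_lin_def V)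
  have Op: "Op V a = ?T" for a
    unfolding Op_def by (rule the_equality) (simp_all add: iff)
  have lin: "?T = restrict (\<lambda>F \<alpha>. c * ?T F \<alpha> + d * ?T F \<alpha>) {\<lambda>_. 0}" for c d
    by (rule restrict_ext) simp
  show ?thesis
    unfolding wick_isomorphism_def linear_bijection_def Op V
  proof (intro conjI ballI allI)
    show "\<exists>!T. wick_extension V a T" for a unfolding iff by blast
    show "bij_betw (\<lambda>a. ?T) {\<lambda>_. 0} (cont_lin V)" unfolding L by (simp add: bij_betw_def)
    show "(\<lambda>k. c * a k + d * b k) \<in> {\<lambda>_. 0}" if "a \<in> {\<lambda>_. 0}" "b \<in> {\<lambda>_. 0}" for a b :: "'d series2" and c d
      using that by simp
  qed (rule lin)
qed

text \<open>Holds at 0 and at infinity too, which matters for the weights with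
  \<open>s = 0\<close>.\<close>

lemma one_divide_one_divide_ennreal: "1 / (1 / x) = (x :: ennreal)"
  by (cases x; cases "x = 0") (auto simp: one_divide_ennreal divide_ennreal_def inverse_ennreal less_le)

lemma divide_one_divide_ennreal: "(1 / x) / (1 / y) = y / (x :: ennreal)"
  using one_divide_one_divide_ennreal[of y] by (simp add: divide_ennreal_def mult.commute)

theorem theorem4p8:
  fixes p :: ennreal and s1 s2 :: rflat
  assumes "0 < p"
    and "s1 \<in> Rflat_bar" and "s2 \<in> Rflat_bar"
    and "s1 < Num (1/2)" and "s2 \<le> Num (1/2)"
  shows "wick_isomorphism (B_sp p s1 :: 'd::finite series2 set) (A_sp p s1)
       \<and> wick_isomorphism (B_star p s1 :: 'd series2 set) (A_dual p s1)
       \<and> wick_isomorphism (B0_sp p s2 :: 'd series2 set) (A0_sp p s2)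
       \<and> wick_isomorphism (B0_star p s2 :: 'd series2 set) (A0_dual p s2)"
proof -
  \<comment> \<open>With \<open>h = 1 / weight\<close>, inductive steps have weight
    \<open>1 / h = weight\<close> and give \<open>A_sp\<close>, while projective steps have weight
    \<open>h\<close> and give \<open>A_dual\<close>.\<close>
  obtain u where "weight_limit u (\<lambda>r (\<alpha> :: nat ^ 'd). 1 / weight r s1 \<alpha>) p"
    using weight_limit_inverse_weight[OF assms(1,2,4)] .
  then interpret W1: weight_limit u "\<lambda>r (\<alpha> :: nat ^ 'd). 1 / weight r s1 \<alpha>" p .
  have 1: "wick_isomorphism (B_sp p s1 :: 'd series2 set) (A_sp p s1)"
    using W1.wick_isomorphism_ind[of "B_sp p s1"]
    by (simp add: A_sp_def ell_def B_sp_def ellB_def omega_def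
        one_divide_one_divide_ennreal divide_one_divide_ennreal)
  have 2: "wick_isomorphism (B_star p s1 :: 'd series2 set) (A_dual p s1)"
    using W1.wick_isomorphism_proj[of "B_star p s1"]
    by (simp add: A_dual_def ell_star_def B_star_def ellB_star_def omega_star_def
        divide_one_divide_ennreal)
  have "wick_isomorphism (B0_sp p s2 :: 'd series2 set) (A0_sp p s2) \<and>
      wick_isomorphism (B0_star p s2 :: 'd series2 set) (A0_dual p s2)"
  proof (cases "s2 = Num 0")
    case True
    have coef: "coef F = (\<lambda>_. 0) \<longleftrightarrow> F = (\<lambda>_. 0)" for F :: "'d series"
      by (auto simp: coef_def fun_eq_iff)
    have coef2: "coef2 a = (\<lambda>_. 0) \<longleftrightarrow> a = (\<lambda>_. 0)" for a :: "'d series2"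
      by (auto simp: coef2_def fun_eq_iff)
    have "B0_sp p s2 = ({\<lambda>_. 0} :: 'd series2 set)" "B0_star p s2 = ({\<lambda>_. 0} :: 'd series2 set)"
      by (simp_all add: True B0_sp_def ellB0_def B0_star_def ellB0_star_def coef2)
    moreover have "topspace (A0_sp p s2) = ({\<lambda>_. 0} :: 'd series set)"
      "topspace (A0_dual p s2) = ({\<lambda>_. 0} :: 'd series set)"
      by (auto simp: True A0_sp_def ell0_def A0_dual_def ell0_star_def topspace_pullback_topology coef)
    ultimately show ?thesis by (simp add: wick_isomorphism_trivial)
  next
    case False
    \<comment> \<open>With \<open>h = weight\<close> the roles are exchanged: \<open>A0_sp\<close>
      is the projective limit and \<open>A0_dual\<close> the inductive one.\<close>
    obtain v where "weight_limit v (\<lambda>r (\<alpha> :: nat ^ 'd). weight r s2 \<alpha>) p"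
      using weight_limit_weight[OF assms(1,3,5) False] .
    then interpret W2: weight_limit v "\<lambda>r (\<alpha> :: nat ^ 'd). weight r s2 \<alpha>" p .
    have "wick_isomorphism (B0_sp p s2 :: 'd series2 set) (A0_sp p s2)"
      using W2.wick_isomorphism_proj[of "B0_sp p s2"] False
      by (simp add: A0_sp_def ell0_def B0_sp_def ellB0_def omega_def)
    moreover have "wick_isomorphism (B0_star p s2 :: 'd series2 set) (A0_dual p s2)"
      using W2.wick_isomorphism_ind[of "B0_star p s2"] False
      by (simp add: A0_dual_def ell0_star_def B0_star_def ellB0_star_def omega_star_def)
    ultimately show ?thesis ..
  qed
  with 1 2 show ?thesis by blast
qed

end
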